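(* Let $(R,\mathfrak m,k)$ be an Artinian local ring with canonical module $\omega$. Assume that $2$ is a unit in $R$ and that $\operatorname{Soc}(R)\subseteq \mathfrak m^2$. Then $R$ is the quotient of a zero-dimensional Gorenstein local ring by its socle (that is, $R\cong S/\operatorname{Soc}(S)$ for some zero-dimensional Gorenstein local ring $S$) if and only if there exists a surjective $R$-linear map $f:\omega\to\mathfrak m$.
   Context: All rings are commutative and Noetherian. For an Artinian local ring $(R,\mathfrak m,k)$ the canonical module $\omega$ is the injective hull of the residue field $k$. The socle of a local ring $(A,\mathfrak n)$ is $\operatorname{Soc}(A)=0:_A\mathfrak n$. *)

theory Defs
  imports
    "HOL-Algebra.Module" "HOL-Algebra.Ideal_Product" "HOL-Algebra.Ring_Divisibility"
    "HOL-Library.Extended_Nat"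
begin

section \<open>Local rings\<close>

locale local_ring = cring R + noetherian_ring R + maximalideal \<mm> R
  for R (structure) and \<mm> +
  assumes unique_maximal: "maximalideal I R \<Longrightarrow> I = \<mm>"

locale artinian_local_ring = local_ring +
  assumes descending_chain:
    "\<lbrakk>\<And>n::nat. ideal (I n) R; \<And>n. I (Suc n) \<subseteq> I n\<rbrakk> \<Longrightarrow> \<exists>n. \<forall>k\<ge>n. I k = I n"

text \<open>The socle \<open>0 :\<^sub>R \<mm>\<close> of a local ring with maximal ideal \<open>\<mm>\<close>.\<close>

definition socle :: "('a, 'm) ring_scheme \<Rightarrow> 'a set \<Rightarrow> 'a set" where
  "socle R \<mm> = {a \<in> carrier R. \<forall>x\<in>\<mm>. a \<otimes>\<^bsub>R\<^esub> x = \<zero>\<^bsub>R\<^esub>}"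

definition krull_dim :: "('a, 'm) ring_scheme \<Rightarrow> enat" where
  "krull_dim R = (SUP n \<in> {n. \<exists>P :: nat \<Rightarrow> 'a set.
      (\<forall>i\<le>n. primeideal (P i) R) \<and> (\<forall>i<n. P i \<subset> P (Suc i))}. enat n)"


section \<open>Modules\<close>

definition mod_hom ::
  "('a, 'm) ring_scheme \<Rightarrow> ('a, 'b, 'p) module_scheme \<Rightarrow> ('a, 'c, 'q) module_scheme \<Rightarrow> ('b \<Rightarrow> 'c) set"
  where "mod_hom R M N = {f \<in> carrier M \<rightarrow> carrier N.
     (\<forall>x\<in>carrier M. \<forall>y\<in>carrier M. f (x \<oplus>\<^bsub>M\<^esub> y) = f x \<oplus>\<^bsub>N\<^esub> f y) \<and>
     (\<forall>r\<in>carrier R. \<forall>x\<in>carrier M. f (r \<odot>\<^bsub>M\<^esub> x) = r \<odot>\<^bsub>N\<^esub> f x)}"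

definition ring_module :: "('a, 'm) ring_scheme \<Rightarrow> ('a, 'a) module" where
  "ring_module R = \<lparr>carrier = carrier R, monoid.mult = monoid.mult R, one = \<one>\<^bsub>R\<^esub>,
     ring.zero = \<zero>\<^bsub>R\<^esub>, add = add R, smult = monoid.mult R\<rparr>"

definition ideal_module :: "('a, 'm) ring_scheme \<Rightarrow> 'a set \<Rightarrow> ('a, 'a) module" where
  "ideal_module R I = (ring_module R)\<lparr>carrier := I\<rparr>"

definition quotient_module :: "('a, 'm) ring_scheme \<Rightarrow> 'a set \<Rightarrow> ('a, 'a set) module" where
  "quotient_module R I = \<lparr>carrier = carrier (R Quot I), monoid.mult = monoid.mult (R Quot I),
     one = \<one>\<^bsub>R Quot I\<^esub>, ring.zero = \<zero>\<^bsub>R Quot I\<^esub>, add = add (R Quot I),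
     smult = (\<lambda>r x. (I +>\<^bsub>R\<^esub> r) \<otimes>\<^bsub>R Quot I\<^esub> x)\<rparr>"

text \<open>
  HOL cannot quantify over modules of all types inside a definition, so the extension
  property is required for the test modules carried by the type of the ring only. By Baer's
  criterion this loses nothing: lemma \<open>injective_module_extend\<close> below derives the
  extension property for test modules of arbitrary types.
\<close>

definition injective_module :: "('a, 'm) ring_scheme \<Rightarrow> ('a, 'e, 'p) module_scheme \<Rightarrow> bool" where
  "injective_module R E \<longleftrightarrow> module R E \<and>
     (\<forall>(M :: ('a, 'a) module) (N :: ('a, 'a) module) i g.
        module R M \<and> module R N \<and> i \<in> mod_hom R M N \<and> inj_on i (carrier M) \<and>
        g \<in> mod_hom R M E \<longrightarrow>
        (\<exists>h\<in>mod_hom R N E. \<forall>x\<in>carrier M. h (i x) = g x))"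

lemma ring_module_simps [simp]:
  "carrier (ring_module R) = carrier R" "\<zero>\<^bsub>ring_module R\<^esub> = \<zero>\<^bsub>R\<^esub>"
  "x \<oplus>\<^bsub>ring_module R\<^esub> y = x \<oplus>\<^bsub>R\<^esub> y" "r \<odot>\<^bsub>ring_module R\<^esub> x = r \<otimes>\<^bsub>R\<^esub> x"
  by (simp_all add: ring_module_def)

lemma ideal_module_simps [simp]:
  "carrier (ideal_module R I) = I" "\<zero>\<^bsub>ideal_module R I\<^esub> = \<zero>\<^bsub>R\<^esub>"
  "x \<oplus>\<^bsub>ideal_module R I\<^esub> y = x \<oplus>\<^bsub>R\<^esub> y" "r \<odot>\<^bsub>ideal_module R I\<^esub> x = r \<otimes>\<^bsub>R\<^esub> x"
  by (simp_all add: ideal_module_def ring_module_def)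

lemma module_ring_module:
  assumes "cring R" shows "module R (ring_module R)"
proof -
  interpret cring R by fact
  show ?thesis
    by (rule moduleI, fact, rule abelian_groupI)
      (auto simp: a_ac m_ac l_distr r_distr intro: exI[of _ "\<ominus>\<^bsub>R\<^esub> _"] dest: l_neg)
qed

lemma module_ideal_module:
  assumes "cring R" "ideal I R" shows "module R (ideal_module R I)"
proof -
  interpret module R "ring_module R" by (rule module_ring_module) fact
  interpret I: ideal I R by fact
  have "submodule I R (ring_module R)"
  proof (rule submoduleI)
    fix a assume a: "a \<in> I"
    have "\<ominus>\<^bsub>R\<^esub> a \<in> I" using a by simp
    moreover have "\<ominus>\<^bsub>ring_module R\<^esub> a = \<ominus>\<^bsub>R\<^esub> a"
      by (simp add: a_inv_def m_inv_def ring_module_def)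
    ultimately show "\<ominus>\<^bsub>ring_module R\<^esub> a \<in> I" by simp
  qed (auto simp: I.I_l_closed)
  then show ?thesis
    unfolding ideal_module_def by (rule submodule.submodule_is_module) (rule module_ring_module, fact)
qed

lemma injective_module_extend:
  fixes M :: "('a, 'b, 'q) module_scheme" and N :: "('a, 'c, 'r) module_scheme"
  assumes E: "injective_module R E" and M: "module R M" and N: "module R N"
    and i: "i \<in> mod_hom R M N" "inj_on i (carrier M)" and g: "g \<in> mod_hom R M E"
  shows "\<exists>h\<in>mod_hom R N E. \<forall>x\<in>carrier M. h (i x) = g x"
proof -
  interpret E: module R E using E by (simp add: injective_module_def)
  interpret M: module R M by fact
  interpret N: module R N by fact
  have iM: "i x \<in> carrier N" "g x \<in> carrier E" if "x \<in> carrier M" for x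
    using i g that by (auto simp: mod_hom_def)
  define B where "B = (\<lambda>x. (i x, g x)) ` carrier M"
  define A where "A = {G. B \<subseteq> G \<and> G \<subseteq> carrier N \<times> carrier E \<and>
     (\<forall>x y x' y'. (x, y) \<in> G \<longrightarrow> (x', y') \<in> G \<longrightarrow> (x \<oplus>\<^bsub>N\<^esub> x', y \<oplus>\<^bsub>E\<^esub> y') \<in> G) \<and>
     (\<forall>r x y. r \<in> carrier R \<longrightarrow> (x, y) \<in> G \<longrightarrow> (r \<odot>\<^bsub>N\<^esub> x, r \<odot>\<^bsub>E\<^esub> y) \<in> G) \<and>
     (\<forall>x y y'. (x, y) \<in> G \<longrightarrow> (x, y') \<in> G \<longrightarrow> y = y')}"
  have "B \<in> A"
  proof -
    have 1: "(i x \<oplus>\<^bsub>N\<^esub> i x', g x \<oplus>\<^bsub>E\<^esub> g x') \<in> B" if "x \<in> carrier M" "x' \<in> carrier M" for x x'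
      using i g that unfolding B_def mod_hom_def by (intro image_eqI[of _ _ "x \<oplus>\<^bsub>M\<^esub> x'"]) auto
    have 2: "(r \<odot>\<^bsub>N\<^esub> i x, r \<odot>\<^bsub>E\<^esub> g x) \<in> B" if "x \<in> carrier M" "r \<in> carrier R" for x r
      using i g that unfolding B_def mod_hom_def by (intro image_eqI[of _ _ "r \<odot>\<^bsub>M\<^esub> x"]) auto
    have 3: "y = y'" if "(x, y) \<in> B" "(x, y') \<in> B" for x y y'
      using that i(2) unfolding B_def by (auto dest: inj_onD)
    have 4: "B \<subseteq> carrier N \<times> carrier E" using iM by (auto simp: B_def)
    show ?thesis unfolding A_def using 3 4
      by (auto simp: B_def intro: 1[unfolded B_def] 2[unfolded B_def])
  qed
  have "\<exists>G\<in>A. \<forall>X\<in>A. G \<subseteq> X \<longrightarrow> X = G"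
  proof (rule subset_Zorn_nonempty)
    show "A \<noteq> {}" using \<open>B \<in> A\<close> by blast
    fix C assume C: "C \<noteq> {}" "subset.chain A C"
    have CA: "G \<in> A" if "G \<in> C" for G using C(2) that by (auto simp: subset.chain_def)
    have tot: "\<exists>G\<in>C. p \<in> G \<and> q \<in> G" if pq: "p \<in> \<Union>C" "q \<in> \<Union>C" for p q
    proof -
      obtain G H where GH: "G \<in> C" "H \<in> C" "p \<in> G" "q \<in> H" using pq by blast
      then have "G \<subseteq> H \<or> H \<subseteq> G" using C(2) by (auto simp: subset_chain_def)
      then show ?thesis using GH by blast
    qed
    have "B \<subseteq> \<Union>C" using C(1) CA unfolding A_def by blast
    moreover have "\<Union>C \<subseteq> carrier N \<times> carrier E" using CA unfolding A_def by blast
    moreover have "(x \<oplus>\<^bsub>N\<^esub> x', y \<oplus>\<^bsub>E\<^esub> y') \<in> \<Union>C" if xy: "(x, y) \<in> \<Union>C" "(x', y') \<in> \<Union>C" for x y x' y'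
    proof -
      obtain G where G: "G \<in> C" "(x, y) \<in> G" "(x', y') \<in> G" using tot[OF xy] by blast
      then have "(x \<oplus>\<^bsub>N\<^esub> x', y \<oplus>\<^bsub>E\<^esub> y') \<in> G" using CA[OF G(1)] unfolding A_def by blast
      then show ?thesis using G by blast
    qed
    moreover have "(r \<odot>\<^bsub>N\<^esub> x, r \<odot>\<^bsub>E\<^esub> y) \<in> \<Union>C" if xy: "(x, y) \<in> \<Union>C" "r \<in> carrier R" for x y r
    proof -
      obtain G where G: "G \<in> C" "(x, y) \<in> G" using xy by blast
      then have "(r \<odot>\<^bsub>N\<^esub> x, r \<odot>\<^bsub>E\<^esub> y) \<in> G" using CA[OF G(1)] xy unfolding A_def by blast
      then show ?thesis using G by blast
    qed
    moreover have "y = y'" if xy: "(x, y) \<in> \<Union>C" "(x, y') \<in> \<Union>C" for x y y'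
    proof -
      obtain G where G: "G \<in> C" "(x, y) \<in> G" "(x, y') \<in> G" using tot[OF xy] by blast
      then show ?thesis using CA[OF G(1)] unfolding A_def by blast
    qed
    ultimately show "\<Union>C \<in> A" unfolding A_def by blast
  qed
  then obtain G where "G \<in> A" and max: "\<And>X. X \<in> A \<Longrightarrow> G \<subseteq> X \<Longrightarrow> X = G" by blast
  from \<open>G \<in> A\<close> have BG: "B \<subseteq> G" and GN: "\<And>x y. (x, y) \<in> G \<Longrightarrow> x \<in> carrier N"
    and GE: "\<And>x y. (x, y) \<in> G \<Longrightarrow> y \<in> carrier E"
    and Gadd: "\<And>x y x' y'. (x, y) \<in> G \<Longrightarrow> (x', y') \<in> G \<Longrightarrow> (x \<oplus>\<^bsub>N\<^esub> x', y \<oplus>\<^bsub>E\<^esub> y') \<in> G"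
    and Gsm: "\<And>r x y. r \<in> carrier R \<Longrightarrow> (x, y) \<in> G \<Longrightarrow> (r \<odot>\<^bsub>N\<^esub> x, r \<odot>\<^bsub>E\<^esub> y) \<in> G"
    and Gfun: "\<And>x y y'. (x, y) \<in> G \<Longrightarrow> (x, y') \<in> G \<Longrightarrow> y = y'"
    unfolding A_def by blast+
  have Gz: "(\<zero>\<^bsub>N\<^esub>, \<zero>\<^bsub>E\<^esub>) \<in> G"
  proof -
    have *: "(i \<zero>\<^bsub>M\<^esub>, g \<zero>\<^bsub>M\<^esub>) \<in> G" using BG by (auto simp: B_def)
    show ?thesis using Gsm[OF E.R.zero_closed *] GN[OF *] GE[OF *] by simp
  qed
  have Gminus: "(\<ominus>\<^bsub>N\<^esub> x, \<ominus>\<^bsub>E\<^esub> y) \<in> G" if "(x, y) \<in> G" for x y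
    using Gsm[of "\<ominus>\<^bsub>R\<^esub> \<one>\<^bsub>R\<^esub>", OF _ that] GN[OF that] GE[OF that]
    by (simp add: N.smult_l_minus E.smult_l_minus)
  have dom: "\<exists>y. (x, y) \<in> G" if x: "x \<in> carrier N" for x
  proof -
    define I where "I = {r \<in> carrier R. \<exists>y. (r \<odot>\<^bsub>N\<^esub> x, y) \<in> G}"
    have I: "ideal I R"
    proof (rule idealI)
      show "ring R" by (rule E.R.ring_axioms)
      show "subgroup I (add_monoid R)"
      proof (rule E.R.add.subgroupI)
        show "I \<subseteq> carrier R" by (auto simp: I_def)
        show "I \<noteq> {}" 
        proof -
          have "\<zero>\<^bsub>R\<^esub> \<in> I" using Gz x by (auto simp: I_def)
          then show ?thesis by blast
        qed
        fix a b assume ab: "a \<in> I" "b \<in> I"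
        then show "a \<oplus>\<^bsub>R\<^esub> b \<in> I" using x by (auto simp: I_def N.smult_l_distr dest: Gadd)
        show "\<ominus>\<^bsub>R\<^esub> a \<in> I" using ab x by (auto simp: I_def N.smult_l_minus dest: Gminus)
      qed
      fix a r assume a: "a \<in> I" and r: "r \<in> carrier R"
      then show "r \<otimes>\<^bsub>R\<^esub> a \<in> I" using x r by (auto simp: I_def N.smult_assoc1 dest: Gsm[OF r])
      then show "a \<otimes>\<^bsub>R\<^esub> r \<in> I" using a r by (simp add: I_def E.R.m_comm)
    qed
    define p where "p r = (SOME y. (r \<odot>\<^bsub>N\<^esub> x, y) \<in> G)" for r
    have p: "(r \<odot>\<^bsub>N\<^esub> x, p r) \<in> G" if "r \<in> I" for r
      using that unfolding I_def p_def by (auto intro: someI_ex)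
    have IR: "r \<in> carrier R" if "r \<in> I" for r using that by (simp add: I_def)
    have "p \<in> mod_hom R (ideal_module R I) E"
    proof -
      have "p (a \<oplus>\<^bsub>R\<^esub> b) = p a \<oplus>\<^bsub>E\<^esub> p b" if ab: "a \<in> I" "b \<in> I" for a b
        using p[of "a \<oplus>\<^bsub>R\<^esub> b"] Gadd[OF p[OF ab(1)] p[OF ab(2)]] ab IR x
          additive_subgroup.a_closed[OF ideal.axioms(1)[OF I] ab]
        by (auto simp: N.smult_l_distr intro: Gfun)
      moreover have "p (r \<otimes>\<^bsub>R\<^esub> a) = r \<odot>\<^bsub>E\<^esub> p a" if ra: "r \<in> carrier R" "a \<in> I" for r a
        using p[of "r \<otimes>\<^bsub>R\<^esub> a"] Gsm[OF ra(1) p[OF ra(2)]] ra IR x ideal.I_l_closed[OF I ra(2,1)]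
        by (auto simp: N.smult_assoc1 intro: Gfun)
      moreover have "p a \<in> carrier E" if "a \<in> I" for a using GE p that by blast
      ultimately show ?thesis by (simp add: mod_hom_def)
    qed
    moreover have "(\<lambda>r. r) \<in> mod_hom R (ideal_module R I) (ring_module R)"
      using IR by (auto simp: mod_hom_def)
    moreover have "inj_on (\<lambda>r. r) (carrier (ideal_module R I))" by (simp add: inj_on_def)
    ultimately have "\<exists>q\<in>mod_hom R (ring_module R) E. \<forall>r\<in>carrier (ideal_module R I). q r = p r"
      using E module_ideal_module[OF E.R.is_cring I] module_ring_module[OF E.R.is_cring]
      unfolding injective_module_def by blast
    then obtain q where q: "q \<in> mod_hom R (ring_module R) E" "\<And>r. r \<in> I \<Longrightarrow> q r = p r" by auto
    define e where "e = q \<one>\<^bsub>R\<^esub>"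
    have e: "e \<in> carrier E" using q(1) by (auto simp: e_def mod_hom_def)
    have qe: "q r = r \<odot>\<^bsub>E\<^esub> e" if "r \<in> carrier R" for r
    proof -
      have "q (r \<otimes>\<^bsub>R\<^esub> \<one>\<^bsub>R\<^esub>) = r \<odot>\<^bsub>E\<^esub> q \<one>\<^bsub>R\<^esub>"
        using q(1) that by (simp add: mod_hom_def del: E.R.r_one)
      then show ?thesis using that by (simp add: e_def)
    qed
    have key: "b = r \<odot>\<^bsub>E\<^esub> e" if "r \<in> carrier R" "(r \<odot>\<^bsub>N\<^esub> x, b) \<in> G" for r b
    proof -
      have "r \<in> I" using that by (auto simp: I_def)
      from Gfun[OF that(2) p[OF this]] q(2)[OF this] qe[OF that(1)] show ?thesis by simp
    qed
    define G' where "G' = {(a \<oplus>\<^bsub>N\<^esub> r \<odot>\<^bsub>N\<^esub> x, b \<oplus>\<^bsub>E\<^esub> r \<odot>\<^bsub>E\<^esub> e) | a b r. (a, b) \<in> G \<and> r \<in> carrier R}"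
    have G'I: "(u, v) \<in> G'" if "(a, b) \<in> G" "r \<in> carrier R" "u = a \<oplus>\<^bsub>N\<^esub> r \<odot>\<^bsub>N\<^esub> x" "v = b \<oplus>\<^bsub>E\<^esub> r \<odot>\<^bsub>E\<^esub> e"
      for a b r u v using that unfolding G'_def by blast
    have GG': "G \<subseteq> G'"
    proof
      fix z assume "z \<in> G"
      moreover obtain a b where "z = (a, b)" by (cases z)
      ultimately show "z \<in> G'" using x e GN[of a b] GE[of a b]
        by (auto intro!: G'I[of a b "\<zero>\<^bsub>R\<^esub>"])
    qed
    have "G' \<in> A"
    proof -
      have "G' \<subseteq> carrier N \<times> carrier E" using GN GE x e by (auto simp: G'_def)
      moreover have "(u \<oplus>\<^bsub>N\<^esub> u', v \<oplus>\<^bsub>E\<^esub> v') \<in> G'" if uv: "(u, v) \<in> G'" "(u', v') \<in> G'" for u v u' v'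
      proof -
        from uv obtain a b r a' b' r' where *: "(a, b) \<in> G" "r \<in> carrier R" "(a', b') \<in> G" "r' \<in> carrier R"
          "u = a \<oplus>\<^bsub>N\<^esub> r \<odot>\<^bsub>N\<^esub> x" "v = b \<oplus>\<^bsub>E\<^esub> r \<odot>\<^bsub>E\<^esub> e"
          "u' = a' \<oplus>\<^bsub>N\<^esub> r' \<odot>\<^bsub>N\<^esub> x" "v' = b' \<oplus>\<^bsub>E\<^esub> r' \<odot>\<^bsub>E\<^esub> e"
          unfolding G'_def by blast
        show ?thesis
          using * x e GN[OF *(1)] GN[OF *(3)] GE[OF *(1)] GE[OF *(3)]
          by (intro G'I[OF Gadd[OF *(1,3)] E.R.a_closed[OF *(2,4)]])
            (simp_all add: N.smult_l_distr E.smult_l_distr N.M.a_ac E.M.a_ac)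
      qed
      moreover have "(s \<odot>\<^bsub>N\<^esub> u, s \<odot>\<^bsub>E\<^esub> v) \<in> G'" if uv: "(u, v) \<in> G'" and s: "s \<in> carrier R" for u v s
      proof -
        from uv obtain a b r where *: "(a, b) \<in> G" "r \<in> carrier R"
          "u = a \<oplus>\<^bsub>N\<^esub> r \<odot>\<^bsub>N\<^esub> x" "v = b \<oplus>\<^bsub>E\<^esub> r \<odot>\<^bsub>E\<^esub> e"
          unfolding G'_def by blast
        show ?thesis
          using * x e s GN[OF *(1)] GE[OF *(1)]
          by (intro G'I[OF Gsm[OF s *(1)] E.R.m_closed[OF s *(2)]])
            (simp_all add: N.smult_r_distr E.smult_r_distr N.smult_assoc1 E.smult_assoc1)
      qed
      moreover have "v = v'" if uv: "(u, v) \<in> G'" "(u, v') \<in> G'" for u v v'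
      proof -
        from uv(1) obtain a b r where *: "(a, b) \<in> G" "r \<in> carrier R"
          "u = a \<oplus>\<^bsub>N\<^esub> r \<odot>\<^bsub>N\<^esub> x" "v = b \<oplus>\<^bsub>E\<^esub> r \<odot>\<^bsub>E\<^esub> e"
          unfolding G'_def by blast
        from uv(2) obtain a' b' r' where **: "(a', b') \<in> G" "r' \<in> carrier R"
          "u = a' \<oplus>\<^bsub>N\<^esub> r' \<odot>\<^bsub>N\<^esub> x" "v' = b' \<oplus>\<^bsub>E\<^esub> r' \<odot>\<^bsub>E\<^esub> e"
          unfolding G'_def by blast
        note c = GN[OF *(1)] GN[OF **(1)] GE[OF *(1)] GE[OF **(1)] *(2) **(2) x e
        have eq: "a \<oplus>\<^bsub>N\<^esub> r \<odot>\<^bsub>N\<^esub> x = a' \<oplus>\<^bsub>N\<^esub> r' \<odot>\<^bsub>N\<^esub> x" using * ** by simp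
        have "(r \<oplus>\<^bsub>R\<^esub> \<ominus>\<^bsub>R\<^esub> r') \<odot>\<^bsub>N\<^esub> x = a' \<oplus>\<^bsub>N\<^esub> \<ominus>\<^bsub>N\<^esub> a"
        proof -
          have "(r \<oplus>\<^bsub>R\<^esub> \<ominus>\<^bsub>R\<^esub> r') \<odot>\<^bsub>N\<^esub> x = r \<odot>\<^bsub>N\<^esub> x \<oplus>\<^bsub>N\<^esub> \<ominus>\<^bsub>N\<^esub> (r' \<odot>\<^bsub>N\<^esub> x)"
            using c by (simp add: N.smult_l_distr N.smult_l_minus)
          also have "\<dots> = (a \<oplus>\<^bsub>N\<^esub> r \<odot>\<^bsub>N\<^esub> x) \<oplus>\<^bsub>N\<^esub> \<ominus>\<^bsub>N\<^esub> a \<oplus>\<^bsub>N\<^esub> \<ominus>\<^bsub>N\<^esub> (r' \<odot>\<^bsub>N\<^esub> x)"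
            using c by (simp add: N.M.a_ac N.M.r_neg N.M.r_neg1 N.M.r_neg2)
          also have "\<dots> = a' \<oplus>\<^bsub>N\<^esub> \<ominus>\<^bsub>N\<^esub> a"
            unfolding eq using c by (simp add: N.M.a_ac N.M.r_neg N.M.r_neg1 N.M.r_neg2)
          finally show ?thesis .
        qed
        then have "((r \<oplus>\<^bsub>R\<^esub> \<ominus>\<^bsub>R\<^esub> r') \<odot>\<^bsub>N\<^esub> x, b' \<oplus>\<^bsub>E\<^esub> \<ominus>\<^bsub>E\<^esub> b) \<in> G"
          using Gadd[OF **(1) Gminus[OF *(1)]] by simp
        from key[OF _ this] have "b' \<oplus>\<^bsub>E\<^esub> \<ominus>\<^bsub>E\<^esub> b = r \<odot>\<^bsub>E\<^esub> e \<oplus>\<^bsub>E\<^esub> \<ominus>\<^bsub>E\<^esub> (r' \<odot>\<^bsub>E\<^esub> e)"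
          using c by (simp add: E.smult_l_distr E.smult_l_minus)
        then have "(b' \<oplus>\<^bsub>E\<^esub> \<ominus>\<^bsub>E\<^esub> b) \<oplus>\<^bsub>E\<^esub> (b \<oplus>\<^bsub>E\<^esub> r' \<odot>\<^bsub>E\<^esub> e)
            = (r \<odot>\<^bsub>E\<^esub> e \<oplus>\<^bsub>E\<^esub> \<ominus>\<^bsub>E\<^esub> (r' \<odot>\<^bsub>E\<^esub> e)) \<oplus>\<^bsub>E\<^esub> (b \<oplus>\<^bsub>E\<^esub> r' \<odot>\<^bsub>E\<^esub> e)" by simp
        then have "b' \<oplus>\<^bsub>E\<^esub> r' \<odot>\<^bsub>E\<^esub> e = b \<oplus>\<^bsub>E\<^esub> r \<odot>\<^bsub>E\<^esub> e"
          using c by (simp add: E.M.a_ac E.M.r_neg E.M.r_neg1 E.M.r_neg2)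
        then show ?thesis using * ** by simp
      qed
      ultimately show ?thesis using BG GG' unfolding A_def by blast
    qed
    from max[OF this GG'] have "G' = G" .
    moreover have "(\<zero>\<^bsub>N\<^esub> \<oplus>\<^bsub>N\<^esub> \<one>\<^bsub>R\<^esub> \<odot>\<^bsub>N\<^esub> x, \<zero>\<^bsub>E\<^esub> \<oplus>\<^bsub>E\<^esub> \<one>\<^bsub>R\<^esub> \<odot>\<^bsub>E\<^esub> e) \<in> G'"
      by (rule G'I[OF Gz, of "\<one>\<^bsub>R\<^esub>"]) simp_all
    ultimately show ?thesis using x by auto
  qed
  define h where "h x = (SOME y. (x, y) \<in> G)" for x
  have h: "(x, h x) \<in> G" if "x \<in> carrier N" for x
    unfolding h_def using dom[OF that] by (rule someI_ex)
  have hI: "h x = y" if "(x, y) \<in> G" for x y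
    using Gfun[OF h[OF GN[OF that]] that] .
  have "h \<in> mod_hom R N E"
    unfolding mod_hom_def using h by (auto intro: hI Gadd Gsm GE)
  moreover have "h (i x) = g x" if "x \<in> carrier M" for x
    using BG that by (intro hI) (auto simp: B_def)
  ultimately show ?thesis by blast
qed

definition essential_submodule ::
  "('a, 'm) ring_scheme \<Rightarrow> 'e set \<Rightarrow> ('a, 'e, 'p) module_scheme \<Rightarrow> bool" where
  "essential_submodule R K E \<longleftrightarrow> submodule K R E \<and>
     (\<forall>H. submodule H R E \<and> H \<noteq> {\<zero>\<^bsub>E\<^esub>} \<longrightarrow> H \<inter> K \<noteq> {\<zero>\<^bsub>E\<^esub>})"

definition injective_hull ::
  "('a, 'm) ring_scheme \<Rightarrow> ('a, 'k, 'p) module_scheme \<Rightarrow> ('a, 'e, 'q) module_scheme \<Rightarrow> bool" where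
  "injective_hull R K E \<longleftrightarrow> injective_module R E \<and>
     (\<exists>i\<in>mod_hom R K E. inj_on i (carrier K) \<and> essential_submodule R (i ` carrier K) E)"

definition canonical_module ::
  "('a, 'm) ring_scheme \<Rightarrow> 'a set \<Rightarrow> ('a, 'e, 'p) module_scheme \<Rightarrow> bool" where
  "canonical_module R \<mm> \<omega> \<longleftrightarrow> injective_hull R (quotient_module R \<mm>) \<omega>"

text \<open>
  A zero-dimensional local ring is Gorenstein if it is isomorphic, as a module over itself,
  to its canonical module. Being an injective hull of the residue field is invariant under
  isomorphism, so this says that the ring itself is one.
\<close>

definition zero_dim_gorenstein_local_ring :: "('a, 'm) ring_scheme \<Rightarrow> 'a set \<Rightarrow> bool" where
  "zero_dim_gorenstein_local_ring S \<nn> \<longleftrightarrow>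
     local_ring S \<nn> \<and> krull_dim S = 0 \<and> canonical_module S \<nn> (ring_module S)"

end

theory Submission
  imports Defs "HOL-Library.Function_Algebras" "HOL-Computational_Algebra.Polynomial" "HOL-Algebra.Weak_Morphisms"
begin

text \<open>
  Write \<open>E\<close> for the canonical module; every endomorphism of \<open>E\<close> is multiplication by an element
  of \<open>R\<close>.

  If \<open>R = S/Soc(S)\<close> with \<open>S\<close> Gorenstein with maximal ideal \<open>\<nn>\<close>, injectivity of \<open>S\<close> over itself and
  of \<open>E\<close> over \<open>R\<close> gives embeddings \<open>E \<rightarrow> \<nn> \<rightarrow> E\<close> whose composite is an automorphism, so
  \<open>E \<cong> \<nn>\<close> surjects onto \<open>\<mm>\<close>.

  Conversely let \<open>f : E \<rightarrow> \<mm>\<close> be onto and let \<open>t : E \<rightarrow> R\<close> be its transpose, \<open>t(x) y = f(y) x\<close>. Since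
  \<open>f(f(x) y - f(y) x) = 0\<close> and \<open>ker f \<subseteq> Soc(E)\<close>, the difference \<open>f - t\<close> has values in
  \<open>Soc(R) \<subseteq> \<mm>\<^sup>2\<close>, so by Nakayama \<open>g = f + t = 2f - (f - t)\<close> is still onto \<open>\<mm>\<close>; moreover
  \<open>g(x) y = g(y) x\<close>, which makes \<open>E\<close> a commutative ring without unit under \<open>x y = g(x) y\<close>. It
  remains to build a local ring \<open>S\<close> over \<open>R\<close> with maximal ideal \<open>E\<close>. Take a ring \<open>A\<close> with a
  surjection \<open>\<pi> : A \<rightarrow> R\<close> and an \<open>A\<close>-linear lift \<open>\<psi> : \<pi>\<^sup>-\<^sup>1(\<mm>) \<rightarrow> E\<close> of \<open>\<pi>\<close> along \<open>g\<close>, and put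
  \<open>S = A/(ker \<pi> \<inter> ker \<psi>)\<close>. Such a pair is found by Zorn's lemma: start with the integers and adjoin
  one variable at a time, first inverting elements until the residue ring of \<open>A\<close> is a field and then
  enlarging that field. Each time the ideal of new relations is principal modulo \<open>\<pi>\<^sup>-\<^sup>1(\<mm>)\<close>, so \<open>\<psi>\<close>
  extends. This replaces the Cohen structure theorem.
\<close>

section \<open>Modules and local rings\<close>

text \<open>If \<open>R\<close> contained its residue field k, the ring S could be taken as k
  \<oplus> E. In general no such subfield exists, for instance when a nonzero prime number lies in
  \<mm>, and the way S is built from k and E is not given in advance. It is read off from a ring A
  so free that \<psi> can be defined on it by hand. A single generator \<Phi> of the new relations
  leaves one choice, a preimage \<theta> of \<Phi>(\<alpha>) under g, and one possible conflict, two
  values at a multiple of \<Phi>; the identity g(x) y = g(y) x removes the conflict. Zorn's lemma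
  needs all candidates for A inside one type. They are rings of integer-valued functions of
  variables indexed by the elements of \<open>R\<close>; since the integers are an infinite domain,
  such functions behave like polynomials. The inclusion of ker f in Soc(E) is a comparison of
  lengths in disguise. If f kills \<open>e\<close>, a generator of Soc(E), then ker t \<subseteq>
  Soc(E) \<subseteq> ker f, while the image of t lies in \<mm>, the image of f. If not, f is
  injective.\<close>

lemma (in abelian_group) minus_eq_zero_iff:
  assumes "x \<in> carrier G" "y \<in> carrier G"
  shows "x \<ominus> y = \<zero> \<longleftrightarrow> x = y"
proof
  assume "x \<ominus> y = \<zero>"
  then have "\<ominus> (\<ominus> y) = x" using assms by (intro minus_equality) (auto simp: minus_eq)
  then show "x = y" using assms by simp
qed (use assms in \<open>simp add: minus_eq r_neg\<close>)

lemma mod_homI: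
  assumes "\<And>x. x \<in> carrier M \<Longrightarrow> f x \<in> carrier N"
    and "\<And>x y. x \<in> carrier M \<Longrightarrow> y \<in> carrier M \<Longrightarrow> f (x \<oplus>\<^bsub>M\<^esub> y) = f x \<oplus>\<^bsub>N\<^esub> f y"
    and "\<And>r x. r \<in> carrier R \<Longrightarrow> x \<in> carrier M \<Longrightarrow> f (r \<odot>\<^bsub>M\<^esub> x) = r \<odot>\<^bsub>N\<^esub> f x"
  shows "f \<in> mod_hom R M N"
  using assms by (auto simp: mod_hom_def)

lemma mod_homD:
  assumes "f \<in> mod_hom R M N"
  shows "x \<in> carrier M \<Longrightarrow> f x \<in> carrier N"
    and "x \<in> carrier M \<Longrightarrow> y \<in> carrier M \<Longrightarrow> f (x \<oplus>\<^bsub>M\<^esub> y) = f x \<oplus>\<^bsub>N\<^esub> f y"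
    and "r \<in> carrier R \<Longrightarrow> x \<in> carrier M \<Longrightarrow> f (r \<odot>\<^bsub>M\<^esub> x) = r \<odot>\<^bsub>N\<^esub> f x"
  using assms by (auto simp: mod_hom_def)

lemma mod_hom_zero:
  assumes "module R M" "module R N" "f \<in> mod_hom R M N"
  shows "f \<zero>\<^bsub>M\<^esub> = \<zero>\<^bsub>N\<^esub>"
proof -
  interpret M: module R M by fact
  interpret N: module R N by fact
  note f = mod_homD[OF assms(3)]
  have "f (\<zero>\<^bsub>R\<^esub> \<odot>\<^bsub>M\<^esub> \<zero>\<^bsub>M\<^esub>) = \<zero>\<^bsub>R\<^esub> \<odot>\<^bsub>N\<^esub> f \<zero>\<^bsub>M\<^esub>" by (rule f(3)) auto
  then show ?thesis using f(1)[of "\<zero>\<^bsub>M\<^esub>"] by simp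
qed

lemma (in module) minus_smult_one: "x \<in> carrier M \<Longrightarrow> (\<ominus>\<one>) \<odot>\<^bsub>M\<^esub> x = \<ominus>\<^bsub>M\<^esub> x"
  by (simp add: smult_l_minus)

lemma mod_hom_diff:
  assumes "module R M" "module R N" "f \<in> mod_hom R M N" "x \<in> carrier M" "y \<in> carrier M"
  shows "f (x \<ominus>\<^bsub>M\<^esub> y) = f x \<ominus>\<^bsub>N\<^esub> f y"
proof -
  interpret M: module R M by fact
  interpret N: module R N by fact
  note f = mod_homD[OF assms(3)]
  have "f ((\<ominus>\<^bsub>R\<^esub> \<one>\<^bsub>R\<^esub>) \<odot>\<^bsub>M\<^esub> y) = (\<ominus>\<^bsub>R\<^esub> \<one>\<^bsub>R\<^esub>) \<odot>\<^bsub>N\<^esub> f y"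
    using assms by (intro f(3)) auto
  then have "f (\<ominus>\<^bsub>M\<^esub> y) = \<ominus>\<^bsub>N\<^esub> f y"
    using f(1) assms(5) by (simp add: M.minus_smult_one N.minus_smult_one)
  then show ?thesis
    using f(2)[of x "\<ominus>\<^bsub>M\<^esub> y"] assms(4,5) by (simp add: a_minus_def)
qed

lemma (in module) submodule_of_closed:
  assumes "H \<subseteq> carrier M" "\<zero>\<^bsub>M\<^esub> \<in> H" "\<And>x y. x \<in> H \<Longrightarrow> y \<in> H \<Longrightarrow> x \<oplus>\<^bsub>M\<^esub> y \<in> H"
    and smult: "\<And>r x. r \<in> carrier R \<Longrightarrow> x \<in> H \<Longrightarrow> r \<odot>\<^bsub>M\<^esub> x \<in> H"
  shows "submodule H R M"
proof (rule submoduleI)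
  fix x assume x: "x \<in> H"
  have "(\<ominus>\<one>) \<odot>\<^bsub>M\<^esub> x \<in> H" using x by (intro smult) auto
  then show "\<ominus>\<^bsub>M\<^esub> x \<in> H" using x assms(1) by (auto simp: minus_smult_one)
qed (use assms in auto)

lemma (in module) module_of_closed:
  assumes "H \<subseteq> carrier M" "\<zero>\<^bsub>M\<^esub> \<in> H" "\<And>x y. x \<in> H \<Longrightarrow> y \<in> H \<Longrightarrow> x \<oplus>\<^bsub>M\<^esub> y \<in> H"
    and "\<And>r x. r \<in> carrier R \<Longrightarrow> x \<in> H \<Longrightarrow> r \<odot>\<^bsub>M\<^esub> x \<in> H"
  shows "module R (M\<lparr>carrier := H\<rparr>)"
  by (intro submodule.submodule_is_module submodule_of_closed assms module_axioms)

lemma (in cring) ideal_of_closed: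
  assumes "I \<subseteq> carrier R" "\<zero> \<in> I" "\<And>x y. x \<in> I \<Longrightarrow> y \<in> I \<Longrightarrow> x \<oplus> y \<in> I"
    and smult: "\<And>r x. r \<in> carrier R \<Longrightarrow> x \<in> I \<Longrightarrow> r \<otimes> x \<in> I"
  shows "ideal I R"
proof (rule idealI)
  show "subgroup I (add_monoid R)"
  proof (rule add.subgroupI)
    fix a assume a: "a \<in> I"
    have "(\<ominus>\<one>) \<otimes> a \<in> I" using a by (intro smult) auto
    then show "\<ominus> a \<in> I" using a assms(1) by (auto simp: l_minus)
  qed (use assms in auto)
  fix a x assume "a \<in> I" "x \<in> carrier R"
  then show "x \<otimes> a \<in> I" "a \<otimes> x \<in> I"
    using smult assms(1) by (auto simp: m_comm[of a x] subset_iff)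
qed (rule ring_axioms)

section \<open>Extension of linear maps into injective modules, and Baer's criterion\<close>

lemma injective_module_factor:
  assumes E: "injective_module R E" and M: "module R M" and N: "module R N"
    and u: "u \<in> mod_hom R M N" and \<phi>: "\<phi> \<in> mod_hom R M E"
    and ker: "\<And>x. x \<in> carrier M \<Longrightarrow> u x = \<zero>\<^bsub>N\<^esub> \<Longrightarrow> \<phi> x = \<zero>\<^bsub>E\<^esub>"
  shows "\<exists>h\<in>mod_hom R N E. \<forall>x\<in>carrier M. h (u x) = \<phi> x"
proof -
  have mE: "module R E" using E by (simp add: injective_module_def)
  interpret M: module R M by fact
  interpret N: module R N by fact
  interpret E: module R E by fact
  note u' = mod_homD[OF u] and \<phi>' = mod_homD[OF \<phi>]
  define H where "H = u ` carrier M"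
  define g where "g y = \<phi> (inv_into (carrier M) u y)" for y
  \<comment> \<open>Two preimages of an element differ by an element of the kernel of
    \<open>u\<close>, which \<phi> kills. So \<open>g\<close> is well defined on the image of
    \<open>u\<close>, and injectivity of \<open>E\<close> becomes applicable to maps such as
    multiplication by a scalar, which are rarely injective.\<close>
  have g: "g (u x) = \<phi> x" if x: "x \<in> carrier M" for x
  proof -
    define x' where "x' = inv_into (carrier M) u (u x)"
    have x': "x' \<in> carrier M" "u x' = u x"
      using x by (auto simp: x'_def inv_into_into f_inv_into_f)
    have "u (x' \<ominus>\<^bsub>M\<^esub> x) = u x \<ominus>\<^bsub>N\<^esub> u x"
      using x x' by (simp add: mod_hom_diff[OF M N u])
    also have "\<dots> = \<zero>\<^bsub>N\<^esub>" using u'(1)[OF x] by (simp add: a_minus_def N.r_neg)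
    finally have "u (x' \<ominus>\<^bsub>M\<^esub> x) = \<zero>\<^bsub>N\<^esub>" .
    then have "\<phi> (x' \<ominus>\<^bsub>M\<^esub> x) = \<zero>\<^bsub>E\<^esub>" using x x' by (intro ker) auto
    then have "\<phi> x' = \<phi> x" using x x' \<phi>'(1) by (simp add: mod_hom_diff[OF M mE \<phi>] E.M.minus_eq_zero_iff)
    then show ?thesis by (simp add: g_def x'_def)
  qed
  have zH: "\<zero>\<^bsub>N\<^esub> \<in> H" using mod_hom_zero[OF M N u] by (auto simp: H_def intro!: image_eqI[of _ _ "\<zero>\<^bsub>M\<^esub>"])
  have aH: "x \<oplus>\<^bsub>N\<^esub> y \<in> H" if "x \<in> H" "y \<in> H" for x y
    using that unfolding H_def by (auto simp flip: u'(2))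
  have sH: "r \<odot>\<^bsub>N\<^esub> x \<in> H" if "r \<in> carrier R" "x \<in> H" for r x
    using that unfolding H_def by (auto simp flip: u'(3))
  have "module R (N\<lparr>carrier := H\<rparr>)"
    by (rule N.module_of_closed) (use zH aH sH u'(1) in \<open>auto simp: H_def\<close>)
  moreover have "(\<lambda>x. x) \<in> mod_hom R (N\<lparr>carrier := H\<rparr>) N"
    using u'(1) by (auto simp: mod_hom_def H_def)
  moreover have "g \<in> mod_hom R (N\<lparr>carrier := H\<rparr>) E"
    by (rule mod_homI) (auto simp: H_def g \<phi>' simp flip: u'(2,3))
  ultimately obtain h where "h \<in> mod_hom R N E" "\<And>y. y \<in> H \<Longrightarrow> h y = g y"
    using injective_module_extend[OF E _ N, of "N\<lparr>carrier := H\<rparr>" "\<lambda>x. x" g] by (auto simp: inj_on_def)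
  then show ?thesis using g unfolding H_def by (metis imageI)
qed

text \<open>The cyclic case: r x determines r y because the annihilator of x kills y. Maps
  prescribed by one value, such as one socle generator going to another, come from here.\<close>

lemma injective_module_extend_element:
  assumes E: "injective_module R E" and N: "module R N"
    and x: "x \<in> carrier N" and y: "y \<in> carrier E"
    and ann: "\<And>r. r \<in> carrier R \<Longrightarrow> r \<odot>\<^bsub>N\<^esub> x = \<zero>\<^bsub>N\<^esub> \<Longrightarrow> r \<odot>\<^bsub>E\<^esub> y = \<zero>\<^bsub>E\<^esub>"
  shows "\<exists>h\<in>mod_hom R N E. h x = y"
proof -
  interpret N: module R N by fact
  interpret E: module R E using E by (simp add: injective_module_def)
  have "\<exists>h\<in>mod_hom R N E. \<forall>r\<in>carrier (ring_module R). h (r \<odot>\<^bsub>N\<^esub> x) = r \<odot>\<^bsub>E\<^esub> y"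
    using x y ann
    by (intro injective_module_factor[OF E module_ring_module[OF N.is_cring] N] mod_homI)
      (auto simp: N.smult_l_distr E.smult_l_distr N.smult_assoc1 E.smult_assoc1)
  then obtain h where "h \<in> mod_hom R N E" "\<And>r. r \<in> carrier R \<Longrightarrow> h (r \<odot>\<^bsub>N\<^esub> x) = r \<odot>\<^bsub>E\<^esub> y"
    by auto
  from this(1) this(2)[of "\<one>\<^bsub>R\<^esub>"] show ?thesis using x y by auto
qed

text \<open>Needed to prove a ring injective over itself, where maps out of ideals are the ones
  under control. A maximal linear graph between N and E that contains the given map is shown to have
  domain N.\<close>

lemma baer_criterion:
  assumes E: "module R E"
    and ideals: "\<And>I h. ideal I R \<Longrightarrow> h \<in> mod_hom R (ideal_module R I) E \<Longrightarrow>
      \<exists>y\<in>carrier E. \<forall>r\<in>I. h r = r \<odot>\<^bsub>E\<^esub> y"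
  shows "injective_module R E"
  unfolding injective_module_def
proof (intro conjI allI impI E)
  fix M N :: "('a, 'a) module" and i g
  assume "module R M \<and> module R N \<and> i \<in> mod_hom R M N \<and> inj_on i (carrier M) \<and> g \<in> mod_hom R M E"
  then have M: "module R M" and N: "module R N" and i: "i \<in> mod_hom R M N" "inj_on i (carrier M)"
    and g: "g \<in> mod_hom R M E" by auto
  interpret M: module R M by fact
  interpret N: module R N by fact
  interpret E: module R E by fact
  note i' = mod_homD[OF i(1)] and g' = mod_homD[OF g]
  define B where "B = (\<lambda>x. (i x, g x)) ` carrier M"
  \<comment> \<open>Single-valuedness is demanded at zero only; closure under sums and scalars,
    hence under differences, gives it everywhere.\<close>
  define A where "A = {G. B \<subseteq> G \<and> G \<subseteq> carrier N \<times> carrier E \<and>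
     (\<forall>p\<in>G. \<forall>q\<in>G. (fst p \<oplus>\<^bsub>N\<^esub> fst q, snd p \<oplus>\<^bsub>E\<^esub> snd q) \<in> G) \<and>
     (\<forall>r\<in>carrier R. \<forall>p\<in>G. (r \<odot>\<^bsub>N\<^esub> fst p, r \<odot>\<^bsub>E\<^esub> snd p) \<in> G) \<and>
     (\<forall>p\<in>G. fst p = \<zero>\<^bsub>N\<^esub> \<longrightarrow> snd p = \<zero>\<^bsub>E\<^esub>)}"
  have iz: "g x = \<zero>\<^bsub>E\<^esub>" if "x \<in> carrier M" "i x = \<zero>\<^bsub>N\<^esub>" for x
    using inj_onD[OF i(2), of x "\<zero>\<^bsub>M\<^esub>"] that mod_hom_zero[OF M N i(1)] mod_hom_zero[OF M E g] by simp
  have BA: "B \<in> A"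
    unfolding A_def B_def using i'(1) g'(1)
    by (auto simp: iz simp flip: i'(2,3) g'(2,3))
  have "\<exists>G\<in>A. \<forall>X\<in>A. G \<subseteq> X \<longrightarrow> X = G"
  proof (rule subset_Zorn_nonempty)
    show "A \<noteq> {}" using BA by blast
    fix C assume C: "C \<noteq> {}" "subset.chain A C"
    have CA: "G \<in> A" if "G \<in> C" for G using C(2) that by (auto simp: subset.chain_def)
    have two: "\<exists>G\<in>C. p \<in> G \<and> q \<in> G" if "p \<in> \<Union>C" "q \<in> \<Union>C" for p q
      using that C(2) unfolding subset_chain_def by blast
    have "B \<subseteq> \<Union>C" "\<Union>C \<subseteq> carrier N \<times> carrier E" using C(1) CA unfolding A_def by blast+
    moreover have "(fst p \<oplus>\<^bsub>N\<^esub> fst q, snd p \<oplus>\<^bsub>E\<^esub> snd q) \<in> \<Union>C" if pq: "p \<in> \<Union>C" "q \<in> \<Union>C" for p q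
    proof -
      obtain G where "G \<in> C" "p \<in> G" "q \<in> G" using two[OF pq] by blast
      with CA show ?thesis unfolding A_def by blast
    qed
    moreover have "(r \<odot>\<^bsub>N\<^esub> fst p, r \<odot>\<^bsub>E\<^esub> snd p) \<in> \<Union>C" if "r \<in> carrier R" "p \<in> \<Union>C" for r p
      using that CA unfolding A_def by blast
    moreover have "snd p = \<zero>\<^bsub>E\<^esub>" if "p \<in> \<Union>C" "fst p = \<zero>\<^bsub>N\<^esub>" for p
      using that CA unfolding A_def by blast
    ultimately show "\<Union>C \<in> A" unfolding A_def by blast
  qed
  then obtain G where GA: "G \<in> A" and max: "\<And>X. X \<in> A \<Longrightarrow> G \<subseteq> X \<Longrightarrow> X = G" by blast
  from GA have BG: "B \<subseteq> G" and Gc: "\<And>x y. (x, y) \<in> G \<Longrightarrow> x \<in> carrier N" "\<And>x y. (x, y) \<in> G \<Longrightarrow> y \<in> carrier E"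
    and Ga: "\<And>x y x' y'. (x, y) \<in> G \<Longrightarrow> (x', y') \<in> G \<Longrightarrow> (x \<oplus>\<^bsub>N\<^esub> x', y \<oplus>\<^bsub>E\<^esub> y') \<in> G"
    and Gs: "\<And>r x y. r \<in> carrier R \<Longrightarrow> (x, y) \<in> G \<Longrightarrow> (r \<odot>\<^bsub>N\<^esub> x, r \<odot>\<^bsub>E\<^esub> y) \<in> G"
    and Gz: "\<And>y. (\<zero>\<^bsub>N\<^esub>, y) \<in> G \<Longrightarrow> y = \<zero>\<^bsub>E\<^esub>"
    unfolding A_def by force+
  have Gm: "(\<ominus>\<^bsub>N\<^esub> x, \<ominus>\<^bsub>E\<^esub> y) \<in> G" if "(x, y) \<in> G" for x y
    using Gs[OF _ that, of "\<ominus>\<^bsub>R\<^esub> \<one>\<^bsub>R\<^esub>"] Gc[OF that] by (simp add: N.minus_smult_one E.minus_smult_one)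
  have Gf: "y = y'" if "(x, y) \<in> G" "(x, y') \<in> G" for x y y'
    using Gz[of "y \<oplus>\<^bsub>E\<^esub> \<ominus>\<^bsub>E\<^esub> y'"] Ga[OF that(1) Gm[OF that(2)]] Gc[OF that(1)] Gc[OF that(2)]
    by (simp add: N.r_neg E.M.minus_eq_zero_iff flip: E.M.minus_eq)
  have G0: "(\<zero>\<^bsub>N\<^esub>, \<zero>\<^bsub>E\<^esub>) \<in> G"
  proof -
    have "(i \<zero>\<^bsub>M\<^esub>, g \<zero>\<^bsub>M\<^esub>) \<in> B" unfolding B_def by blast
    then show ?thesis using BG mod_hom_zero[OF M N i(1)] mod_hom_zero[OF M E g] by auto
  qed
  have dom: "\<exists>y. (x, y) \<in> G" if x: "x \<in> carrier N" for x
  proof -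
    \<comment> \<open>\<open>I\<close> collects the scalars that move x into the domain of
      \<open>G\<close>, and \<open>p\<close> sends such an r to the value of \<open>G\<close> at r
      x. Once \<open>p\<close> is multiplication by some \<open>e\<close>, the graph can be enlarged
      by sending x to \<open>e\<close>.\<close>
    define I where "I = {r \<in> carrier R. \<exists>y. (r \<odot>\<^bsub>N\<^esub> x, y) \<in> G}"
    define p where "p r = (THE y. (r \<odot>\<^bsub>N\<^esub> x, y) \<in> G)" for r
    have pI: "p r = y" if "(r \<odot>\<^bsub>N\<^esub> x, y) \<in> G" for r y
      unfolding p_def using that Gf by blast
    have IR: "r \<in> carrier R" "(r \<odot>\<^bsub>N\<^esub> x, p r) \<in> G" if "r \<in> I" for r
      using that pI by (auto simp: I_def)
    have addI: "a \<oplus>\<^bsub>R\<^esub> b \<in> I" "p (a \<oplus>\<^bsub>R\<^esub> b) = p a \<oplus>\<^bsub>E\<^esub> p b" if "a \<in> I" "b \<in> I" for a b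
      using Ga[OF IR(2) IR(2), OF that] IR(1)[OF that(1)] IR(1)[OF that(2)] x
      by (auto simp: I_def N.smult_l_distr intro!: pI)
    have mulI: "r \<otimes>\<^bsub>R\<^esub> a \<in> I" "p (r \<otimes>\<^bsub>R\<^esub> a) = r \<odot>\<^bsub>E\<^esub> p a" if "r \<in> carrier R" "a \<in> I" for r a
      using Gs[OF that(1) IR(2)[OF that(2)]] IR(1)[OF that(2)] that(1) x
      by (auto simp: I_def N.smult_assoc1 intro!: pI)
    have "ideal I R"
    proof (rule cring.ideal_of_closed[OF M.is_cring])
      show "I \<subseteq> carrier R" by (auto simp: I_def)
      show "\<zero>\<^bsub>R\<^esub> \<in> I" using G0 x by (auto simp: I_def)
    qed (fact addI(1) mulI(1))+
    moreover have "p \<in> mod_hom R (ideal_module R I) E"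
      by (rule mod_homI) (use addI mulI Gc(2)[OF IR(2)] in auto)
    ultimately obtain e where e: "e \<in> carrier E" "\<And>r. r \<in> I \<Longrightarrow> p r = r \<odot>\<^bsub>E\<^esub> e"
      using ideals by blast
    define G' where "G' = {(fst p \<oplus>\<^bsub>N\<^esub> r \<odot>\<^bsub>N\<^esub> x, snd p \<oplus>\<^bsub>E\<^esub> r \<odot>\<^bsub>E\<^esub> e) | p r. p \<in> G \<and> r \<in> carrier R}"
    have G'I: "(u, v) \<in> G'" if "(a, b) \<in> G" "r \<in> carrier R" "u = a \<oplus>\<^bsub>N\<^esub> r \<odot>\<^bsub>N\<^esub> x" "v = b \<oplus>\<^bsub>E\<^esub> r \<odot>\<^bsub>E\<^esub> e"
      for a b r u v using that unfolding G'_def by force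
    have G'E: "\<exists>a b r. (a, b) \<in> G \<and> r \<in> carrier R \<and> q = (a \<oplus>\<^bsub>N\<^esub> r \<odot>\<^bsub>N\<^esub> x, b \<oplus>\<^bsub>E\<^esub> r \<odot>\<^bsub>E\<^esub> e)" if "q \<in> G'" for q
      using that unfolding G'_def by force
    have GG': "(a, b) \<in> G'" if "(a, b) \<in> G" for a b
      using Gc[OF that] x e(1) by (intro G'I[OF that M.R.zero_closed]) auto
    have "G' \<in> A"
      unfolding A_def
    proof (intro CollectI conjI ballI impI)
      show "B \<subseteq> G'" using BG GG' by auto
      show "G' \<subseteq> carrier N \<times> carrier E"
        using Gc x e(1) by (auto dest!: G'E)
    next
      fix q q' assume "q \<in> G'" "q' \<in> G'"
      from G'E[OF this(1)] G'E[OF this(2)] obtain a b r a' b' r' where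
        *: "(a, b) \<in> G" "r \<in> carrier R" "q = (a \<oplus>\<^bsub>N\<^esub> r \<odot>\<^bsub>N\<^esub> x, b \<oplus>\<^bsub>E\<^esub> r \<odot>\<^bsub>E\<^esub> e)"
        "(a', b') \<in> G" "r' \<in> carrier R" "q' = (a' \<oplus>\<^bsub>N\<^esub> r' \<odot>\<^bsub>N\<^esub> x, b' \<oplus>\<^bsub>E\<^esub> r' \<odot>\<^bsub>E\<^esub> e)"
        by blast
      then show "(fst q \<oplus>\<^bsub>N\<^esub> fst q', snd q \<oplus>\<^bsub>E\<^esub> snd q') \<in> G'"
        using x e(1) Gc[OF *(1)] Gc[OF *(4)]
        by (intro G'I[OF Ga[OF *(1,4)] M.R.a_closed[OF *(2,5)]])
          (auto simp: N.smult_l_distr E.smult_l_distr N.M.a_ac E.M.a_ac)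
    next
      fix s q assume s: "s \<in> carrier R" and "q \<in> G'"
      from G'E[OF this(2)] obtain a b r where
        *: "(a, b) \<in> G" "r \<in> carrier R" "q = (a \<oplus>\<^bsub>N\<^esub> r \<odot>\<^bsub>N\<^esub> x, b \<oplus>\<^bsub>E\<^esub> r \<odot>\<^bsub>E\<^esub> e)"
        by blast
      then show "(s \<odot>\<^bsub>N\<^esub> fst q, s \<odot>\<^bsub>E\<^esub> snd q) \<in> G'"
        using x e(1) Gc[OF *(1)] s
        by (intro G'I[OF Gs[OF s *(1)] M.R.m_closed[OF s *(2)]])
          (auto simp: N.smult_r_distr E.smult_r_distr N.smult_assoc1 E.smult_assoc1)
    next
      fix q assume "q \<in> G'" and z: "fst q = \<zero>\<^bsub>N\<^esub>"
      from G'E[OF this(1)] obtain a b r where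
        *: "(a, b) \<in> G" "r \<in> carrier R" "q = (a \<oplus>\<^bsub>N\<^esub> r \<odot>\<^bsub>N\<^esub> x, b \<oplus>\<^bsub>E\<^esub> r \<odot>\<^bsub>E\<^esub> e)"
        by blast
      note c = Gc[OF *(1)]
      \<comment> \<open>A relation a + r x = 0 means that r x is in the domain of \<open>G\<close>
        already, so r lies in \<open>I\<close> and r e is forced to be the negative of b.\<close>
      have "\<ominus>\<^bsub>N\<^esub> a = r \<odot>\<^bsub>N\<^esub> x"
        using z * c x by (simp add: N.M.minus_equality N.M.a_comm)
      then have G1: "(r \<odot>\<^bsub>N\<^esub> x, \<ominus>\<^bsub>E\<^esub> b) \<in> G" using Gm[OF *(1)] by simp
      then have "r \<in> I" using *(2) by (auto simp: I_def)
      then have "r \<odot>\<^bsub>E\<^esub> e = \<ominus>\<^bsub>E\<^esub> b" using pI[OF G1] e(2) by simp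
      then show "snd q = \<zero>\<^bsub>E\<^esub>" using *(3) c by (simp add: E.M.r_neg)
    qed
    then have "G' = G" using GG' by (intro max) auto
    then show ?thesis using G'I[OF G0 M.R.one_closed refl refl] x by auto
  qed
  define h where "h x = (THE y. (x, y) \<in> G)" for x
  have hI: "h x = y" if "(x, y) \<in> G" for x y
    unfolding h_def using that Gf by blast
  have h: "(x, h x) \<in> G" if "x \<in> carrier N" for x
    using dom[OF that] hI by auto
  have "h \<in> mod_hom R N E"
  proof (rule mod_homI)
    fix x y assume "x \<in> carrier N" "y \<in> carrier N"
    then show "h (x \<oplus>\<^bsub>N\<^esub> y) = h x \<oplus>\<^bsub>E\<^esub> h y" by (intro hI Ga h)
  next
    fix r x assume "r \<in> carrier R" "x \<in> carrier N"
    then show "h (r \<odot>\<^bsub>N\<^esub> x) = r \<odot>\<^bsub>E\<^esub> h x" by (intro hI Gs h)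
  qed (use h Gc in blast)
  moreover have "\<forall>x\<in>carrier M. h (i x) = g x"
    using BG by (auto simp: B_def intro!: hI)
  ultimately show "\<exists>h\<in>mod_hom R N E. \<forall>x\<in>carrier M. h (i x) = g x" by blast
qed

text \<open>Noetherian induction: a nonempty chain of ideals contains its own union, so Zorn's lemma
  applies to any nonempty family of ideals.\<close>

lemma (in noetherian_ring) exists_maximal_member:
  assumes "A \<noteq> {}" and ideals: "\<And>I. I \<in> A \<Longrightarrow> ideal I R"
  shows "\<exists>I\<in>A. \<forall>J\<in>A. I \<subseteq> J \<longrightarrow> J = I"
proof (rule subset_Zorn_nonempty)
  fix C assume C: "C \<noteq> {}" "subset.chain A C"
  then have "subset.chain {I. ideal I R} C"
    using ideals by (auto simp: subset_chain_def)
  from ideal_chain_is_trivial[OF C(1) this] show "\<Union>C \<in> A"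
    using C(2) by (auto simp: subset_chain_def)
qed fact

context cring
begin

definition ideal_adjoin :: "'a set \<Rightarrow> 'a \<Rightarrow> 'a set" where
  "ideal_adjoin I a = {i \<oplus> r \<otimes> a | i r. i \<in> I \<and> r \<in> carrier R}"

lemma ideal_adjoin:
  assumes I: "ideal I R" and a: "a \<in> carrier R"
  shows "ideal (ideal_adjoin I a) R" "I \<subseteq> ideal_adjoin I a" "a \<in> ideal_adjoin I a"
proof -
  interpret I: ideal I R by fact
  show sub: "I \<subseteq> ideal_adjoin I a"
    unfolding ideal_adjoin_def using a I.Icarr by (force intro: exI[of _ \<zero>])
  show "a \<in> ideal_adjoin I a"
    unfolding ideal_adjoin_def using a by (force intro: exI[of _ \<one>] exI[of _ \<zero>])
  show "ideal (ideal_adjoin I a) R"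
  proof (rule ideal_of_closed)
    show "ideal_adjoin I a \<subseteq> carrier R" unfolding ideal_adjoin_def using a I.Icarr by auto
    show "\<zero> \<in> ideal_adjoin I a" using sub by auto
    fix x y assume "x \<in> ideal_adjoin I a" "y \<in> ideal_adjoin I a"
    then obtain i r j s where *: "i \<in> I" "r \<in> carrier R" "x = i \<oplus> r \<otimes> a" "j \<in> I" "s \<in> carrier R" "y = j \<oplus> s \<otimes> a"
      unfolding ideal_adjoin_def by blast
    have "x \<oplus> y = (i \<oplus> j) \<oplus> (r \<oplus> s) \<otimes> a"
      using * a by (simp add: I.Icarr l_distr a_ac)
    then show "x \<oplus> y \<in> ideal_adjoin I a" unfolding ideal_adjoin_def using * by blast
  next
    fix s x assume s: "s \<in> carrier R" and "x \<in> ideal_adjoin I a"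
    then obtain i r where *: "i \<in> I" "r \<in> carrier R" "x = i \<oplus> r \<otimes> a"
      unfolding ideal_adjoin_def by blast
    have "s \<otimes> x = s \<otimes> i \<oplus> (s \<otimes> r) \<otimes> a"
      using * a s by (simp add: I.Icarr r_distr m_assoc)
    moreover have "s \<otimes> i \<in> I" using * s by (simp add: I.I_l_closed)
    ultimately show "s \<otimes> x \<in> ideal_adjoin I a" unfolding ideal_adjoin_def using * s by blast
  qed
qed

end

section \<open>Units, Nakayama arguments and socle elements in local rings\<close>

context local_ring
begin

lemma maximal_ideal_carrier: "x \<in> \<mm> \<Longrightarrow> x \<in> carrier R"
  by (rule Icarr)

lemma one_notin: "\<one> \<notin> \<mm>"
  using I_notcarr one_imp_carrier by blast

text \<open>A nonunit generates a proper ideal; an ideal maximal among the proper ones containing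
  the nonunit is a maximal ideal, hence \<mm>.\<close>

lemma Units_iff:
  assumes a: "a \<in> carrier R"
  shows "a \<in> Units R \<longleftrightarrow> a \<notin> \<mm>"
proof
  assume "a \<in> Units R"
  then show "a \<notin> \<mm>"
    using one_notin I_r_closed[of a "inv a"] by auto
next
  assume am: "a \<notin> \<mm>"
  show "a \<in> Units R"
  proof (rule ccontr)
    assume nu: "a \<notin> Units R"
    define A where "A = {I. ideal I R \<and> I \<noteq> carrier R \<and> a \<in> I}"
    have "PIdl a \<in> A"
    proof -
      have "PIdl a \<noteq> carrier R"
      proof
        assume "PIdl a = carrier R"
        then obtain b where "b \<in> carrier R" "\<one> = b \<otimes> a" unfolding cgenideal_def by blast
        with nu a show False by (auto simp: Units_def m_comm)
      qed
      then show ?thesis using a by (auto simp: A_def cgenideal_ideal cgenideal_self)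
    qed
    then have "\<exists>I\<in>A. \<forall>J\<in>A. I \<subseteq> J \<longrightarrow> J = I"
      by (intro exists_maximal_member) (auto simp: A_def)
    then obtain I where I: "I \<in> A" "\<And>J. J \<in> A \<Longrightarrow> I \<subseteq> J \<Longrightarrow> J = I" by blast
    have "maximalideal I R"
      using I unfolding A_def by (intro maximalidealI) auto
    then have "I = \<mm>" by (rule unique_maximal)
    with I am show False by (simp add: A_def)
  qed
qed

lemma one_minus_Units:
  assumes "a \<in> \<mm>" shows "\<one> \<ominus> a \<in> Units R"
proof (rule ccontr)
  have a: "a \<in> carrier R" using assms Icarr by simp
  assume "\<one> \<ominus> a \<notin> Units R"
  then have "\<one> \<ominus> a \<in> \<mm>" using a by (simp add: Units_iff)
  then have "(\<one> \<ominus> a) \<oplus> a \<in> \<mm>" using assms by simp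
  then show False using one_notin a by (simp add: a_minus_def a_assoc l_neg)
qed

text \<open>Nakayama's lemma for a cyclic module: modulo I the unit 1 - b kills x.\<close>

lemma eq_mult_maximal_zero:
  assumes "b \<in> \<mm>" "ideal I R" "x \<in> carrier R" "x \<ominus> b \<otimes> x \<in> I"
  shows "x \<in> I"
proof -
  interpret I: ideal I R by fact
  have b: "b \<in> carrier R" using assms(1) by (rule Icarr)
  have u: "\<one> \<ominus> b \<in> Units R" using assms(1) by (rule one_minus_Units)
  have "(\<one> \<ominus> b) \<otimes> x \<in> I"
    using assms b by (simp add: a_minus_def l_distr l_minus)
  then have "inv (\<one> \<ominus> b) \<otimes> ((\<one> \<ominus> b) \<otimes> x) \<in> I"
    using Units_inv_closed[OF u] by (rule I.I_l_closed)
  moreover have "inv (\<one> \<ominus> b) \<otimes> ((\<one> \<ominus> b) \<otimes> x) = x"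
    using assms(3) m_assoc[OF Units_inv_closed[OF u] Units_closed[OF u] assms(3)] Units_l_inv[OF u] by simp
  ultimately show ?thesis by simp
qed

end

context artinian_local_ring
begin

text \<open>In R/I every nonzero cyclic submodule contains a nonzero socle element. Otherwise the
  multiplier of c could be multiplied by elements of \<mm> forever without its product with c
  entering I. The multipliers generate a descending chain of principal ideals, and where the chain
  is stationary Nakayama's lemma makes the multiplier zero.\<close>

lemma exists_socle_mod:
  assumes I: "ideal I R" and c: "c \<in> carrier R" "c \<notin> I"
  shows "\<exists>s\<in>carrier R. s \<otimes> c \<notin> I \<and> (\<forall>b\<in>\<mm>. b \<otimes> (s \<otimes> c) \<in> I)"
proof (rule ccontr)
  interpret I: ideal I R by fact
  assume no: "\<not> ?thesis"
  define P where "P s \<longleftrightarrow> s \<in> carrier R \<and> s \<otimes> c \<notin> I" for s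
  have "\<exists>f. P (f 0) \<and> (\<forall>n. P (f (Suc n)) \<and> (\<exists>b\<in>\<mm>. f (Suc n) = b \<otimes> f n))"
  proof (rule exE[OF dependent_nat_choice[where P = "\<lambda>_. P" and Q = "\<lambda>_ x y. \<exists>b\<in>\<mm>. y = b \<otimes> x"]])
    show "\<exists>x. P x" using c by (auto simp: P_def intro!: exI[of _ \<one>])
    fix s and n :: nat assume "P s"
    with no obtain b where "b \<in> \<mm>" "b \<otimes> (s \<otimes> c) \<notin> I" unfolding P_def by blast
    with \<open>P s\<close> c show "\<exists>y. P y \<and> (\<exists>b\<in>\<mm>. y = b \<otimes> s)"
      by (intro exI[of _ "b \<otimes> s"]) (auto simp: P_def m_assoc maximal_ideal_carrier)
  qed auto
  then obtain f where f: "\<And>n. P (f n)" "\<And>n. \<exists>b\<in>\<mm>. f (Suc n) = b \<otimes> f n"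
    by (metis not0_implies_Suc)
  have fc: "f n \<in> carrier R" for n using f(1) by (simp add: P_def)
  have "\<exists>n. \<forall>k\<ge>n. PIdl (f k) = PIdl (f n)"
  proof (rule descending_chain)
    fix n
    show "ideal (PIdl (f n)) R" using fc by (rule cgenideal_ideal)
    show "PIdl (f (Suc n)) \<subseteq> PIdl (f n)"
    proof -
      obtain b where b: "b \<in> \<mm>" "f (Suc n) = b \<otimes> f n" using f(2) by blast
      then have "f (Suc n) \<in> PIdl (f n)"
        unfolding cgenideal_def using Icarr by auto
      then show ?thesis using fc by (intro cgenideal_minimal cgenideal_ideal)
    qed
  qed
  then obtain n where "PIdl (f (Suc n)) = PIdl (f n)" by (metis le_SucI order_refl)
  then have "f n \<in> PIdl (f (Suc n))" using cgenideal_self[OF fc, of n] by simp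
  then obtain a where a: "a \<in> carrier R" "f n = a \<otimes> f (Suc n)" unfolding cgenideal_def by auto
  obtain b where b: "b \<in> \<mm>" "f (Suc n) = b \<otimes> f n" using f(2) by blast
  have bc: "b \<in> carrier R" using b(1) by (rule Icarr)
  have "f n = (a \<otimes> b) \<otimes> f n" using a b bc fc by (simp add: m_assoc)
  then have "f n \<ominus> (a \<otimes> b) \<otimes> f n = \<zero>"
    using a(1) bc fc[of n] by (simp add: minus_eq_zero_iff del: m_assoc)
  then have eq: "f n \<ominus> (a \<otimes> b) \<otimes> f n \<in> {\<zero>}" by simp
  have "a \<otimes> b \<in> \<mm>" using a(1) b(1) by (simp add: I_l_closed)
  from eq_mult_maximal_zero[OF this zeroideal fc eq] have "f n = \<zero>" by simp
  then show False using f(1)[of n] c by (simp add: P_def)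
qed

lemma nilpotent_maximal:
  assumes x: "x \<in> \<mm>" shows "\<exists>n::nat. x [^] n = \<zero>"
proof -
  have xc: "x \<in> carrier R" using x by (rule Icarr)
  have "\<exists>n::nat. \<forall>k\<ge>n. PIdl (x [^] k) = PIdl (x [^] n)"
  proof (rule descending_chain[of "\<lambda>n. PIdl (x [^] n)"])
    fix n :: nat
    show "ideal (PIdl (x [^] n)) R" using xc by (intro cgenideal_ideal) auto
    have "x [^] Suc n \<in> PIdl (x [^] n)"
      unfolding cgenideal_def using xc by (auto simp: m_comm)
    then show "PIdl (x [^] Suc n) \<subseteq> PIdl (x [^] n)"
      using xc by (intro cgenideal_minimal cgenideal_ideal) auto
  qed
  then obtain n :: nat where "PIdl (x [^] Suc n) = PIdl (x [^] n)" by (metis le_SucI order_refl)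
  then have "x [^] n \<in> PIdl (x [^] Suc n)" using cgenideal_self[of "x [^] n"] xc by simp
  then obtain a where a: "a \<in> carrier R" "x [^] n = a \<otimes> x [^] Suc n" unfolding cgenideal_def by auto
  then have "x [^] n = (a \<otimes> x) \<otimes> x [^] n" using xc by (simp add: m_ac)
  then have "x [^] n \<ominus> (a \<otimes> x) \<otimes> x [^] n = \<zero>"
    using a(1) xc by (subst minus_eq_zero_iff) auto
  then have eq: "x [^] n \<ominus> (a \<otimes> x) \<otimes> x [^] n \<in> {\<zero>}" by simp
  have "a \<otimes> x \<in> \<mm>" using a(1) x by (simp add: I_l_closed)
  from eq_mult_maximal_zero[OF this zeroideal _ eq] xc have "x [^] n \<in> {\<zero>}" by simp
  then show ?thesis by auto
qed

end

text \<open>A working form of "injective hull of the residue field", with \<open>e\<close> as the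
  image of the class of 1. The last clause is essentiality of the line R e: every nonzero submodule
  contains \<open>e\<close>. Over a local ring both forms are equivalent, and this one avoids
  cosets.\<close>

definition injective_hull_generator ::
  "('a, 'm) ring_scheme \<Rightarrow> 'a set \<Rightarrow> ('a, 'e, 'p) module_scheme \<Rightarrow> 'e \<Rightarrow> bool" where
  "injective_hull_generator R \<mm> E e \<longleftrightarrow> injective_module R E \<and> e \<in> carrier E \<and> e \<noteq> \<zero>\<^bsub>E\<^esub> \<and>
     (\<forall>a\<in>\<mm>. a \<odot>\<^bsub>E\<^esub> e = \<zero>\<^bsub>E\<^esub>) \<and>
     (\<forall>x\<in>carrier E. x \<noteq> \<zero>\<^bsub>E\<^esub> \<longrightarrow> (\<exists>r\<in>carrier R. r \<odot>\<^bsub>E\<^esub> x = e))"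

context local_ring
begin

lemma quotient_module_simps:
  "carrier (quotient_module R \<mm>) = a_rcosets \<mm>"
  "r \<in> carrier R \<Longrightarrow> s \<in> carrier R \<Longrightarrow> (\<mm> +> r) \<oplus>\<^bsub>quotient_module R \<mm>\<^esub> (\<mm> +> s) = \<mm> +> (r \<oplus> s)"
  "r \<in> carrier R \<Longrightarrow> s \<in> carrier R \<Longrightarrow> r \<odot>\<^bsub>quotient_module R \<mm>\<^esub> (\<mm> +> s) = \<mm> +> (r \<otimes> s)"
  by (simp_all add: quotient_module_def FactRing_def a_rcos_sum rcoset_mult_add)

lemma coset_eq_iff:
  assumes "r \<in> carrier R" "s \<in> carrier R"
  shows "\<mm> +> r = \<mm> +> s \<longleftrightarrow> r \<ominus> s \<in> \<mm>"
  by (rule quotient_eq_iff_same_a_r_cos[symmetric]) (use assms is_ideal in auto)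

text \<open>Essentiality applied to the submodule R x gives a nonzero element r x = s e. Then s does
  not kill \<open>e\<close>, so it is a unit and can be divided out.\<close>

lemma canonical_module_imp_generator:
  assumes "canonical_module R \<mm> E"
  shows "\<exists>e. injective_hull_generator R \<mm> E e"
proof -
  let ?k = "quotient_module R \<mm>"
  from assms obtain i where E: "injective_module R E" and i: "i \<in> mod_hom R ?k E" "inj_on i (carrier ?k)"
    and ess: "essential_submodule R (i ` carrier ?k) E"
    unfolding canonical_module_def injective_hull_def by blast
  interpret E: module R E using E by (simp add: injective_module_def)
  note i' = mod_homD[OF i(1)]
  have cos: "\<mm> +> r \<in> carrier ?k" if "r \<in> carrier R" for r
    using that by (auto simp: quotient_module_simps A_RCOSETS_def')
  define e where "e = i (\<mm> +> \<one>)"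
  have e: "e \<in> carrier E" using i'(1) cos by (simp add: e_def)
  have ie: "i (\<mm> +> r) = r \<odot>\<^bsub>E\<^esub> e" if "r \<in> carrier R" for r
    using i'(3)[OF that cos[OF one_closed]] that by (simp add: quotient_module_simps e_def)
  have re0: "r \<odot>\<^bsub>E\<^esub> e = \<zero>\<^bsub>E\<^esub> \<longleftrightarrow> r \<in> \<mm>" if r: "r \<in> carrier R" for r
  proof -
    have "r \<odot>\<^bsub>E\<^esub> e = \<zero>\<^bsub>E\<^esub> \<longleftrightarrow> i (\<mm> +> r) = i (\<mm> +> \<zero>)" using r e by (simp add: ie)
    also have "\<dots> \<longleftrightarrow> \<mm> +> r = \<mm> +> \<zero>" using i(2) cos r by (auto simp: inj_on_def)
    also have "\<dots> \<longleftrightarrow> r \<in> \<mm>" using r by (simp add: coset_eq_iff a_minus_def)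
    finally show ?thesis .
  qed
  have mult: "\<exists>r\<in>carrier R. r \<odot>\<^bsub>E\<^esub> x = e" if x: "x \<in> carrier E" "x \<noteq> \<zero>\<^bsub>E\<^esub>" for x
  proof -
    define H where "H = (\<lambda>r. r \<odot>\<^bsub>E\<^esub> x) ` carrier R"
    have "submodule H R E"
    proof (rule E.submodule_of_closed)
      show "\<zero>\<^bsub>E\<^esub> \<in> H" using x by (auto simp: H_def intro!: image_eqI[of _ _ \<zero>])
    qed (use x in \<open>auto simp: H_def simp flip: E.smult_l_distr E.smult_assoc1\<close>)
    moreover have "x \<in> H" using x by (auto simp: H_def intro!: image_eqI[of _ _ \<one>])
    then have "H \<noteq> {\<zero>\<^bsub>E\<^esub>}" using x by auto
    ultimately have "H \<inter> i ` carrier ?k \<noteq> {\<zero>\<^bsub>E\<^esub>}" using ess unfolding essential_submodule_def by blast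
    moreover have "\<zero>\<^bsub>E\<^esub> \<in> H \<inter> i ` carrier ?k"
    proof -
      have "\<zero>\<^bsub>E\<^esub> = i (\<mm> +> \<zero>)" using ie[of \<zero>] e by simp
      then show ?thesis using cos x by (auto simp: H_def intro!: image_eqI[of _ _ \<zero>])
    qed
    ultimately obtain z where z: "z \<in> H" "z \<in> i ` carrier ?k" "z \<noteq> \<zero>\<^bsub>E\<^esub>" by blast
    then obtain r s where rs: "r \<in> carrier R" "z = r \<odot>\<^bsub>E\<^esub> x" "s \<in> carrier R" "z = s \<odot>\<^bsub>E\<^esub> e"
      unfolding H_def by (auto simp: quotient_module_simps A_RCOSETS_def' ie)
    then have rs: "r \<in> carrier R" "s \<in> carrier R" "r \<odot>\<^bsub>E\<^esub> x = s \<odot>\<^bsub>E\<^esub> e" "s \<odot>\<^bsub>E\<^esub> e \<noteq> \<zero>\<^bsub>E\<^esub>"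
      using z(3) by simp_all
    then have "s \<in> Units R" using re0 by (simp add: Units_iff)
    then have "(inv s \<otimes> r) \<odot>\<^bsub>E\<^esub> x = e"
      using rs x e by (simp add: E.smult_assoc1 flip: E.smult_assoc1[of "inv s" s])
    then show ?thesis using rs \<open>s \<in> Units R\<close> by blast
  qed
  show ?thesis
    unfolding injective_hull_generator_def
    using E e re0[of \<one>] re0 mult one_notin Icarr by (intro exI[of _ e]) auto
qed

end

section \<open>Endomorphisms of the canonical module\<close>

locale local_ring_hull = local_ring R \<mm> + E: module R E
  for R (structure) and \<mm> and E (structure) and e +
  assumes generator: "injective_hull_generator R \<mm> E e"
begin

lemma injective: "injective_module R E"
  and e_closed [simp]: "e \<in> carrier E"
  and e_nonzero: "e \<noteq> \<zero>\<^bsub>E\<^esub>"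
  and maximal_smult_e: "a \<in> \<mm> \<Longrightarrow> a \<odot>\<^bsub>E\<^esub> e = \<zero>\<^bsub>E\<^esub>"
  and smult_eq_e: "x \<in> carrier E \<Longrightarrow> x \<noteq> \<zero>\<^bsub>E\<^esub> \<Longrightarrow> \<exists>r\<in>carrier R. r \<odot>\<^bsub>E\<^esub> x = e"
  using generator unfolding injective_hull_generator_def by auto

lemma unit_smult_zero:
  assumes "u \<in> Units R" "x \<in> carrier E" "u \<odot>\<^bsub>E\<^esub> x = \<zero>\<^bsub>E\<^esub>"
  shows "x = \<zero>\<^bsub>E\<^esub>"
proof -
  have "x = inv u \<odot>\<^bsub>E\<^esub> (u \<odot>\<^bsub>E\<^esub> x)" using assms(1,2) by (simp add: Units_closed flip: E.smult_assoc1)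
  then show ?thesis using assms by simp
qed

lemma smult_e_zero_iff:
  assumes "r \<in> carrier R"
  shows "r \<odot>\<^bsub>E\<^esub> e = \<zero>\<^bsub>E\<^esub> \<longleftrightarrow> r \<in> \<mm>"
  using assms maximal_smult_e unit_smult_zero[of r e] e_nonzero Units_iff[of r] by auto

text \<open>If x is nonzero, some multiple r x equals \<open>e\<close>; as \<mm> kills x, the scalar
  r is a unit. So the socle of \<open>E\<close> is a line over the residue field.\<close>

lemma socle_cyclic:
  assumes x: "x \<in> carrier E" and ann: "\<And>a. a \<in> \<mm> \<Longrightarrow> a \<odot>\<^bsub>E\<^esub> x = \<zero>\<^bsub>E\<^esub>"
  shows "\<exists>r\<in>carrier R. x = r \<odot>\<^bsub>E\<^esub> e"
proof (cases "x = \<zero>\<^bsub>E\<^esub>")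
  case True
  then show ?thesis by (auto intro!: bexI[of _ \<zero>])
next
  case False
  then obtain r where r: "r \<in> carrier R" "r \<odot>\<^bsub>E\<^esub> x = e" using smult_eq_e[OF x] by blast
  then have "r \<notin> \<mm>" using ann e_nonzero by auto
  then have u: "r \<in> Units R" using r by (simp add: Units_iff)
  then have "x = inv r \<odot>\<^bsub>E\<^esub> e" using x r by (simp flip: E.smult_assoc1 r(2))
  then show ?thesis using u by blast
qed

text \<open>A nonzero submodule of \<open>E\<close>, such as a nontrivial kernel, contains
  \<open>e\<close>.\<close>

lemma mod_hom_injective:
  assumes "module R N" "h \<in> mod_hom R E N" "h e \<noteq> \<zero>\<^bsub>N\<^esub>" "x \<in> carrier E" "h x = \<zero>\<^bsub>N\<^esub>"
  shows "x = \<zero>\<^bsub>E\<^esub>"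
proof (rule ccontr)
  interpret N: module R N by fact
  assume "x \<noteq> \<zero>\<^bsub>E\<^esub>"
  then obtain r where r: "r \<in> carrier R" "r \<odot>\<^bsub>E\<^esub> x = e" using smult_eq_e assms(4) by blast
  have "h e = r \<odot>\<^bsub>N\<^esub> h x" using mod_homD(3)[OF assms(2) r(1) assms(4)] r(2) by simp
  then show False using assms(3,5) r(1) by simp
qed

end

lemma (in local_ring) generator_imp_canonical_module:
  assumes "injective_hull_generator R \<mm> E e"
  shows "canonical_module R \<mm> E"
proof -
  let ?k = "quotient_module R \<mm>"
  have E: "injective_module R E" using assms by (simp add: injective_hull_generator_def)
  interpret E: module R E using E by (simp add: injective_module_def)
  interpret H: local_ring_hull R \<mm> E e by unfold_locales (rule assms)
  note e = H.e_closed H.e_nonzero H.maximal_smult_e H.smult_eq_e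
  note re0 = H.smult_e_zero_iff
  \<comment> \<open>The class of r goes to r e; the choice of the representative is harmless because
    \<mm> kills \<open>e\<close>.\<close>
  define i where "i C = (SOME r. r \<in> carrier R \<and> C = \<mm> +> r) \<odot>\<^bsub>E\<^esub> e" for C
  have i: "i (\<mm> +> r) = r \<odot>\<^bsub>E\<^esub> e" if r: "r \<in> carrier R" for r
  proof -
    define s where "s = (SOME s. s \<in> carrier R \<and> \<mm> +> r = \<mm> +> s)"
    have s: "s \<in> carrier R \<and> \<mm> +> r = \<mm> +> s"
      unfolding s_def by (rule someI[of _ r]) (use r in auto)
    then have "r \<ominus> s \<in> \<mm>" using coset_eq_iff[OF r, of s] by blast
    then have "(r \<ominus> s) \<odot>\<^bsub>E\<^esub> e = \<zero>\<^bsub>E\<^esub>" by (rule e)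
    moreover have "(r \<ominus> s) \<odot>\<^bsub>E\<^esub> e = r \<odot>\<^bsub>E\<^esub> e \<ominus>\<^bsub>E\<^esub> s \<odot>\<^bsub>E\<^esub> e"
      using r s e(1) by (simp add: a_minus_def E.smult_l_distr E.smult_l_minus)
    ultimately have "r \<odot>\<^bsub>E\<^esub> e = s \<odot>\<^bsub>E\<^esub> e"
      using r s e(1) by (simp add: E.M.minus_eq_zero_iff)
    then show ?thesis by (simp add: i_def s_def)
  qed
  have rep: "\<exists>r\<in>carrier R. C = \<mm> +> r" if "C \<in> carrier ?k" for C
    using that by (auto simp: quotient_module_simps A_RCOSETS_def')
  have cos: "\<mm> +> r \<in> carrier ?k" if "r \<in> carrier R" for r
    using that by (auto simp: quotient_module_simps A_RCOSETS_def')
  have ihom: "i \<in> mod_hom R ?k E"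
  proof (rule mod_homI)
    fix C assume "C \<in> carrier ?k"
    then obtain r where "r \<in> carrier R" "C = \<mm> +> r" using rep by blast
    then show "i C \<in> carrier E" using e by (simp add: i)
  next
    fix C D assume "C \<in> carrier ?k" "D \<in> carrier ?k"
    then obtain r s where "r \<in> carrier R" "C = \<mm> +> r" "s \<in> carrier R" "D = \<mm> +> s" using rep by blast
    then show "i (C \<oplus>\<^bsub>?k\<^esub> D) = i C \<oplus>\<^bsub>E\<^esub> i D" using e by (simp add: i quotient_module_simps E.smult_l_distr)
  next
    fix s C assume "s \<in> carrier R" "C \<in> carrier ?k"
    moreover from this obtain r where "r \<in> carrier R" "C = \<mm> +> r" using rep by blast
    ultimately show "i (s \<odot>\<^bsub>?k\<^esub> C) = s \<odot>\<^bsub>E\<^esub> i C" using e by (simp add: i quotient_module_simps E.smult_assoc1)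
  qed
  moreover have "inj_on i (carrier ?k)"
  proof (rule inj_onI)
    fix C D assume "C \<in> carrier ?k" "D \<in> carrier ?k" and eq: "i C = i D"
    then obtain r s where rs: "r \<in> carrier R" "C = \<mm> +> r" "s \<in> carrier R" "D = \<mm> +> s" using rep by blast
    then have "(r \<ominus> s) \<odot>\<^bsub>E\<^esub> e = \<zero>\<^bsub>E\<^esub>"
      using eq e by (simp add: i a_minus_def E.smult_l_distr E.smult_l_minus E.M.r_neg)
    then show "C = D" using rs re0 by (simp add: coset_eq_iff)
  qed
  moreover have "essential_submodule R (i ` carrier ?k) E"
    unfolding essential_submodule_def
  proof (intro conjI allI impI)
    have im: "i ` carrier ?k = (\<lambda>r. r \<odot>\<^bsub>E\<^esub> e) ` carrier R"
    proof
      show "i ` carrier ?k \<subseteq> (\<lambda>r. r \<odot>\<^bsub>E\<^esub> e) ` carrier R" using rep i by force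
      show "(\<lambda>r. r \<odot>\<^bsub>E\<^esub> e) ` carrier R \<subseteq> i ` carrier ?k" using cos i by (auto intro!: image_eqI[OF sym])
    qed
    show "submodule (i ` carrier ?k) R E"
      unfolding im
    proof (rule E.submodule_of_closed)
      show "\<zero>\<^bsub>E\<^esub> \<in> (\<lambda>r. r \<odot>\<^bsub>E\<^esub> e) ` carrier R" using e by (auto intro!: image_eqI[of _ _ \<zero>])
    qed (use e in \<open>auto simp flip: E.smult_l_distr E.smult_assoc1\<close>)
    fix H assume H: "submodule H R E \<and> H \<noteq> {\<zero>\<^bsub>E\<^esub>}"
    then interpret H: submodule H R E by simp
    obtain x where x: "x \<in> H" "x \<noteq> \<zero>\<^bsub>E\<^esub>" using H H.one_closed by auto
    then obtain r where "r \<in> carrier R" "r \<odot>\<^bsub>E\<^esub> x = e" using e(4) H.subset by auto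
    then have "e \<in> H" using x H.smult_closed by auto
    moreover have "e \<in> i ` carrier ?k" unfolding im using e by (auto intro!: image_eqI[of _ _ \<one>])
    ultimately show "H \<inter> i ` carrier ?k \<noteq> {\<zero>\<^bsub>E\<^esub>}" using e by blast
  qed
  ultimately show ?thesis unfolding canonical_module_def injective_hull_def using E by blast
qed

locale artinian_local_ring_hull = local_ring_hull + artinian_local_ring
begin

text \<open>If r is nonzero, some multiple s r is a nonzero socle element of \<open>R\<close>,
  annihilated by no unit. Sending it to \<open>e\<close> extends to a map h from \<open>R\<close> to
  \<open>E\<close>, and then e = s r h(1) contradicts r E = 0.\<close>

lemma faithful:
  assumes r: "r \<in> carrier R" and ann: "\<And>x. x \<in> carrier E \<Longrightarrow> r \<odot>\<^bsub>E\<^esub> x = \<zero>\<^bsub>E\<^esub>"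
  shows "r = \<zero>"
proof (rule ccontr)
  assume "r \<noteq> \<zero>"
  then obtain s where s: "s \<in> carrier R" "s \<otimes> r \<noteq> \<zero>" "\<And>b. b \<in> \<mm> \<Longrightarrow> b \<otimes> (s \<otimes> r) = \<zero>"
    using exists_socle_mod[OF zeroideal r] by auto
  have "\<exists>h\<in>mod_hom R (ring_module R) E. h (s \<otimes> r) = e"
  proof (rule injective_module_extend_element[OF injective module_ring_module[OF is_cring]])
    fix t assume t: "t \<in> carrier R" "t \<odot>\<^bsub>ring_module R\<^esub> (s \<otimes> r) = \<zero>\<^bsub>ring_module R\<^esub>"
    have "t \<notin> Units R"
    proof
      assume u: "t \<in> Units R"
      have "s \<otimes> r = inv t \<otimes> (t \<otimes> (s \<otimes> r))"
        using u t(1) s(1) r m_assoc[of "inv t" t "s \<otimes> r"] by simp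
      then show False using t(2) s(2) u by simp
    qed
    then show "t \<odot>\<^bsub>E\<^esub> e = \<zero>\<^bsub>E\<^esub>" using t(1) by (simp add: Units_iff maximal_smult_e)
  qed (use r s in auto)
  then obtain h where h: "h \<in> mod_hom R (ring_module R) E" "h (s \<otimes> r) = e" by blast
  have "h ((s \<otimes> r) \<otimes> \<one>) = (s \<otimes> r) \<odot>\<^bsub>E\<^esub> h \<one>"
    using mod_homD(3)[OF h(1), of "s \<otimes> r" \<one>] r s by simp
  then have "e = s \<odot>\<^bsub>E\<^esub> (r \<odot>\<^bsub>E\<^esub> h \<one>)"
    using h(2) r s(1) mod_homD(1)[OF h(1)] by (simp add: E.smult_assoc1)
  then show False using ann[of "h \<one>"] mod_homD(1)[OF h(1)] s(1) e_nonzero by simp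
qed

text \<open>Noetherian induction: enlarging \<open>I\<close> by a socle element \<open>a\<close> of \<open>R/I\<close> leaves an error that
  factors through multiplication by \<open>a\<close>, which maps \<open>0 :\<^sub>E I\<close> into the socle of \<open>E\<close>.\<close>

lemma homothety_annihilator:
  assumes "ideal I R"
    and "\<phi> \<in> mod_hom R (E\<lparr>carrier := {x \<in> carrier E. \<forall>a\<in>I. a \<odot>\<^bsub>E\<^esub> x = \<zero>\<^bsub>E\<^esub>}\<rparr>) E"
  shows "\<exists>r\<in>carrier R. \<forall>x\<in>carrier E. (\<forall>a\<in>I. a \<odot>\<^bsub>E\<^esub> x = \<zero>\<^bsub>E\<^esub>) \<longrightarrow> \<phi> x = r \<odot>\<^bsub>E\<^esub> x"
proof -
  define W where "W I = {x \<in> carrier E. \<forall>a\<in>I. a \<odot>\<^bsub>E\<^esub> x = \<zero>\<^bsub>E\<^esub>}" for I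
  define good where "good I \<longleftrightarrow> (\<forall>\<phi>\<in>mod_hom R (E\<lparr>carrier := W I\<rparr>) E.
    \<exists>r\<in>carrier R. \<forall>x\<in>W I. \<phi> x = r \<odot>\<^bsub>E\<^esub> x)" for I
  have W_mod: "module R (E\<lparr>carrier := W I\<rparr>)" if "I \<subseteq> carrier R" for I
  proof (rule E.module_of_closed)
    fix r x assume rx: "r \<in> carrier R" "x \<in> W I"
    have "a \<odot>\<^bsub>E\<^esub> (r \<odot>\<^bsub>E\<^esub> x) = \<zero>\<^bsub>E\<^esub>" if "a \<in> I" for a
    proof -
      have a: "a \<in> carrier R" using that \<open>I \<subseteq> carrier R\<close> by blast
      have "a \<odot>\<^bsub>E\<^esub> (r \<odot>\<^bsub>E\<^esub> x) = r \<odot>\<^bsub>E\<^esub> (a \<odot>\<^bsub>E\<^esub> x)"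
        using rx a by (simp add: W_def m_comm flip: E.smult_assoc1)
      then show ?thesis using rx that by (simp add: W_def)
    qed
    then show "r \<odot>\<^bsub>E\<^esub> x \<in> W I" using rx by (simp add: W_def)
  qed (use that in \<open>auto simp: W_def E.smult_r_distr subset_iff\<close>)
  have "good I" if "ideal I R" for I
  proof (rule ccontr)
    assume "\<not> good I"
    then have "\<exists>J\<in>{J. ideal J R \<and> \<not> good J}. \<forall>K\<in>{J. ideal J R \<and> \<not> good J}. J \<subseteq> K \<longrightarrow> K = J"
      using that by (intro exists_maximal_member) auto
    then obtain J where J: "ideal J R" "\<not> good J" "\<And>K. ideal K R \<Longrightarrow> J \<subseteq> K \<Longrightarrow> K \<noteq> J \<Longrightarrow> good K"
      by blast
    interpret J: ideal J R by fact
    have WJ: "module R (E\<lparr>carrier := W J\<rparr>)" using J.a_subset by (rule W_mod)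
    have "\<one> \<notin> J"
    proof
      assume one: "\<one> \<in> J"
      have "good J"
        unfolding good_def
      proof (intro ballI bexI[of _ \<zero>])
        fix \<phi> x assume \<phi>: "\<phi> \<in> mod_hom R (E\<lparr>carrier := W J\<rparr>) E" and x: "x \<in> W J"
        have "x = \<zero>\<^bsub>E\<^esub>" using x one by (auto simp: W_def dest: E.smult_one)
        then show "\<phi> x = \<zero> \<odot>\<^bsub>E\<^esub> x" using mod_hom_zero[OF WJ E.module_axioms \<phi>] by simp
      qed auto
      with J(2) show False by simp
    qed
    then obtain s where s: "s \<in> carrier R" "s \<otimes> \<one> \<notin> J" "\<And>b. b \<in> \<mm> \<Longrightarrow> b \<otimes> (s \<otimes> \<one>) \<in> J"
      using exists_socle_mod[OF J(1) one_closed] by blast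
    define K where "K = ideal_adjoin J s"
    note K = ideal_adjoin[OF J(1) s(1), folded K_def]
    have "K \<noteq> J" using K(3) s(1,2) by auto
    then have gK: "good K" using J(3) K by blast
    have "good J"
      unfolding good_def
    proof (intro ballI)
      fix \<phi> assume \<phi>: "\<phi> \<in> mod_hom R (E\<lparr>carrier := W J\<rparr>) E"
      note \<phi>' = mod_homD[OF \<phi>, simplified]
      have WKJ: "x \<in> W K \<longleftrightarrow> x \<in> W J \<and> s \<odot>\<^bsub>E\<^esub> x = \<zero>\<^bsub>E\<^esub>" for x
      proof
        assume "x \<in> W J \<and> s \<odot>\<^bsub>E\<^esub> x = \<zero>\<^bsub>E\<^esub>"
        then show "x \<in> W K"
          using s(1) J.Icarr by (auto simp: W_def K_def ideal_adjoin_def E.smult_l_distr E.smult_assoc1)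
      qed (use K(2,3) in \<open>auto simp: W_def\<close>)
      have "\<phi> \<in> mod_hom R (E\<lparr>carrier := W K\<rparr>) E"
        by (rule mod_homI) (use \<phi>' WKJ in auto)
      then obtain r where r: "r \<in> carrier R" "\<And>x. x \<in> W K \<Longrightarrow> \<phi> x = r \<odot>\<^bsub>E\<^esub> x"
        using gK unfolding good_def by blast
      have WE: "x \<in> carrier E" if "x \<in> W J" for x using that by (simp add: W_def)
      have sW: "a \<odot>\<^bsub>E\<^esub> (s \<odot>\<^bsub>E\<^esub> x) = \<zero>\<^bsub>E\<^esub>" if "a \<in> \<mm>" "x \<in> W J" for a x
      proof -
        have "a \<odot>\<^bsub>E\<^esub> (s \<odot>\<^bsub>E\<^esub> x) = (a \<otimes> s) \<odot>\<^bsub>E\<^esub> x"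
          using that s(1) Icarr[OF that(1)] WE by (simp add: E.smult_assoc1)
        also have "\<dots> = \<zero>\<^bsub>E\<^esub>" using s(3)[OF that(1)] s(1) that(2) by (simp add: W_def)
        finally show ?thesis .
      qed
      define \<psi> where "\<psi> x = \<phi> x \<ominus>\<^bsub>E\<^esub> r \<odot>\<^bsub>E\<^esub> x" for x
      have "\<exists>h\<in>mod_hom R E E. \<forall>x\<in>carrier (E\<lparr>carrier := W J\<rparr>). h (s \<odot>\<^bsub>E\<^esub> x) = \<psi> x"
      proof (rule injective_module_factor[OF injective WJ E.module_axioms])
        show "(\<lambda>x. s \<odot>\<^bsub>E\<^esub> x) \<in> mod_hom R (E\<lparr>carrier := W J\<rparr>) E"
          by (rule mod_homI) (use s(1) WE in \<open>auto simp: E.smult_r_distr m_comm simp flip: E.smult_assoc1\<close>)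
        show "\<psi> \<in> mod_hom R (E\<lparr>carrier := W J\<rparr>) E"
        proof (rule mod_homI)
          fix x y assume "x \<in> carrier (E\<lparr>carrier := W J\<rparr>)" "y \<in> carrier (E\<lparr>carrier := W J\<rparr>)"
          then have xy: "x \<in> W J" "y \<in> W J" by auto
          note c = WE[OF xy(1)] WE[OF xy(2)] \<phi>'(1)[OF xy(1)] \<phi>'(1)[OF xy(2)]
          show "\<psi> (x \<oplus>\<^bsub>E\<lparr>carrier := W J\<rparr>\<^esub> y) = \<psi> x \<oplus>\<^bsub>E\<^esub> \<psi> y"
            using r(1) c xy by (simp add: \<psi>_def \<phi>'(2) E.smult_r_distr E.M.minus_eq E.M.minus_add E.M.a_ac)
        next
          fix t x assume t: "t \<in> carrier R" and "x \<in> carrier (E\<lparr>carrier := W J\<rparr>)"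
          then have x: "x \<in> W J" by auto
          have "r \<odot>\<^bsub>E\<^esub> (t \<odot>\<^bsub>E\<^esub> x) = t \<odot>\<^bsub>E\<^esub> (r \<odot>\<^bsub>E\<^esub> x)"
            using r(1) t WE[OF x] by (simp add: m_comm flip: E.smult_assoc1)
          then show "\<psi> (t \<odot>\<^bsub>E\<lparr>carrier := W J\<rparr>\<^esub> x) = t \<odot>\<^bsub>E\<^esub> \<psi> x"
            using r(1) t x WE[OF x] \<phi>'(1)[OF x]
            by (simp add: \<psi>_def \<phi>'(3) E.M.minus_eq E.smult_r_distr E.smult_r_minus)
        qed (use \<phi>'(1) r(1) WE in \<open>auto simp: \<psi>_def\<close>)
        fix x assume "x \<in> carrier (E\<lparr>carrier := W J\<rparr>)" "s \<odot>\<^bsub>E\<^esub> x = \<zero>\<^bsub>E\<^esub>"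
        then have x: "x \<in> W J" "x \<in> W K" using WKJ by auto
        then show "\<psi> x = \<zero>\<^bsub>E\<^esub>"
          using r WE[OF x(1)] by (simp add: \<psi>_def E.M.minus_eq E.M.r_neg)
      qed
      then obtain h where h: "h \<in> mod_hom R E E" "\<And>x. x \<in> W J \<Longrightarrow> h (s \<odot>\<^bsub>E\<^esub> x) = \<psi> x"
        by auto
      note h' = mod_homD[OF h(1)]
      \<comment> \<open>\<open>h\<close> preserves the socle, so on the line R e it is
        multiplication by a scalar c. For x in \<open>W J\<close> the element s x lies on this line,
        hence the error at x is c s x and the multiplier r gets corrected to r + c s.\<close>
      have "\<exists>c\<in>carrier R. h e = c \<odot>\<^bsub>E\<^esub> e"
      proof (rule socle_cyclic)
        fix a assume a: "a \<in> \<mm>"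
        then show "a \<odot>\<^bsub>E\<^esub> h e = \<zero>\<^bsub>E\<^esub>"
          using h'(3)[of a e] Icarr maximal_smult_e mod_hom_zero[OF E.module_axioms E.module_axioms h(1)]
          by simp
      qed (use h' in auto)
      then obtain c where c: "c \<in> carrier R" "h e = c \<odot>\<^bsub>E\<^esub> e" by blast
      have "\<phi> x = (r \<oplus> c \<otimes> s) \<odot>\<^bsub>E\<^esub> x" if x: "x \<in> W J" for x
      proof -
        obtain t where t: "t \<in> carrier R" "s \<odot>\<^bsub>E\<^esub> x = t \<odot>\<^bsub>E\<^esub> e"
          using socle_cyclic[of "s \<odot>\<^bsub>E\<^esub> x"] sW x s(1) WE by auto
        have "\<psi> x = h (t \<odot>\<^bsub>E\<^esub> e)" using h(2)[OF x] t by simp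
        also have "\<dots> = t \<odot>\<^bsub>E\<^esub> (c \<odot>\<^bsub>E\<^esub> e)" using t c by (simp add: h'(3))
        also have "\<dots> = c \<odot>\<^bsub>E\<^esub> (t \<odot>\<^bsub>E\<^esub> e)" using t c by (simp add: m_comm flip: E.smult_assoc1)
        also have "\<dots> = (c \<otimes> s) \<odot>\<^bsub>E\<^esub> x" using c s(1) WE[OF x] by (simp add: E.smult_assoc1 flip: t(2))
        finally have \<psi>: "\<psi> x = (c \<otimes> s) \<odot>\<^bsub>E\<^esub> x" .
        have "\<phi> x = r \<odot>\<^bsub>E\<^esub> x \<oplus>\<^bsub>E\<^esub> \<psi> x"
          using r(1) WE[OF x] \<phi>'(1)[OF x] by (simp add: \<psi>_def E.M.minus_eq E.M.a_ac E.M.r_neg)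
        then show ?thesis using \<psi> r(1) c s(1) WE[OF x] by (simp add: E.smult_l_distr)
      qed
      then show "\<exists>r\<in>carrier R. \<forall>x\<in>W J. \<phi> x = r \<odot>\<^bsub>E\<^esub> x"
        using r(1) c s(1) by (intro bexI[of _ "r \<oplus> c \<otimes> s"]) auto
    qed
    with J(2) show False by simp
  qed
  then have "\<exists>r\<in>carrier R. \<forall>x\<in>W I. \<phi> x = r \<odot>\<^bsub>E\<^esub> x"
    using assms unfolding good_def W_def by blast
  then show ?thesis unfolding W_def by blast
qed

lemma homothety:
  assumes "\<phi> \<in> mod_hom R E E"
  shows "\<exists>r\<in>carrier R. \<forall>x\<in>carrier E. \<phi> x = r \<odot>\<^bsub>E\<^esub> x"
proof -
  have "{x \<in> carrier E. \<forall>a\<in>{\<zero>}. a \<odot>\<^bsub>E\<^esub> x = \<zero>\<^bsub>E\<^esub>} = carrier E" by auto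
  then have "\<phi> \<in> mod_hom R (E\<lparr>carrier := {x \<in> carrier E. \<forall>a\<in>{\<zero>}. a \<odot>\<^bsub>E\<^esub> x = \<zero>\<^bsub>E\<^esub>}\<rparr>) E"
    using assms by (simp add: mod_hom_def)
  from homothety_annihilator[OF zeroideal this] show ?thesis by auto
qed

end

section \<open>Surjections from the canonical module onto the maximal ideal\<close>

lemma (in local_ring) socle_ideal: "ideal (socle R \<mm>) R"
proof (rule ideal_of_closed)
  fix x y assume "x \<in> socle R \<mm>" "y \<in> socle R \<mm>"
  then show "x \<oplus> y \<in> socle R \<mm>" by (auto simp: socle_def l_distr maximal_ideal_carrier)
next
  fix r x assume "r \<in> carrier R" "x \<in> socle R \<mm>"
  then show "r \<otimes> x \<in> socle R \<mm>" by (auto simp: socle_def m_assoc maximal_ideal_carrier)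
qed (auto simp: socle_def maximal_ideal_carrier)

section \<open>From a Gorenstein ring to a surjection onto the maximal ideal\<close>

definition restrict_scalars ::
  "('b \<Rightarrow> 'a) \<Rightarrow> ('a, 'e, 'p) module_scheme \<Rightarrow> ('b, 'e) module" where
  "restrict_scalars \<rho> M = \<lparr>carrier = carrier M, monoid.mult = monoid.mult M, one = \<one>\<^bsub>M\<^esub>,
     ring.zero = \<zero>\<^bsub>M\<^esub>, add = add M, module.smult = (\<lambda>s. module.smult M (\<rho> s))\<rparr>"

lemma restrict_scalars_simps [simp]:
  "carrier (restrict_scalars \<rho> M) = carrier M" "\<zero>\<^bsub>restrict_scalars \<rho> M\<^esub> = \<zero>\<^bsub>M\<^esub>"
  "x \<oplus>\<^bsub>restrict_scalars \<rho> M\<^esub> y = x \<oplus>\<^bsub>M\<^esub> y" "s \<odot>\<^bsub>restrict_scalars \<rho> M\<^esub> x = \<rho> s \<odot>\<^bsub>M\<^esub> x"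
  by (simp_all add: restrict_scalars_def)

lemma module_restrict_scalars:
  assumes "cring S" "\<rho> \<in> ring_hom S R" "module R M"
  shows "module S (restrict_scalars \<rho> M)"
proof -
  interpret M: module R M by fact
  interpret S: cring S by fact
  note \<rho> = ring_hom_memE[OF assms(2)]
  show ?thesis
    by (rule moduleI, fact, rule abelian_groupI)
      (auto simp: \<rho> M.M.a_ac M.smult_l_distr M.smult_r_distr M.smult_assoc1
        intro: bexI[of _ "\<ominus>\<^bsub>M\<^esub> _"] dest: M.M.l_neg)
qed

context artinian_local_ring_hull
begin

lemma surjection_of_socle_quotient:
  fixes S :: "('s, 'n) ring_scheme"
  assumes S: "local_ring S \<nn>" and s0: "injective_hull_generator S \<nn> (ring_module S) s0"
    and \<rho>: "\<rho> \<in> ring_hom S R" and surj: "\<rho> ` carrier S = carrier R"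
    and ker: "\<And>s. s \<in> carrier S \<Longrightarrow> \<rho> s = \<zero> \<longleftrightarrow> s \<in> socle S \<nn>"
  shows "\<exists>f\<in>mod_hom R E (ideal_module R \<mm>). f ` carrier E = \<mm>"
proof -
  interpret S: local_ring S \<nn> by fact
  interpret SM: module S "ring_module S" by (rule module_ring_module[OF S.is_cring])
  interpret G: local_ring_hull S \<nn> "ring_module S" s0
    using s0 by unfold_locales
  note \<rho>' = ring_hom_memE[OF \<rho>]
  note G_simps = G.e_closed[simplified] G.e_nonzero[simplified]
  have soc: "z \<in> carrier S" "a \<in> \<nn> \<Longrightarrow> z \<otimes>\<^bsub>S\<^esub> a = \<zero>\<^bsub>S\<^esub>" if "z \<in> socle S \<nn>" for z a
    using that by (auto simp: socle_def)
  \<comment> \<open>A socle element outside \<nn> would be a unit, and then 1 would lie in the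
    socle, which is the kernel of \<rho>.\<close>
  have soc_n: "z \<in> \<nn>" if z: "z \<in> socle S \<nn>" for z
  proof (rule ccontr)
    assume "z \<notin> \<nn>"
    then have u: "z \<in> Units S" using soc(1)[OF z] by (simp add: S.Units_iff)
    have "inv\<^bsub>S\<^esub> z \<otimes>\<^bsub>S\<^esub> z \<in> socle S \<nn>"
      using ideal.I_l_closed[OF S.socle_ideal z] S.Units_inv_closed[OF u] .
    then have "\<rho> \<one>\<^bsub>S\<^esub> = \<zero>" using u ker[of "\<one>\<^bsub>S\<^esub>"] by simp
    then show False using \<rho>'(4) one_notin zero_closed by simp
  qed
  have s0_soc: "s0 \<in> socle S \<nn>"
    using G_simps G.maximal_smult_e S.Icarr by (auto simp: socle_def S.m_comm)
  have n_iff: "\<rho> s \<in> \<mm> \<longleftrightarrow> s \<in> \<nn>" if s: "s \<in> carrier S" for s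
  proof
    assume m: "\<rho> s \<in> \<mm>"
    show "s \<in> \<nn>"
    proof (rule ccontr)
      assume "s \<notin> \<nn>"
      then have u: "s \<in> Units S" using s by (simp add: S.Units_iff)
      have "\<rho> (inv\<^bsub>S\<^esub> s) \<otimes> \<rho> s \<in> \<mm>" using m \<rho>'(1) u by (simp add: I_l_closed)
      then have "\<rho> (inv\<^bsub>S\<^esub> s \<otimes>\<^bsub>S\<^esub> s) \<in> \<mm>" using \<rho>'(2)[OF S.Units_inv_closed[OF u] s] by simp
      then show False using u \<rho>'(4) one_notin by simp
    qed
  next
    assume n: "s \<in> \<nn>"
    show "\<rho> s \<in> \<mm>"
    proof (rule ccontr)
      assume "\<rho> s \<notin> \<mm>"
      then have u: "\<rho> s \<in> Units R" using s \<rho>'(1) by (simp add: Units_iff)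
      obtain s' where s': "s' \<in> carrier S" "\<rho> s' = inv (\<rho> s)" using surj u by (metis Units_inv_closed imageE)
      have "\<rho> (s' \<otimes>\<^bsub>S\<^esub> s \<oplus>\<^bsub>S\<^esub> (\<ominus>\<^bsub>S\<^esub> \<one>\<^bsub>S\<^esub>)) = \<one> \<oplus> \<rho> (\<ominus>\<^bsub>S\<^esub> \<one>\<^bsub>S\<^esub>)"
        using s s' u by (simp add: \<rho>')
      also have "\<dots> = \<rho> (\<one>\<^bsub>S\<^esub> \<oplus>\<^bsub>S\<^esub> (\<ominus>\<^bsub>S\<^esub> \<one>\<^bsub>S\<^esub>))"
        by (simp add: \<rho>' del: S.r_neg)
      also have "\<dots> = \<zero>" using ker[of "\<zero>\<^bsub>S\<^esub>"] additive_subgroup.zero_closed[OF ideal.axioms(1)[OF S.socle_ideal]]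
        by (simp add: S.r_neg)
      finally have "s' \<otimes>\<^bsub>S\<^esub> s \<oplus>\<^bsub>S\<^esub> (\<ominus>\<^bsub>S\<^esub> \<one>\<^bsub>S\<^esub>) \<in> \<nn>" using s s' ker soc_n by simp
      moreover have "\<ominus>\<^bsub>S\<^esub> (s' \<otimes>\<^bsub>S\<^esub> s) \<in> \<nn>" using s' n by (simp add: S.I_l_closed)
      ultimately have "\<ominus>\<^bsub>S\<^esub> (s' \<otimes>\<^bsub>S\<^esub> s) \<oplus>\<^bsub>S\<^esub> (s' \<otimes>\<^bsub>S\<^esub> s \<oplus>\<^bsub>S\<^esub> (\<ominus>\<^bsub>S\<^esub> \<one>\<^bsub>S\<^esub>)) \<in> \<nn>" by simp
      then have "\<ominus>\<^bsub>S\<^esub> \<one>\<^bsub>S\<^esub> \<in> \<nn>" using s s' by (simp add: S.r_neg1)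
      then have "\<ominus>\<^bsub>S\<^esub> (\<ominus>\<^bsub>S\<^esub> \<one>\<^bsub>S\<^esub>) \<in> \<nn>" by (rule S.a_inv_closed)
      then show False using S.one_notin by simp
    qed
  qed
  \<comment> \<open>\<nn> as a module over \<open>R\<close>: a scalar acts through any preimage
    under \<rho>, because two preimages differ by a socle element and the socle kills \<nn>. This
    structure lets injectivity of \<open>E\<close> over \<open>R\<close> produce a map out of
    \<nn>.\<close>
  define N where "N = \<lparr>carrier = \<nn>, monoid.mult = monoid.mult S, one = \<one>\<^bsub>S\<^esub>, ring.zero = \<zero>\<^bsub>S\<^esub>,
     add = add S, module.smult = (\<lambda>r x. inv_into (carrier S) \<rho> r \<otimes>\<^bsub>S\<^esub> x)\<rparr>"
  have N_simps [simp]: "carrier N = \<nn>" "\<zero>\<^bsub>N\<^esub> = \<zero>\<^bsub>S\<^esub>" "x \<oplus>\<^bsub>N\<^esub> y = x \<oplus>\<^bsub>S\<^esub> y" for x y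
    by (simp_all add: N_def)
  have N_smult [simp]: "\<rho> s \<odot>\<^bsub>N\<^esub> x = s \<otimes>\<^bsub>S\<^esub> x" if s: "s \<in> carrier S" and x: "x \<in> \<nn>" for s x
  proof -
    define s' where "s' = inv_into (carrier S) \<rho> (\<rho> s)"
    have s': "s' \<in> carrier S" "\<rho> s' = \<rho> s"
      using s by (auto simp: s'_def inv_into_into f_inv_into_f)
    have "\<rho> (s' \<oplus>\<^bsub>S\<^esub> (\<ominus>\<^bsub>S\<^esub> s)) = \<rho> (s \<oplus>\<^bsub>S\<^esub> (\<ominus>\<^bsub>S\<^esub> s))" using s s' by (simp add: \<rho>' del: S.r_neg)
    then have "s' \<oplus>\<^bsub>S\<^esub> (\<ominus>\<^bsub>S\<^esub> s) \<in> socle S \<nn>"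
      using s s' ker[of "s' \<oplus>\<^bsub>S\<^esub> (\<ominus>\<^bsub>S\<^esub> s)"] ker[of "\<zero>\<^bsub>S\<^esub>"]
        additive_subgroup.zero_closed[OF ideal.axioms(1)[OF S.socle_ideal]] by (simp add: S.r_neg)
    then have "(s' \<ominus>\<^bsub>S\<^esub> s) \<otimes>\<^bsub>S\<^esub> x = \<zero>\<^bsub>S\<^esub>" using soc(2) x by (simp add: S.minus_eq)
    then have "s' \<otimes>\<^bsub>S\<^esub> x \<ominus>\<^bsub>S\<^esub> s \<otimes>\<^bsub>S\<^esub> x = \<zero>\<^bsub>S\<^esub>"
      using s s' S.Icarr[OF x] by (simp add: S.minus_eq S.l_distr S.l_minus)
    then have "s' \<otimes>\<^bsub>S\<^esub> x = s \<otimes>\<^bsub>S\<^esub> x" using s s' S.Icarr[OF x] by (simp add: S.minus_eq_zero_iff)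
    then show ?thesis by (simp add: N_def s'_def)
  qed
  have surj': "\<exists>s\<in>carrier S. r = \<rho> s" if "r \<in> carrier R" for r using that surj by blast
  have N: "module R N"
  proof (rule moduleI[OF is_cring])
    show "abelian_group N"
      by (rule abelian_groupI)
        (auto simp: S.a_ac S.maximal_ideal_carrier S.l_neg S.r_neg intro!: bexI[of _ "\<ominus>\<^bsub>S\<^esub> _"])
    fix r x assume "r \<in> carrier R" "x \<in> carrier N"
    then show "r \<odot>\<^bsub>N\<^esub> x \<in> carrier N" by (auto dest!: surj' simp: S.I_l_closed)
  next
    fix r r' x assume r: "r \<in> carrier R" "r' \<in> carrier R" and x: "x \<in> carrier N"
    then obtain s s' where s: "s \<in> carrier S" "r = \<rho> s" "s' \<in> carrier S" "r' = \<rho> s'" using surj' by metis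
    show "(r \<oplus> r') \<odot>\<^bsub>N\<^esub> x = r \<odot>\<^bsub>N\<^esub> x \<oplus>\<^bsub>N\<^esub> r' \<odot>\<^bsub>N\<^esub> x" "(r \<otimes> r') \<odot>\<^bsub>N\<^esub> x = r \<odot>\<^bsub>N\<^esub> (r' \<odot>\<^bsub>N\<^esub> x)"
      using s x S.Icarr[of x]
      by (simp_all add: S.I_l_closed S.l_distr S.m_assoc flip: \<rho>'(2,3))
  next
    fix r x y assume "r \<in> carrier R" and x: "x \<in> carrier N" "y \<in> carrier N"
    then obtain s where s: "s \<in> carrier S" "r = \<rho> s" using surj' by metis
    then show "r \<odot>\<^bsub>N\<^esub> (x \<oplus>\<^bsub>N\<^esub> y) = r \<odot>\<^bsub>N\<^esub> x \<oplus>\<^bsub>N\<^esub> r \<odot>\<^bsub>N\<^esub> y"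
      using x S.Icarr[of x] S.Icarr[of y] by (simp add: S.r_distr)
  next
    fix x assume "x \<in> carrier N"
    then show "\<one> \<odot>\<^bsub>N\<^esub> x = x" using N_smult[of "\<one>\<^bsub>S\<^esub>" x] \<rho>'(4) S.Icarr[of x] by simp
  qed
  interpret N: module R N by fact
  \<comment> \<open>A scalar of S kills \<open>e\<close> exactly when it lies in \<nn>, and then it
    kills \<open>s0\<close>; so \<open>e\<close> may be sent to \<open>s0\<close>. The same
    comparison in the other direction yields \<open>h\<close> with \<open>h s0 = e\<close>.\<close>
  have "\<exists>f\<in>mod_hom S (restrict_scalars \<rho> E) (ring_module S). f e = s0"
    using G_simps(1) n_iff smult_e_zero_iff \<rho>'(1) G.maximal_smult_e
    by (intro injective_module_extend_element[OF G.injective]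
        module_restrict_scalars[OF S.is_cring \<rho> E.module_axioms]) auto
  then obtain f where f: "f \<in> mod_hom S (restrict_scalars \<rho> E) (ring_module S)" "f e = s0" by blast
  note f' = mod_homD[OF f(1), simplified]
  have f0: "f \<zero>\<^bsub>E\<^esub> = \<zero>\<^bsub>S\<^esub>"
    using mod_hom_zero[OF module_restrict_scalars[OF S.is_cring \<rho> E.module_axioms] SM.module_axioms f(1)] by simp
  have "\<exists>h\<in>mod_hom R N E. h s0 = e"
  proof (rule injective_module_extend_element[OF injective N])
    fix r assume "r \<in> carrier R" "r \<odot>\<^bsub>N\<^esub> s0 = \<zero>\<^bsub>N\<^esub>"
    moreover from this obtain s where s: "s \<in> carrier S" "r = \<rho> s" using surj' by metis
    ultimately have "s \<in> \<nn>" using G.smult_e_zero_iff[of s] soc_n[OF s0_soc] by simp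
    then show "r \<odot>\<^bsub>E\<^esub> e = \<zero>\<^bsub>E\<^esub>" using s n_iff maximal_smult_e by simp
  qed (use soc_n[OF s0_soc] in auto)
  then obtain h where h: "h \<in> mod_hom R N E" "h s0 = e" by blast
  note h' = mod_homD[OF h(1), simplified]
  \<comment> \<open>\<open>s0\<close> acts on \<open>E\<close> as \<open>\<rho> s0\<close>, which is
    zero, so it kills every value of \<open>f\<close>; a unit value would make \<open>s0\<close>
    vanish.\<close>
  have fn: "f x \<in> \<nn>" if x: "x \<in> carrier E" for x
  proof (rule ccontr)
    assume "f x \<notin> \<nn>"
    then have u: "f x \<in> Units S" using f'(1)[OF x] by (simp add: S.Units_iff)
    have "f (\<rho> s0 \<odot>\<^bsub>E\<^esub> x) = s0 \<otimes>\<^bsub>S\<^esub> f x" using f'(3)[OF G_simps(1) x] .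
    moreover have "\<rho> s0 = \<zero>" using ker s0_soc G_simps(1) by simp
    ultimately have "f x \<otimes>\<^bsub>S\<^esub> s0 = \<zero>\<^bsub>S\<^esub>" using x f0 f'(1)[OF x] G_simps(1) by (simp add: S.m_comm)
    then show False using G.unit_smult_zero[OF u, of s0] G_simps by simp
  qed
  have "(\<lambda>x. h (f x)) \<in> mod_hom R E E"
  proof (rule mod_homI)
    fix r x assume "r \<in> carrier R" and x: "x \<in> carrier E"
    then obtain s where s: "s \<in> carrier S" "r = \<rho> s" using surj' by metis
    have "f (r \<odot>\<^bsub>E\<^esub> x) = r \<odot>\<^bsub>N\<^esub> f x" using s x f'(3) fn by simp
    then show "h (f (r \<odot>\<^bsub>E\<^esub> x)) = r \<odot>\<^bsub>E\<^esub> h (f x)" using h'(3) fn x s(2) \<open>r \<in> carrier R\<close> by simp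
  qed (use f' h' fn in auto)
  from homothety[OF this] obtain r where r: "r \<in> carrier R" "\<And>x. x \<in> carrier E \<Longrightarrow> h (f x) = r \<odot>\<^bsub>E\<^esub> x"
    by blast
  \<comment> \<open>Fixing \<open>e\<close> keeps the multiplier \<open>r\<close> of the composite
    outside \<mm>, so it is a unit.\<close>
  have "r \<odot>\<^bsub>E\<^esub> e = e" using r(2)[of e] f(2) h(2) by simp
  then have ru: "r \<in> Units R" using r(1) smult_e_zero_iff[OF r(1)] e_nonzero by (simp add: Units_iff)
  have hinj: "y = \<zero>\<^bsub>S\<^esub>" if y: "y \<in> \<nn>" "h y = \<zero>\<^bsub>E\<^esub>" for y
  proof (rule ccontr)
    assume "y \<noteq> \<zero>\<^bsub>S\<^esub>"
    then obtain s where s: "s \<in> carrier S" "s \<otimes>\<^bsub>S\<^esub> y = s0" using G.smult_eq_e[of y] S.Icarr[OF y(1)] by auto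
    have "h (\<rho> s \<odot>\<^bsub>N\<^esub> y) = \<zero>\<^bsub>E\<^esub>" using h'(3) s(1) y \<rho>'(1) by (simp del: N_smult)
    then show False using s y h(2) e_nonzero by simp
  qed
  have fsurj: "\<exists>x\<in>carrier E. f x = y" if y: "y \<in> \<nn>" for y
  proof -
    \<comment> \<open>With this x the elements f(x) and y have the same image under
      \<open>h\<close>, and \<open>h\<close> is injective because every nonzero element of \<nn> has
      \<open>s0\<close> among its multiples.\<close>
    define x where "x = inv r \<odot>\<^bsub>E\<^esub> h y"
    have x: "x \<in> carrier E" using ru h'(1)[OF y] by (simp add: x_def)
    have "h (f x) = (r \<otimes> inv r) \<odot>\<^bsub>E\<^esub> h y"
      using r x ru h'(1)[OF y] E.smult_assoc1[of r "inv r" "h y"] by (simp add: x_def del: Units_r_inv)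
    then have "h (f x) = h y" using ru h'(1)[OF y] by simp
    then have "h (f x \<ominus>\<^bsub>N\<^esub> y) = \<zero>\<^bsub>E\<^esub>"
      using mod_hom_diff[OF N E.module_axioms h(1), of "f x" y] fn[OF x] y h'(1)[OF y]
      by (simp add: E.M.minus_eq E.M.r_neg)
    then have "f x \<ominus>\<^bsub>N\<^esub> y = \<zero>\<^bsub>N\<^esub>" using hinj[of "f x \<ominus>\<^bsub>N\<^esub> y"] N.M.minus_closed[of "f x" y] fn[OF x] y by simp
    then show ?thesis using N.M.minus_eq_zero_iff[of "f x" y] fn[OF x] y x by auto
  qed
  have "(\<lambda>x. \<rho> (f x)) \<in> mod_hom R E (ideal_module R \<mm>)"
  proof (rule mod_homI)
    fix r x assume "r \<in> carrier R" and x: "x \<in> carrier E"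
    then obtain s where s: "s \<in> carrier S" "r = \<rho> s" using surj' by metis
    then show "\<rho> (f (r \<odot>\<^bsub>E\<^esub> x)) = r \<odot>\<^bsub>ideal_module R \<mm>\<^esub> \<rho> (f x)"
      using x f' \<rho>'(2) by simp
  qed (use f' fn n_iff S.maximal_ideal_carrier \<rho>'(3) in auto)
  moreover have "(\<lambda>x. \<rho> (f x)) ` carrier E = \<mm>"
  proof
    show "(\<lambda>x. \<rho> (f x)) ` carrier E \<subseteq> \<mm>" using fn n_iff S.Icarr by auto
    show "\<mm> \<subseteq> (\<lambda>x. \<rho> (f x)) ` carrier E"
    proof
      fix a assume a: "a \<in> \<mm>"
      then obtain s where s: "s \<in> carrier S" "a = \<rho> s" using surj' Icarr by metis
      then have "s \<in> \<nn>" using a n_iff by simp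
      then obtain x where "x \<in> carrier E" "f x = s" using fsurj by blast
      then show "a \<in> (\<lambda>x. \<rho> (f x)) ` carrier E" using s by auto
    qed
  qed
  ultimately show ?thesis by blast
qed

end

text \<open>Let K be maximal among the ideals between P and \<mm> that differ from \<mm>. If a b
  were outside K for some a and b in \<mm>, then K + R a b would be \<mm>, so b = k + r a b and
  Nakayama's lemma for the single element b puts it into K. Hence K contains the square of \<mm>,
  and with P all of \<mm>.\<close>

lemma (in local_ring) nakayama_maximal:
  assumes P: "ideal P R" "P \<subseteq> \<mm>"
    and gen: "\<And>a. a \<in> \<mm> \<Longrightarrow> \<exists>p\<in>P. \<exists>q\<in>\<mm> \<cdot> \<mm>. a = p \<oplus> q"
  shows "P = \<mm>"
proof (rule ccontr)
  assume "P \<noteq> \<mm>"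
  define A where "A = {K. ideal K R \<and> P \<subseteq> K \<and> K \<subset> \<mm>}"
  have "\<exists>K\<in>A. \<forall>J\<in>A. K \<subseteq> J \<longrightarrow> J = K"
    using P \<open>P \<noteq> \<mm>\<close> by (intro exists_maximal_member) (auto simp: A_def)
  then obtain K where "K \<in> A" and max: "\<And>J. J \<in> A \<Longrightarrow> K \<subseteq> J \<Longrightarrow> J = K"
    by blast
  then have K: "ideal K R" "P \<subseteq> K" "K \<subset> \<mm>" by (auto simp: A_def)
  interpret K: ideal K R by fact
  have prod: "a \<otimes> b \<in> K" if a: "a \<in> \<mm>" and b: "b \<in> \<mm>" for a b
  proof (rule ccontr)
    assume n: "a \<otimes> b \<notin> K"
    have c: "a \<in> carrier R" "b \<in> carrier R" using a b Icarr by auto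
    have ab: "a \<otimes> b \<in> carrier R" "a \<otimes> b \<in> \<mm>" using c a by (auto simp: I_r_closed)
    define J where "J = ideal_adjoin K (a \<otimes> b)"
    note J = ideal_adjoin[OF K(1) ab(1), folded J_def]
    have "J \<subseteq> \<mm>" using K(3) ab unfolding J_def ideal_adjoin_def by (auto simp: I_l_closed)
    moreover have "J \<noteq> K" using J(3) n by auto
    ultimately have "J = \<mm>" using max[of J] J K unfolding A_def by blast
    then obtain k r where kr: "k \<in> K" "r \<in> carrier R" "b = k \<oplus> r \<otimes> (a \<otimes> b)"
      using b unfolding J_def ideal_adjoin_def by blast
    have "b \<ominus> (r \<otimes> a) \<otimes> b = k \<oplus> r \<otimes> (a \<otimes> b) \<ominus> r \<otimes> (a \<otimes> b)"
      using kr(2) c m_assoc[OF kr(2) c] by (simp add: kr(3)[symmetric])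
    also have "\<dots> = k" using kr(1,2) K.Icarr ab(1) by (simp add: minus_eq a_assoc r_neg)
    finally have "b \<ominus> (r \<otimes> a) \<otimes> b \<in> K" using kr by simp
    then have "b \<in> K"
      using eq_mult_maximal_zero[of "r \<otimes> a" K b] kr a c K(1) by (simp add: I_l_closed)
    then show False using n c by (simp add: K.I_l_closed)
  qed
  have "q \<in> K" if "q \<in> \<mm> \<cdot> \<mm>" for q
    using that by induction (auto simp: prod)
  then have "\<mm> \<subseteq> K" using gen K(2) K.a_closed by blast
  then show False using K(3) by blast
qed

section \<open>Symmetrization of a surjection\<close>

lemma (in artinian_local_ring_hull) exists_symmetric_surjection:
  assumes f: "f \<in> mod_hom R E (ideal_module R \<mm>)" "f ` carrier E = \<mm>"
    and two: "\<one> \<oplus> \<one> \<in> Units R" and soc: "socle R \<mm> \<subseteq> \<mm> \<cdot> \<mm>"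
  shows "\<exists>g\<in>mod_hom R E (ideal_module R \<mm>). g ` carrier E = \<mm> \<and>
    (\<forall>x\<in>carrier E. \<forall>y\<in>carrier E. g x \<odot>\<^bsub>E\<^esub> y = g y \<odot>\<^bsub>E\<^esub> x)"
proof -
  have mI: "module R (ideal_module R \<mm>)" by (rule module_ideal_module[OF is_cring is_ideal])
  note f' = mod_homD[OF f(1), simplified]
  have fc [simp]: "f x \<in> carrier R" if "x \<in> carrier E" for x using f'(1) that Icarr by blast
  have f0: "f \<zero>\<^bsub>E\<^esub> = \<zero>" using mod_hom_zero[OF E.module_axioms mI f(1)] by simp
  have fdiff: "f (x \<ominus>\<^bsub>E\<^esub> y) = \<zero> \<longleftrightarrow> f x = f y" if "x \<in> carrier E" "y \<in> carrier E" for x y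
  proof -
    have "f (x \<oplus>\<^bsub>E\<^esub> (\<ominus>\<one>) \<odot>\<^bsub>E\<^esub> y) = f x \<oplus> (\<ominus>\<one>) \<otimes> f y"
      using that by (simp add: f')
    then have "f (x \<ominus>\<^bsub>E\<^esub> y) = f x \<ominus> f y"
      using that by (simp add: E.minus_smult_one E.M.minus_eq minus_eq l_minus)
    then show ?thesis using that by (simp add: minus_eq_zero_iff)
  qed
  have eqI: "r = r'" if "r \<in> carrier R" "r' \<in> carrier R"
    "\<And>y. y \<in> carrier E \<Longrightarrow> r \<odot>\<^bsub>E\<^esub> y = r' \<odot>\<^bsub>E\<^esub> y" for r r'
  proof -
    have "r \<ominus> r' = \<zero>"
      using that by (intro faithful) (auto simp: minus_eq E.smult_l_distr E.smult_l_minus E.M.r_neg)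
    then show ?thesis using that by (simp add: minus_eq_zero_iff)
  qed
  \<comment> \<open>For fixed x the map y \<mapsto> f(y) x is an endomorphism of \<open>E\<close>,
    hence a multiplication; its multiplier is t(x).\<close>
  have "\<exists>r\<in>carrier R. \<forall>y\<in>carrier E. f y \<odot>\<^bsub>E\<^esub> x = r \<odot>\<^bsub>E\<^esub> y" if "x \<in> carrier E" for x
    using that by (intro homothety mod_homI) (auto simp: f' E.smult_l_distr E.smult_assoc1)
  then obtain t where t: "\<And>x. x \<in> carrier E \<Longrightarrow> t x \<in> carrier R"
    "\<And>x y. x \<in> carrier E \<Longrightarrow> y \<in> carrier E \<Longrightarrow> t x \<odot>\<^bsub>E\<^esub> y = f y \<odot>\<^bsub>E\<^esub> x"
    by metis
  have t_add: "t (x \<oplus>\<^bsub>E\<^esub> y) = t x \<oplus> t y" if "x \<in> carrier E" "y \<in> carrier E" for x y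
    using that t by (intro eqI) (auto simp: E.smult_l_distr E.smult_r_distr)
  have t_smult: "t (r \<odot>\<^bsub>E\<^esub> x) = r \<otimes> t x" if "r \<in> carrier R" "x \<in> carrier E" for r x
  proof (rule eqI)
    fix y assume y: "y \<in> carrier E"
    have "f y \<odot>\<^bsub>E\<^esub> (r \<odot>\<^bsub>E\<^esub> x) = r \<odot>\<^bsub>E\<^esub> (f y \<odot>\<^bsub>E\<^esub> x)"
      using that y by (simp add: m_comm flip: E.smult_assoc1)
    then show "t (r \<odot>\<^bsub>E\<^esub> x) \<odot>\<^bsub>E\<^esub> y = (r \<otimes> t x) \<odot>\<^bsub>E\<^esub> y"
      using that y t by (simp add: E.smult_assoc1)
  qed (use that t in auto)
  have t0: "t \<zero>\<^bsub>E\<^esub> = \<zero>" using t_smult[of \<zero> "\<zero>\<^bsub>E\<^esub>"] t(1) by simp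
  \<comment> \<open>Every a in \<mm> is some f(y), and f(y) x = t(x) y. So ker t lies in the socle
    directly; for ker f this takes the argument below.\<close>
  have t_socle: "a \<odot>\<^bsub>E\<^esub> x = \<zero>\<^bsub>E\<^esub>" if "t x = \<zero>" "x \<in> carrier E" "a \<in> \<mm>" for x a
  proof -
    obtain y where "y \<in> carrier E" "a = f y" using \<open>a \<in> \<mm>\<close> f(2) by blast
    then show ?thesis using t(2)[OF that(2), of y] that by simp
  qed
  have ker_f: "a \<odot>\<^bsub>E\<^esub> x = \<zero>\<^bsub>E\<^esub>" if x: "x \<in> carrier E" "f x = \<zero>" and a: "a \<in> \<mm>" for x a
  proof (cases "f e = \<zero>")
    case False
    then have "x = \<zero>\<^bsub>E\<^esub>" using mod_hom_injective[OF mI f(1) _ x(1)] x(2) by simp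
    then show ?thesis using a Icarr by simp
  next
    case True
    \<comment> \<open>Here f kills the socle, so it contains ker t in its kernel, and equality of
      the two kernels would follow by counting lengths. The chain replaces the count. It iterates J
      \<mapsto> t(preimage of J under f) from zero, so \<open>K 1\<close> is t(ker f). It is
      stationary from some index on, and stationarity is carried down to
      \<open>K 1 = K 0\<close>.\<close>
    define K where "K n = ((\<lambda>J. {t x | x. x \<in> carrier E \<and> f x \<in> J}) ^^ n) {\<zero>}" for n :: nat
    have K0: "K 0 = {\<zero>}" and KS: "K (Suc n) = {t x | x. x \<in> carrier E \<and> f x \<in> K n}" for n
      by (simp_all add: K_def)
    have K_ideal: "ideal (K n) R" for n
    proof (induction n)
      case 0 then show ?case by (simp add: K0 zeroideal)
    next
      case (Suc n)
      then interpret n: ideal "K n" R .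
      show ?case
      proof (rule ideal_of_closed)
        show "\<zero> \<in> K (Suc n)" using f0 t0 by (auto simp: KS intro!: exI[of _ "\<zero>\<^bsub>E\<^esub>"])
        fix x y assume "x \<in> K (Suc n)" "y \<in> K (Suc n)"
        then show "x \<oplus> y \<in> K (Suc n)"
          unfolding KS by clarsimp (metis E.M.a_closed f'(2) n.a_closed t_add)
      next
        fix r x assume "r \<in> carrier R" "x \<in> K (Suc n)"
        then show "r \<otimes> x \<in> K (Suc n)"
          unfolding KS by clarsimp (metis E.smult_closed f'(3) n.I_l_closed t_smult)
      qed (auto simp: KS t)
    qed
    have K_mono: "K n \<subseteq> K (Suc n)" for n
    proof (induction n)
      case 0 then show ?case using K_ideal[of 1]
        by (simp add: K0 additive_subgroup.zero_closed ideal.axioms(1))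
    next
      case (Suc n) then show ?case unfolding KS[of n] KS[of "Suc n"] by blast
    qed
    have "\<exists>I\<in>range K. \<forall>J\<in>range K. I \<subseteq> J \<longrightarrow> J = I"
      by (rule exists_maximal_member) (auto simp: K_ideal)
    then obtain n where "\<forall>J\<in>range K. K n \<subseteq> J \<longrightarrow> J = K n" by (auto simp del: ball_simps)
    with K_mono[of n] have n: "K (Suc n) = K n" by (auto dest: bspec[OF _ rangeI[of K "Suc n"]])
    \<comment> \<open>t(x) e = f(e) x = 0, so t(x) is not a unit: the image of t lies in the image
      of f.\<close>
    have t_m: "t x \<in> \<mm>" if "x \<in> carrier E" for x
    proof (rule ccontr)
      assume "t x \<notin> \<mm>"
      then have u: "t x \<in> Units R" using that t(1) by (simp add: Units_iff)
      have "t x \<odot>\<^bsub>E\<^esub> e = \<zero>\<^bsub>E\<^esub>" using t(2)[OF that, of e] True that by simp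
      then show False using unit_smult_zero[OF u] e_nonzero by simp
    qed
    \<comment> \<open>Write y = f(x). Stationarity replaces x by some x' with t(x') = t(x) and f(x')
      one step further down. The difference lies in ker t, hence in the socle, which f kills; so y =
      f(x').\<close>
    have down: "K (Suc j) = K j" if "K (Suc (Suc j)) = K (Suc j)" for j
    proof (rule subset_antisym[OF _ K_mono], rule subsetI)
      fix y assume y: "y \<in> K (Suc j)"
      then have "y \<in> \<mm>" using t_m by (auto simp: KS)
      then obtain x where x: "x \<in> carrier E" "y = f x" using f(2) by blast
      then have "t x \<in> K (Suc j)" using y that KS[of "Suc j"] by blast
      then obtain x' where x': "x' \<in> carrier E" "t x = t x'" "f x' \<in> K j" unfolding KS by blast
      define d where "d = x \<oplus>\<^bsub>E\<^esub> (\<ominus>\<one>) \<odot>\<^bsub>E\<^esub> x'"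
      have d: "d = x \<ominus>\<^bsub>E\<^esub> x'" "d \<in> carrier E" using x(1) x'(1) by (simp_all add: d_def E.minus_smult_one E.M.minus_eq)
      have "t d = t x \<oplus> (\<ominus>\<one>) \<otimes> t x'" using x(1) x'(1) by (simp add: d_def t_add t_smult)
      then have "t d = \<zero>" using x(1) x' t(1) by (simp add: l_minus r_neg)
      then obtain c where "c \<in> carrier R" "d = c \<odot>\<^bsub>E\<^esub> e" using socle_cyclic[OF d(2)] t_socle d(2) by blast
      then have "f d = \<zero>" using f'(3)[of c e] True by simp
      then have "f x = f x'" using fdiff[OF x(1) x'(1)] d(1) by simp
      then show "y \<in> K j" using x(2) x'(3) by simp
    qed
    have "K (Suc 0) = K 0" using n by (induction n) (auto dest: down)
    then have "t x = \<zero>" using x by (auto simp: KS K0)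
    then show ?thesis using t_socle x a by blast
  qed
  define \<delta> where "\<delta> x = f x \<ominus> t x" for x
  have \<delta>_soc: "\<delta> x \<in> socle R \<mm>" if x: "x \<in> carrier E" for x
    unfolding socle_def
  proof (intro CollectI conjI ballI)
    show \<delta>c: "\<delta> x \<in> carrier R" using x t by (simp add: \<delta>_def)
    fix a assume a: "a \<in> \<mm>"
    show "\<delta> x \<otimes> a = \<zero>"
    proof (rule faithful)
      fix y assume y: "y \<in> carrier E"
      have "f (f x \<odot>\<^bsub>E\<^esub> y) = f (f y \<odot>\<^bsub>E\<^esub> x)" using x y by (simp add: f' m_comm)
      then have "f (f x \<odot>\<^bsub>E\<^esub> y \<ominus>\<^bsub>E\<^esub> f y \<odot>\<^bsub>E\<^esub> x) = \<zero>" using x y by (simp add: fdiff)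
      then have "a \<odot>\<^bsub>E\<^esub> (f x \<odot>\<^bsub>E\<^esub> y \<ominus>\<^bsub>E\<^esub> f y \<odot>\<^bsub>E\<^esub> x) = \<zero>\<^bsub>E\<^esub>" using a x y by (intro ker_f) auto
      moreover have "\<delta> x \<odot>\<^bsub>E\<^esub> y = f x \<odot>\<^bsub>E\<^esub> y \<ominus>\<^bsub>E\<^esub> f y \<odot>\<^bsub>E\<^esub> x"
        using x y t by (simp add: \<delta>_def minus_eq E.smult_l_distr E.smult_l_minus E.M.minus_eq)
      ultimately show "(\<delta> x \<otimes> a) \<odot>\<^bsub>E\<^esub> y = \<zero>\<^bsub>E\<^esub>"
        using y a Icarr \<delta>c by (simp add: m_comm[of "\<delta> x"] E.smult_assoc1)
    qed (use \<delta>c a Icarr in auto)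
  qed
  have \<delta>_mm: "\<delta> x \<in> \<mm> \<cdot> \<mm>" "\<delta> x \<in> \<mm>" if "x \<in> carrier E" for x
    using \<delta>_soc[OF that] soc ideal_prod_inter[OF is_ideal is_ideal] by blast+
  define g where "g x = f x \<oplus> t x" for x
  have t_eq: "t x = f x \<ominus> \<delta> x" if "x \<in> carrier E" for x
    using that t(1)[OF that] by (simp add: \<delta>_def minus_eq minus_add r_neg2)
  have g_hom: "g \<in> mod_hom R E (ideal_module R \<mm>)"
  proof (rule mod_homI)
    fix x assume x: "x \<in> carrier E"
    then have "t x \<in> \<mm>" using t_eq f'(1) \<delta>_mm(2) by (simp add: minus_eq)
    then show "g x \<in> carrier (ideal_module R \<mm>)" using f'(1) x by (simp add: g_def)
  qed (auto simp: g_def f' t t_add t_smult a_ac r_distr)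
  note g' = mod_homD[OF g_hom, simplified]
  have gP: "ideal (g ` carrier E) R"
  proof (rule ideal_of_closed)
    show "\<zero> \<in> g ` carrier E" using f0 t0 by (auto simp: g_def intro!: image_eqI[of _ _ "\<zero>\<^bsub>E\<^esub>"])
    show "g ` carrier E \<subseteq> carrier R" using g'(1) Icarr by blast
  qed (auto simp flip: g'(2,3))
  have "g ` carrier E = \<mm>"
  proof (rule nakayama_maximal[OF gP])
    show "g ` carrier E \<subseteq> \<mm>" using g'(1) by blast
    fix a assume a: "a \<in> \<mm>"
    let ?two = "\<one> \<oplus> \<one>"
    \<comment> \<open>Halving a first gives f(x) + f(x) = a, hence a = g(x) + (f(x) - t(x)), whose
      last term lies in the square of \<mm>.\<close>
    have "inv ?two \<otimes> a \<in> \<mm>" using a two by (simp add: I_l_closed)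
    then obtain x where x: "x \<in> carrier E" "f x = inv ?two \<otimes> a" using f(2) by (metis imageE)
    have ac: "a \<in> carrier R" using a by (rule Icarr)
    have "a = (?two \<otimes> inv ?two) \<otimes> a" using two ac by simp
    also have "\<dots> = ?two \<otimes> f x" using two ac x(2) by (subst m_assoc) auto
    also have "\<dots> = f x \<oplus> f x" using x(1) by (simp add: l_distr)
    also have "\<dots> = g x \<oplus> \<delta> x"
    proof -
      have "f x = t x \<oplus> \<delta> x" using x(1) t(1) by (simp add: \<delta>_def minus_eq a_ac r_neg r_neg2)
      then show ?thesis using x(1) t(1) \<delta>_mm(2) Icarr by (simp add: g_def a_assoc)
    qed
    finally show "\<exists>p\<in>g ` carrier E. \<exists>q\<in>\<mm> \<cdot> \<mm>. a = p \<oplus> q" using x(1) \<delta>_mm(1) by blast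
  qed
  moreover have "g x \<odot>\<^bsub>E\<^esub> y = g y \<odot>\<^bsub>E\<^esub> x" if "x \<in> carrier E" "y \<in> carrier E" for x y
    using that t by (simp add: g_def E.smult_l_distr E.M.a_comm)
  ultimately show ?thesis using g_hom by blast
qed

section \<open>Lifting subrings of polynomial functions\<close>

text \<open>Evaluation at \<alpha> with the coefficients carried into a module by c. One definition
  serves both \<pi>, with values in \<open>R\<close>, and \<psi>, with values in \<open>E\<close>.
  The set \<open>B\<close> of the lemmas below is the domain on which c is additive, which for
  \<psi> is only the preimage of \<mm>.\<close>

definition horner ::
  "('a, 'e, 'p) module_scheme \<Rightarrow> 'a \<Rightarrow> ('u::zero \<Rightarrow> 'e) \<Rightarrow> 'u poly \<Rightarrow> 'e" where
  "horner M \<alpha> c p = fold_coeffs (\<lambda>a y. c a \<oplus>\<^bsub>M\<^esub> \<alpha> \<odot>\<^bsub>M\<^esub> y) p \<zero>\<^bsub>M\<^esub>"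

lemma horner_0 [simp]: "horner M \<alpha> c 0 = \<zero>\<^bsub>M\<^esub>"
  by (simp add: horner_def)

context module
begin

context
  fixes \<alpha> and c :: "'u::comm_ring_1 \<Rightarrow> 'c" and B :: "'u set"
  assumes \<alpha> [simp]: "\<alpha> \<in> carrier R"
    and B0: "0 \<in> B" and Badd: "\<And>a b. a \<in> B \<Longrightarrow> b \<in> B \<Longrightarrow> a + b \<in> B"
    and c_closed: "\<And>a. a \<in> B \<Longrightarrow> c a \<in> carrier M"
    and c_add: "\<And>a b. a \<in> B \<Longrightarrow> b \<in> B \<Longrightarrow> c (a + b) = c a \<oplus>\<^bsub>M\<^esub> c b"
begin

lemma horner_coeff_0: "c 0 = \<zero>\<^bsub>M\<^esub>"
  using c_add[OF B0 B0] c_closed[OF B0] by (metis M.add.r_cancel_one add_0)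

lemma horner_pCons: "horner M \<alpha> c (pCons a p) = c a \<oplus>\<^bsub>M\<^esub> \<alpha> \<odot>\<^bsub>M\<^esub> horner M \<alpha> c p"
proof (cases "a = 0 \<and> p = 0")
  case True
  then show ?thesis by (simp add: horner_coeff_0)
next
  case False
  then show ?thesis by (auto simp: horner_def fold_coeffs_pCons_not_0_0_eq fold_coeffs_pCons_coeff_not_0_eq)
qed

lemma horner_closed: "(\<And>i. coeff p i \<in> B) \<Longrightarrow> horner M \<alpha> c p \<in> carrier M"
proof (induction p)
  case (pCons a p)
  have "a \<in> B" "\<And>i. coeff p i \<in> B"
    using pCons.prems[of 0] pCons.prems[of "Suc _"] by simp_all
  then show ?case using pCons.IH c_closed by (simp add: horner_pCons)
qed simp

lemma horner_add:
  "(\<And>i. coeff p i \<in> B) \<Longrightarrow> (\<And>i. coeff q i \<in> B) \<Longrightarrow>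
    horner M \<alpha> c (p + q) = horner M \<alpha> c p \<oplus>\<^bsub>M\<^esub> horner M \<alpha> c q"
proof (induction p q rule: poly_induct2)
  case (pCons a p b q)
  have *: "a \<in> B" "\<And>i. coeff p i \<in> B" "b \<in> B" "\<And>i. coeff q i \<in> B"
    using pCons.prems(1)[of 0] pCons.prems(1)[of "Suc _"] pCons.prems(2)[of 0] pCons.prems(2)[of "Suc _"]
    by simp_all
  have "horner M \<alpha> c (p + q) = horner M \<alpha> c p \<oplus>\<^bsub>M\<^esub> horner M \<alpha> c q"
    using *(2,4) by (rule pCons.IH)
  moreover have "horner M \<alpha> c p \<in> carrier M" "horner M \<alpha> c q \<in> carrier M"
    using * horner_closed by auto
  ultimately show ?case
    using * c_closed by (simp add: horner_pCons c_add smult_r_distr M.a_ac)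
qed simp

lemma horner_smult:
  assumes "\<And>b. b \<in> B \<Longrightarrow> a * b \<in> B" "r \<in> carrier R" "\<And>b. b \<in> B \<Longrightarrow> c (a * b) = r \<odot>\<^bsub>M\<^esub> c b"
    and "\<And>i. coeff q i \<in> B"
  shows "horner M \<alpha> c (Polynomial.smult a q) = r \<odot>\<^bsub>M\<^esub> horner M \<alpha> c q"
  using assms(4)
proof (induction q)
  case (pCons b q)
  have *: "b \<in> B" "\<And>i. coeff q i \<in> B"
    using pCons.prems[of 0] pCons.prems[of "Suc _"] by simp_all
  have h: "horner M \<alpha> c q \<in> carrier M" using * horner_closed by auto
  have "\<alpha> \<odot>\<^bsub>M\<^esub> (r \<odot>\<^bsub>M\<^esub> horner M \<alpha> c q) = r \<odot>\<^bsub>M\<^esub> (\<alpha> \<odot>\<^bsub>M\<^esub> horner M \<alpha> c q)"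
    using h assms(2) by (simp add: R.m_comm flip: smult_assoc1)
  then show ?case
    using * h pCons.IH assms(2,3) c_closed by (simp add: horner_pCons smult_r_distr)
qed (use assms(2) in simp)

end

end

lemma poly_fun_apply:
  fixes p :: "('s \<Rightarrow> 'r::comm_ring_1) poly"
  shows "poly p x v = poly (map_poly (\<lambda>a. a v) p) (x v)"
  by (induction p) (simp_all add: map_poly_pCons)

text \<open>A coordinate function is transcendental over the functions that do not depend on it:
  with the other coordinates frozen, the given one still runs through all integers, and an integer
  polynomial with infinitely many roots is zero.\<close>

lemma poly_coordinate_eq_0:
  fixes p :: "(('s \<Rightarrow> int) \<Rightarrow> int) poly"
  assumes indep: "\<And>i v n. coeff p i (v(\<alpha> := n)) = coeff p i v"
    and zero: "poly p (\<lambda>v. v \<alpha>) = 0"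
  shows "p = 0"
proof (rule poly_eqI)
  fix i
  have "coeff p i v = 0" for v
  proof -
    have "poly (map_poly (\<lambda>a. a v) p) n = 0" for n
    proof -
      have "map_poly (\<lambda>a. a v) p = map_poly (\<lambda>a. a (v(\<alpha> := n))) p"
        by (rule poly_eqI) (simp add: coeff_map_poly indep)
      then show ?thesis
        using fun_cong[OF zero, of "v(\<alpha> := n)"] by (simp add: poly_fun_apply)
    qed
    then have "map_poly (\<lambda>a. a v) p = 0" by (metis poly_all_0_iff_0)
    then have "coeff (map_poly (\<lambda>a. a v) p) i = 0" by simp
    then show ?thesis by (simp add: coeff_map_poly)
  qed
  then show "coeff p i = coeff 0 i" by auto
qed

locale symmetric_surjection = local_ring R \<mm> + E: module R E
  for R (structure) and \<mm> and E (structure) +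
  fixes g
  assumes g_hom: "g \<in> mod_hom R E (ideal_module R \<mm>)"
    and g_surj: "g ` carrier E = \<mm>"
    and g_sym: "x \<in> carrier E \<Longrightarrow> y \<in> carrier E \<Longrightarrow> g x \<odot>\<^bsub>E\<^esub> y = g y \<odot>\<^bsub>E\<^esub> x"
begin

lemmas g_maximal = mod_homD(1)[OF g_hom, simplified]
  and g_add = mod_homD(2)[OF g_hom, simplified]
  and g_smult = mod_homD(3)[OF g_hom, simplified]

lemma g_carrier [simp]: "x \<in> carrier E \<Longrightarrow> g x \<in> carrier R"
  using g_maximal Icarr by blast

lemma g_zero [simp]: "g \<zero>\<^bsub>E\<^esub> = \<zero>"
  using g_smult[of \<zero> "\<zero>\<^bsub>E\<^esub>"] by simp

lemma g_minus: "x \<in> carrier E \<Longrightarrow> g (\<ominus>\<^bsub>E\<^esub> x) = \<ominus> g x"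
  using g_smult[of "\<ominus>\<one>" x] by (simp add: E.minus_smult_one l_minus)

end

text \<open>A subring \<open>A\<close> of the polynomial functions with integer coefficients in variables indexed by
  (representatives in \<open>R\<close> of) generators of a subring of the residue field. The
  \<open>\<psi>\<close> lifts \<open>\<pi>\<close> on \<open>\<pi>\<^sup>-\<^sup>1(\<mm>)\<close> along \<open>g\<close>; off that set it is irrelevant.\<close>

locale partial_lift = symmetric_surjection R \<mm> E g
  for R (structure) and \<mm> and E (structure) and g +
  fixes A :: "(('a \<Rightarrow> int) \<Rightarrow> int) set" and \<pi> and \<psi>
  assumes one_A: "1 \<in> A" and add_A: "a \<in> A \<Longrightarrow> b \<in> A \<Longrightarrow> a + b \<in> A"
    and mult_A: "a \<in> A \<Longrightarrow> b \<in> A \<Longrightarrow> a * b \<in> A" and minus_A: "a \<in> A \<Longrightarrow> - a \<in> A"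
    and \<pi>_closed: "a \<in> A \<Longrightarrow> \<pi> a \<in> carrier R" and \<pi>_one: "\<pi> 1 = \<one>"
    and \<pi>_add: "a \<in> A \<Longrightarrow> b \<in> A \<Longrightarrow> \<pi> (a + b) = \<pi> a \<oplus> \<pi> b"
    and \<pi>_mult: "a \<in> A \<Longrightarrow> b \<in> A \<Longrightarrow> \<pi> (a * b) = \<pi> a \<otimes> \<pi> b"
    and \<psi>_closed: "a \<in> A \<Longrightarrow> \<pi> a \<in> \<mm> \<Longrightarrow> \<psi> a \<in> carrier E"
    and g_\<psi>: "a \<in> A \<Longrightarrow> \<pi> a \<in> \<mm> \<Longrightarrow> g (\<psi> a) = \<pi> a"
    and \<psi>_add: "a \<in> A \<Longrightarrow> b \<in> A \<Longrightarrow> \<pi> a \<in> \<mm> \<Longrightarrow> \<pi> b \<in> \<mm> \<Longrightarrow> \<psi> (a + b) = \<psi> a \<oplus>\<^bsub>E\<^esub> \<psi> b"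
    and \<psi>_mult: "a \<in> A \<Longrightarrow> b \<in> A \<Longrightarrow> \<pi> b \<in> \<mm> \<Longrightarrow> \<psi> (a * b) = \<pi> a \<odot>\<^bsub>E\<^esub> \<psi> b"
    and support: "a \<in> A \<Longrightarrow> (\<And>s. (\<lambda>v. v s) \<in> A \<Longrightarrow> \<pi> (\<lambda>v. v s) = s \<Longrightarrow> v s = w s) \<Longrightarrow> a v = a w"
begin

definition Q where "Q = {a \<in> A. \<pi> a \<in> \<mm>}"

definition polys where "polys = {p. \<forall>i. coeff p i \<in> A}"

definition Q_polys where "Q_polys = {p. \<forall>i. coeff p i \<in> Q}"

lemma zero_A: "0 \<in> A"
  using add_A[OF one_A minus_A[OF one_A]] by simp

lemma \<pi>_zero: "\<pi> 0 = \<zero>"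
  using \<pi>_add[OF zero_A zero_A] \<pi>_closed[OF zero_A] by (metis add.r_cancel_one add_0)

lemma \<pi>_minus: assumes "a \<in> A" shows "\<pi> (- a) = \<ominus> \<pi> a"
proof -
  have "\<pi> (- a) \<oplus> \<pi> a = \<zero>" using \<pi>_add[OF minus_A[OF assms] assms] by (simp add: \<pi>_zero)
  then show ?thesis using \<pi>_closed assms minus_A by (metis minus_equality)
qed

lemma Q_A: "a \<in> Q \<Longrightarrow> a \<in> A"
  and Q_m: "a \<in> Q \<Longrightarrow> \<pi> a \<in> \<mm>"
  by (auto simp: Q_def)

lemma zero_Q: "0 \<in> Q"
  by (simp add: Q_def zero_A \<pi>_zero)

lemma add_Q: "a \<in> Q \<Longrightarrow> b \<in> Q \<Longrightarrow> a + b \<in> Q"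
  by (simp add: Q_def add_A \<pi>_add)

lemma mult_Q: "a \<in> A \<Longrightarrow> b \<in> Q \<Longrightarrow> a * b \<in> Q"
  by (simp add: Q_def mult_A \<pi>_mult I_l_closed \<pi>_closed)

lemma minus_Q: "a \<in> Q \<Longrightarrow> - a \<in> Q"
  by (simp add: Q_def minus_A \<pi>_minus)

lemma diff_Q: "a \<in> Q \<Longrightarrow> b \<in> Q \<Longrightarrow> a - b \<in> Q"
  using add_Q[OF _ minus_Q] by simp

lemma sum_A: "(\<And>i. i \<in> I \<Longrightarrow> f i \<in> A) \<Longrightarrow> sum f I \<in> A"
  by (induction I rule: infinite_finite_induct) (auto intro: zero_A add_A)

lemma sum_Q: "(\<And>i. i \<in> I \<Longrightarrow> f i \<in> Q) \<Longrightarrow> sum f I \<in> Q"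
  by (induction I rule: infinite_finite_induct) (auto intro: zero_Q add_Q)

lemma prime_Q:
  assumes "a \<in> A" "b \<in> A" "a * b \<in> Q" "a \<notin> Q"
  shows "b \<in> Q"
proof (rule ccontr)
  assume "b \<notin> Q"
  with assms have "\<pi> a \<in> Units R" "\<pi> b \<in> Units R"
    by (auto simp: Q_def Units_iff \<pi>_closed)
  then have "\<pi> (a * b) \<in> Units R" using assms by (simp add: \<pi>_mult)
  then show False using assms(3) by (simp add: Q_def Units_iff \<pi>_closed mult_A)
qed

lemma polysD: "p \<in> polys \<Longrightarrow> coeff p i \<in> A"
  and Q_polysD: "p \<in> Q_polys \<Longrightarrow> coeff p i \<in> Q"
  by (simp_all add: polys_def Q_polys_def)

lemma Q_polys_polys: "p \<in> Q_polys \<Longrightarrow> p \<in> polys"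
  by (simp add: polys_def Q_polys_def Q_A)

lemma polys_zero: "0 \<in> polys" by (simp add: polys_def zero_A)

lemma Q_polys_zero: "0 \<in> Q_polys" by (simp add: Q_polys_def zero_Q)

lemma polys_pCons: "pCons a p \<in> polys \<longleftrightarrow> a \<in> A \<and> p \<in> polys"
  by (auto simp: polys_def coeff_pCons split: nat.splits)

lemma Q_polys_pCons: "pCons a p \<in> Q_polys \<longleftrightarrow> a \<in> Q \<and> p \<in> Q_polys"
  by (auto simp: Q_polys_def coeff_pCons split: nat.splits)

lemma polys_add: "p \<in> polys \<Longrightarrow> q \<in> polys \<Longrightarrow> p + q \<in> polys"
  by (simp add: polys_def add_A)

lemma polys_minus: "p \<in> polys \<Longrightarrow> - p \<in> polys"
  by (simp add: polys_def minus_A)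

lemma polys_diff: "p \<in> polys \<Longrightarrow> q \<in> polys \<Longrightarrow> p - q \<in> polys"
  using polys_add[OF _ polys_minus] by simp

lemma polys_mult: "p \<in> polys \<Longrightarrow> q \<in> polys \<Longrightarrow> p * q \<in> polys"
  by (simp add: polys_def coeff_mult sum_A mult_A)

lemma polys_monom: "a \<in> A \<Longrightarrow> Polynomial.monom a n \<in> polys"
  by (simp add: polys_def zero_A)

lemma Q_polys_add: "p \<in> Q_polys \<Longrightarrow> q \<in> Q_polys \<Longrightarrow> p + q \<in> Q_polys"
  by (simp add: Q_polys_def add_Q)

lemma Q_polys_diff: "p \<in> Q_polys \<Longrightarrow> q \<in> Q_polys \<Longrightarrow> p - q \<in> Q_polys"
  by (simp add: Q_polys_def diff_Q)

lemma Q_polys_mult: "p \<in> polys \<Longrightarrow> q \<in> Q_polys \<Longrightarrow> p * q \<in> Q_polys"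
  by (simp add: polys_def Q_polys_def coeff_mult sum_Q mult_Q)

lemma Q_polys_monom: "a \<in> Q \<Longrightarrow> Polynomial.monom a n \<in> Q_polys"
  by (simp add: Q_polys_def zero_Q)

abbreviation ev where "ev \<alpha> \<equiv> horner (ring_module R) \<alpha> \<pi>"

abbreviation \<psi>_ev where "\<psi>_ev \<alpha> \<equiv> horner E \<alpha> \<psi>"

context
  fixes \<alpha> assumes \<alpha>: "\<alpha> \<in> carrier R"
begin

interpretation RM: module R "ring_module R"
  by (rule module_ring_module) (rule is_cring)


lemma ev_pCons: "ev \<alpha> (pCons a p) = \<pi> a \<oplus> \<alpha> \<otimes> ev \<alpha> p"
  by (subst RM.horner_pCons[OF \<alpha> zero_A]) (auto simp: add_A \<pi>_closed \<pi>_add)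

lemma ev_closed: "p \<in> polys \<Longrightarrow> ev \<alpha> p \<in> carrier R"
  using RM.horner_closed[OF \<alpha> zero_A, of \<pi> p] by (auto simp: add_A \<pi>_closed \<pi>_add polys_def)

lemma ev_add: "p \<in> polys \<Longrightarrow> q \<in> polys \<Longrightarrow> ev \<alpha> (p + q) = ev \<alpha> p \<oplus> ev \<alpha> q"
  using RM.horner_add[OF \<alpha> zero_A, of \<pi> p q] by (auto simp: add_A \<pi>_closed \<pi>_add polys_def)

lemma ev_smult: "a \<in> A \<Longrightarrow> p \<in> polys \<Longrightarrow> ev \<alpha> (Polynomial.smult a p) = \<pi> a \<otimes> ev \<alpha> p"
  using RM.horner_smult[OF \<alpha> zero_A, of \<pi> a "\<pi> a" p]
  by (auto simp: add_A mult_A \<pi>_closed \<pi>_add \<pi>_mult polys_def)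

lemma \<psi>_ev_pCons: "\<psi>_ev \<alpha> (pCons a p) = \<psi> a \<oplus>\<^bsub>E\<^esub> \<alpha> \<odot>\<^bsub>E\<^esub> \<psi>_ev \<alpha> p"
  by (subst E.horner_pCons[OF \<alpha> zero_Q]) (auto simp: add_Q \<psi>_closed \<psi>_add Q_A Q_m)

lemma \<psi>_ev_closed: "p \<in> Q_polys \<Longrightarrow> \<psi>_ev \<alpha> p \<in> carrier E"
  using E.horner_closed[OF \<alpha> zero_Q, of \<psi> p] by (auto simp: add_Q \<psi>_closed \<psi>_add Q_A Q_m Q_polys_def)

lemma \<psi>_ev_add: "p \<in> Q_polys \<Longrightarrow> q \<in> Q_polys \<Longrightarrow> \<psi>_ev \<alpha> (p + q) = \<psi>_ev \<alpha> p \<oplus>\<^bsub>E\<^esub> \<psi>_ev \<alpha> q"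
  using E.horner_add[OF \<alpha> zero_Q, of \<psi> p q] by (auto simp: add_Q \<psi>_closed \<psi>_add Q_A Q_m Q_polys_def)

lemma \<psi>_ev_smult:
  "a \<in> A \<Longrightarrow> p \<in> Q_polys \<Longrightarrow> \<psi>_ev \<alpha> (Polynomial.smult a p) = \<pi> a \<odot>\<^bsub>E\<^esub> \<psi>_ev \<alpha> p"
  using E.horner_smult[OF \<alpha> zero_Q, of \<psi> a "\<pi> a" p]
  by (auto simp: add_Q mult_Q \<psi>_closed \<psi>_add \<psi>_mult \<pi>_closed Q_A Q_m Q_polys_def)

lemma \<psi>_zero: "\<psi> 0 = \<zero>\<^bsub>E\<^esub>"
  by (rule E.horner_coeff_0[OF \<alpha> zero_Q, where c = \<psi>]) (auto simp: add_Q \<psi>_closed \<psi>_add Q_A Q_m)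

lemma ev_mult: "p \<in> polys \<Longrightarrow> q \<in> polys \<Longrightarrow> ev \<alpha> (p * q) = ev \<alpha> p \<otimes> ev \<alpha> q"
proof (induction p)
  case (pCons a p)
  then have a: "a \<in> A" "p \<in> polys" by (simp_all add: polys_pCons)
  have "Polynomial.smult a q \<in> polys" "pCons 0 (p * q) \<in> polys"
    using a pCons.prems by (simp_all add: polys_pCons polys_mult zero_A) (simp add: polys_def mult_A)
  then show ?case
    using a pCons ev_closed \<alpha>
    by (simp add: ev_add ev_smult ev_pCons \<pi>_zero \<pi>_closed polys_mult l_distr m_assoc)
qed (simp add: ev_closed)

text \<open>Coefficientwise, \<psi> extends as a linear map to the polynomials with coefficients in
  \<open>Q\<close>. But a polynomial may evaluate into \<mm> without having its coefficients in
  \<open>Q\<close>; this gap is what the generator \<Phi> and its lift \<theta> have to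
  fill.\<close>

lemma \<psi>_ev_mult: "p \<in> polys \<Longrightarrow> q \<in> Q_polys \<Longrightarrow> \<psi>_ev \<alpha> (p * q) = ev \<alpha> p \<odot>\<^bsub>E\<^esub> \<psi>_ev \<alpha> q"
proof (induction p)
  case (pCons a p)
  then have a: "a \<in> A" "p \<in> polys" by (simp_all add: polys_pCons)
  have "Polynomial.smult a q \<in> Q_polys" "pCons 0 (p * q) \<in> Q_polys"
    using a pCons.prems by (simp_all add: Q_polys_pCons Q_polys_mult zero_Q) (simp add: Q_polys_def mult_Q)
  then show ?case
    using a pCons ev_closed \<psi>_ev_closed \<alpha>
    by (simp add: \<psi>_ev_add \<psi>_ev_smult \<psi>_ev_pCons ev_pCons \<psi>_zero \<pi>_closed Q_polys_mult
        E.smult_l_distr E.smult_assoc1)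
qed (simp add: \<psi>_ev_closed)

lemma g_\<psi>_ev: "p \<in> Q_polys \<Longrightarrow> g (\<psi>_ev \<alpha> p) = ev \<alpha> p"
proof (induction p)
  case (pCons a p)
  then have a: "a \<in> Q" "p \<in> Q_polys" by (simp_all add: Q_polys_pCons)
  then show ?case
    using pCons.IH \<psi>_ev_closed \<alpha>
    by (simp add: \<psi>_ev_pCons ev_pCons g_add g_smult g_\<psi> \<psi>_closed Q_A Q_m)
qed simp

end

end

section \<open>Adjoining one variable to a partial lift\<close>

definition extends_lift ::
  "('r, 'm) ring_scheme \<Rightarrow> 'r set \<Rightarrow> 'u set \<Rightarrow> ('u \<Rightarrow> 'r) \<Rightarrow> ('u \<Rightarrow> 'e) \<Rightarrow>
    'u set \<Rightarrow> ('u \<Rightarrow> 'r) \<Rightarrow> ('u \<Rightarrow> 'e) \<Rightarrow> bool" where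
  "extends_lift R \<mm> A \<pi> \<psi> A' \<pi>' \<psi>' \<longleftrightarrow>
     A \<subseteq> A' \<and> (\<forall>a\<in>A. \<pi>' a = \<pi> a) \<and> (\<forall>a\<in>A. \<pi> a \<in> \<mm> \<longrightarrow> \<psi>' a = \<psi> a)"

context partial_lift
begin

text \<open>The relations satisfied by the residue class of \<open>\<alpha>\<close> are generated by \<open>\<Phi>\<close>, so a lift of
  \<open>\<Phi>(\<alpha>)\<close> along \<open>g\<close> determines the extension of \<open>\<psi>\<close>; symmetry of \<open>g\<close> makes it well defined.\<close>

lemma adjoin_element:
  assumes \<alpha>: "\<alpha> \<in> carrier R" and new: "\<not> ((\<lambda>v. v \<alpha>) \<in> A \<and> \<pi> (\<lambda>v. v \<alpha>) = \<alpha>)"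
    and \<Phi>: "\<Phi> \<in> polys" and \<theta>: "\<theta> \<in> carrier E" "g \<theta> = ev \<alpha> \<Phi>"
    and gen: "\<And>p. p \<in> polys \<Longrightarrow> ev \<alpha> p \<in> \<mm> \<Longrightarrow> \<exists>b\<in>polys. \<exists>e\<in>Q_polys. p = \<Phi> * b + e"
    and regular: "\<Phi> = 0 \<and> \<theta> = \<zero>\<^bsub>E\<^esub> \<or> (\<forall>b\<in>polys. \<Phi> * b \<in> Q_polys \<longrightarrow> b \<in> Q_polys)"
  shows "\<exists>A' \<pi>' \<psi>'. partial_lift R \<mm> E g A' \<pi>' \<psi>' \<and> extends_lift R \<mm> A \<pi> \<psi> A' \<pi>' \<psi>' \<and>
    (\<lambda>v. v \<alpha>) \<in> A' \<and> \<pi>' (\<lambda>v. v \<alpha>) = \<alpha>"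
proof -
  let ?X = "(\<lambda>v. v \<alpha>) :: ('a \<Rightarrow> int) \<Rightarrow> int"
  note ev_c = ev_closed[OF \<alpha>] and \<psi>_ev_c = \<psi>_ev_closed[OF \<alpha>]
  \<comment> \<open>The variable of \<alpha> has not been adjoined yet, so \<open>support\<close>
    makes elements of \<open>A\<close> independent of that coordinate. The new variable is therefore
    transcendental over \<open>A\<close>, and elements of the enlarged ring have unique representing
    polynomials.\<close>
  have indep: "a (v(\<alpha> := n)) = a v" if "a \<in> A" for a v n
    by (rule support[OF that]) (use new in auto)
  have inj: "p = q" if "p \<in> polys" "q \<in> polys" "poly p ?X = poly q ?X" for p q
  proof -
    have "p - q = 0"
    proof (rule poly_coordinate_eq_0)
      show "coeff (p - q) i (v(\<alpha> := n)) = coeff (p - q) i v" for i v n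
        using polys_diff[OF that(1,2)] by (intro indep polysD)
      show "poly (p - q) ?X = 0" by (simp only: poly_diff that(3) diff_self)
    qed
    then show ?thesis by simp
  qed
  \<comment> \<open>The consistency condition: a multiple of \<Phi> with coefficients in
    \<open>Q\<close> gets one value coefficientwise and one through \<theta>. When \<Phi> is not
    zero, regularity puts b into \<open>Q_polys\<close>, and the two values are the two sides of the
    symmetry of \<open>g\<close> for \<theta> and \<open>\<psi>_ev \<alpha> b\<close>.\<close>
  have \<psi>_\<Phi>: "\<psi>_ev \<alpha> (\<Phi> * b) = ev \<alpha> b \<odot>\<^bsub>E\<^esub> \<theta>" if b: "b \<in> polys" "\<Phi> * b \<in> Q_polys" for b
    using regular
  proof
    assume "\<Phi> = 0 \<and> \<theta> = \<zero>\<^bsub>E\<^esub>"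
    then show ?thesis using ev_c[OF b(1)] by simp
  next
    assume "\<forall>b\<in>polys. \<Phi> * b \<in> Q_polys \<longrightarrow> b \<in> Q_polys"
    then have bQ: "b \<in> Q_polys" using b by blast
    have "\<psi>_ev \<alpha> (\<Phi> * b) = g \<theta> \<odot>\<^bsub>E\<^esub> \<psi>_ev \<alpha> b"
      using \<psi>_ev_mult[OF \<alpha> \<Phi> bQ] \<theta>(2) by simp
    also have "\<dots> = ev \<alpha> b \<odot>\<^bsub>E\<^esub> \<theta>"
      using g_sym[OF \<theta>(1) \<psi>_ev_c[OF bQ]] g_\<psi>_ev[OF \<alpha> bQ] by simp
    finally show ?thesis .
  qed
  define A' where "A' = (\<lambda>p. poly p ?X) ` polys"
  define rep where "rep u = (THE p. p \<in> polys \<and> u = poly p ?X)" for u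
  have rep: "rep (poly p ?X) = p" if "p \<in> polys" for p
    unfolding rep_def using that inj by blast
  define \<pi>' where "\<pi>' u = ev \<alpha> (rep u)" for u
  have \<pi>': "\<pi>' (poly p ?X) = ev \<alpha> p" if "p \<in> polys" for p
    using rep[OF that] by (simp add: \<pi>'_def)
  define \<psi>' where "\<psi>' u = (THE y. \<exists>b\<in>polys. \<exists>e\<in>Q_polys. rep u = \<Phi> * b + e \<and>
    y = ev \<alpha> b \<odot>\<^bsub>E\<^esub> \<theta> \<oplus>\<^bsub>E\<^esub> \<psi>_ev \<alpha> e)" for u
  have \<psi>': "\<psi>' (poly (\<Phi> * b + e) ?X) = ev \<alpha> b \<odot>\<^bsub>E\<^esub> \<theta> \<oplus>\<^bsub>E\<^esub> \<psi>_ev \<alpha> e"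
    if b: "b \<in> polys" and e: "e \<in> Q_polys" for b e
  proof -
    have "ev \<alpha> b \<odot>\<^bsub>E\<^esub> \<theta> \<oplus>\<^bsub>E\<^esub> \<psi>_ev \<alpha> e = ev \<alpha> b' \<odot>\<^bsub>E\<^esub> \<theta> \<oplus>\<^bsub>E\<^esub> \<psi>_ev \<alpha> e'"
      if b': "b' \<in> polys" and e': "e' \<in> Q_polys" and eq: "\<Phi> * b + e = \<Phi> * b' + e'" for b' e'
    proof -
      have db: "b - b' \<in> polys" using b b' by (rule polys_diff)
      have de: "\<Phi> * (b - b') = e' - e" using eq by (simp add: algebra_simps)
      have dQ: "\<Phi> * (b - b') \<in> Q_polys" unfolding de using e' e by (rule Q_polys_diff)
      have "ev \<alpha> b = ev \<alpha> (b - b') \<oplus> ev \<alpha> b'" using ev_add[OF \<alpha> db b'] by simp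
      then have "ev \<alpha> b \<odot>\<^bsub>E\<^esub> \<theta> = \<psi>_ev \<alpha> (\<Phi> * (b - b')) \<oplus>\<^bsub>E\<^esub> ev \<alpha> b' \<odot>\<^bsub>E\<^esub> \<theta>"
        using \<psi>_\<Phi>[OF db dQ] ev_c[OF db] ev_c[OF b'] \<theta>(1) by (simp add: E.smult_l_distr)
      moreover have "\<psi>_ev \<alpha> e' = \<psi>_ev \<alpha> (\<Phi> * (b - b')) \<oplus>\<^bsub>E\<^esub> \<psi>_ev \<alpha> e"
        using \<psi>_ev_add[OF \<alpha> dQ e] de by simp
      ultimately show ?thesis
        using \<psi>_ev_c[OF dQ] \<psi>_ev_c[OF e] ev_c[OF b'] \<theta>(1) by (simp add: E.M.a_ac)
    qed
    moreover have "rep (poly (\<Phi> * b + e) ?X) = \<Phi> * b + e"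
      by (rule rep[OF polys_add[OF polys_mult[OF \<Phi> b] Q_polys_polys[OF e]]])
    ultimately show ?thesis unfolding \<psi>'_def using b e by (intro the_equality) metis+
  qed
  have dec: "\<exists>b e. b \<in> polys \<and> e \<in> Q_polys \<and> p = \<Phi> * b + e" if "p \<in> polys" "ev \<alpha> p \<in> \<mm>" for p
    using gen[OF that] by blast
  have const: "poly [:a:] ?X = a" "a \<in> A \<Longrightarrow> [:a:] \<in> polys" "a \<in> Q \<Longrightarrow> [:a:] \<in> Q_polys" for a
    by (simp_all add: polys_pCons polys_zero Q_polys_pCons Q_polys_zero)
  have AA': "a \<in> A'" and \<pi>'_A: "\<pi>' a = \<pi> a" if "a \<in> A" for a
  proof -
    show "a \<in> A'" unfolding A'_def using const[of a] that by (metis imageI)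
    show "\<pi>' a = \<pi> a" using \<pi>'[OF const(2)[OF that]] const(1)[of a] ev_pCons[OF \<alpha>, of a 0] that \<alpha>
      by (simp add: \<pi>_closed)
  qed
  have \<psi>'_A: "\<psi>' a = \<psi> a" if "a \<in> A" "\<pi> a \<in> \<mm>" for a
  proof -
    have aQ: "a \<in> Q" using that by (simp add: Q_def)
    show ?thesis
      using \<psi>'[OF polys_zero const(3)[OF aQ]] const(1)[of a] \<psi>_ev_pCons[OF \<alpha>, of a 0] that \<alpha> \<theta>(1)
      by (simp add: \<psi>_closed)
  qed
  have X_poly: "[:0, 1:] \<in> polys" by (simp add: polys_pCons zero_A one_A polys_zero)
  have XA': "?X \<in> A'" and \<pi>'_X: "\<pi>' ?X = \<alpha>"
  proof -
    have "poly [:0, 1:] ?X = ?X" by simp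
    then show "?X \<in> A'" unfolding A'_def using X_poly by (metis imageI)
    show "\<pi>' ?X = \<alpha>" using \<pi>'[OF X_poly] \<alpha> by (simp add: ev_pCons[OF \<alpha>] \<pi>_zero \<pi>_one)
  qed
  have A'E: "\<exists>p\<in>polys. u = poly p ?X" if "u \<in> A'" for u
    using that by (auto simp: A'_def)
  have A'I: "poly p ?X \<in> A'" if "p \<in> polys" for p
    using that by (auto simp: A'_def)
  have "partial_lift R \<mm> E g A' \<pi>' \<psi>'"
  proof unfold_locales
    show "1 \<in> A'" "\<pi>' 1 = \<one>" using AA' \<pi>'_A one_A \<pi>_one by simp_all
  next
    fix u assume "u \<in> A'"
    then obtain p where p: "p \<in> polys" "u = poly p ?X" using A'E by blast
    show "\<pi>' u \<in> carrier R" using p \<pi>' ev_c by simp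
    show "- u \<in> A'" using A'I[OF polys_minus[OF p(1)]] p(2) by simp
    show "\<psi>' u \<in> carrier E" "g (\<psi>' u) = \<pi>' u" if "\<pi>' u \<in> \<mm>"
    proof -
      have "ev \<alpha> p \<in> \<mm>" using that \<pi>' p by simp
      then obtain b e where be: "b \<in> polys" "e \<in> Q_polys" "p = \<Phi> * b + e" using dec p by blast
      have "\<psi>' u = ev \<alpha> b \<odot>\<^bsub>E\<^esub> \<theta> \<oplus>\<^bsub>E\<^esub> \<psi>_ev \<alpha> e" using \<psi>'[OF be(1,2)] be(3) p(2) by simp
      moreover have "\<pi>' u = ev \<alpha> \<Phi> \<otimes> ev \<alpha> b \<oplus> ev \<alpha> e"
        using \<pi>'[OF p(1)] p(2) be \<Phi> by (simp add: ev_add[OF \<alpha>] ev_mult[OF \<alpha>] polys_mult Q_polys_polys)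
      ultimately show "\<psi>' u \<in> carrier E" "g (\<psi>' u) = \<pi>' u"
        using be ev_c \<psi>_ev_c \<theta> g_\<psi>_ev[OF \<alpha>] \<Phi> by (simp_all add: g_add g_smult m_comm)
    qed
    fix v w :: "'a \<Rightarrow> int"
    assume agree: "\<And>s. (\<lambda>v. v s) \<in> A' \<Longrightarrow> \<pi>' (\<lambda>v. v s) = s \<Longrightarrow> v s = w s"
    have "a v = a w" if "a \<in> A" for a
      by (rule support[OF that]) (use agree AA' \<pi>'_A in auto)
    then have "map_poly (\<lambda>a. a v) p = map_poly (\<lambda>a. a w) p"
      using p(1) by (intro poly_eqI) (auto simp: coeff_map_poly polys_def)
    moreover have "v \<alpha> = w \<alpha>" using agree XA' \<pi>'_X by blast
    ultimately show "u v = u w" by (simp add: p(2) poly_fun_apply)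
  next
    fix u u' assume "u \<in> A'" "u' \<in> A'"
    then obtain p p' where p: "p \<in> polys" "u = poly p ?X" "p' \<in> polys" "u' = poly p' ?X" using A'E by metis
    have sum: "u + u' = poly (p + p') ?X" and prod: "u * u' = poly (p * p') ?X" using p by simp_all
    note pp = polys_add[OF p(1,3)] polys_mult[OF p(1,3)]
    show "u + u' \<in> A'" "u * u' \<in> A'" unfolding sum prod using pp A'I by blast+
    show "\<pi>' (u + u') = \<pi>' u \<oplus> \<pi>' u'" "\<pi>' (u * u') = \<pi>' u \<otimes> \<pi>' u'"
      unfolding sum prod using pp p \<pi>' by (simp_all add: ev_add[OF \<alpha>] ev_mult[OF \<alpha>] del: poly_add poly_mult)
    assume "\<pi>' u' \<in> \<mm>"
    then have "ev \<alpha> p' \<in> \<mm>" using \<pi>' p by simp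
    then obtain b' e' where be': "b' \<in> polys" "e' \<in> Q_polys" "p' = \<Phi> * b' + e'" using dec p by blast
    have \<psi>u': "\<psi>' u' = ev \<alpha> b' \<odot>\<^bsub>E\<^esub> \<theta> \<oplus>\<^bsub>E\<^esub> \<psi>_ev \<alpha> e'" using \<psi>'[OF be'(1,2)] be'(3) p(4) by simp
    have "u * u' = poly (\<Phi> * (p * b') + p * e') ?X" unfolding prod be'(3) by (simp add: algebra_simps)
    then have 1: "\<psi>' (u * u') = ev \<alpha> (p * b') \<odot>\<^bsub>E\<^esub> \<theta> \<oplus>\<^bsub>E\<^esub> \<psi>_ev \<alpha> (p * e')"
      using \<psi>'[OF polys_mult[OF p(1) be'(1)] Q_polys_mult[OF p(1) be'(2)]] by simp
    have \<pi>'u: "\<pi>' u = ev \<alpha> p" using \<pi>' p(1,2) by simp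
    show "\<psi>' (u * u') = \<pi>' u \<odot>\<^bsub>E\<^esub> \<psi>' u'"
      unfolding 1 \<psi>u' \<pi>'u using p(1) be'(1,2) ev_c \<psi>_ev_c \<theta>(1)
      by (simp add: ev_mult[OF \<alpha>] \<psi>_ev_mult[OF \<alpha>] E.smult_r_distr E.smult_assoc1)
    assume "\<pi>' u \<in> \<mm>"
    then have "ev \<alpha> p \<in> \<mm>" using \<pi>' p by simp
    then obtain b e where be: "b \<in> polys" "e \<in> Q_polys" "p = \<Phi> * b + e" using dec p by blast
    have \<psi>u: "\<psi>' u = ev \<alpha> b \<odot>\<^bsub>E\<^esub> \<theta> \<oplus>\<^bsub>E\<^esub> \<psi>_ev \<alpha> e" using \<psi>'[OF be(1,2)] be(3) p(2) by simp
    have "u + u' = poly (\<Phi> * (b + b') + (e + e')) ?X"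
      unfolding sum be(3) be'(3) by (simp add: algebra_simps)
    then have 2: "\<psi>' (u + u') = ev \<alpha> (b + b') \<odot>\<^bsub>E\<^esub> \<theta> \<oplus>\<^bsub>E\<^esub> \<psi>_ev \<alpha> (e + e')"
      using \<psi>'[OF polys_add[OF be(1) be'(1)] Q_polys_add[OF be(2) be'(2)]] by simp
    show "\<psi>' (u + u') = \<psi>' u \<oplus>\<^bsub>E\<^esub> \<psi>' u'"
      unfolding 2 \<psi>u \<psi>u' using be(1,2) be'(1,2) ev_c \<psi>_ev_c \<theta>(1)
      by (simp add: ev_add[OF \<alpha>] \<psi>_ev_add[OF \<alpha>] E.smult_l_distr E.M.a_ac)
  qed
  then show ?thesis
    using AA' \<pi>'_A \<psi>'_A XA' \<pi>'_X unfolding extends_lift_def by blast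
qed

text \<open>The relation a X - 1 vanishes at the inverse of \<open>\<pi> a\<close>, so zero lifts
  its value. \<open>A\<close> modulo \<open>Q\<close> may still fail to be a field, so nothing is
  divided by leading coefficients; the constant term -1 allows division from the bottom
  instead.\<close>

lemma adjoin_inverse:
  assumes a: "a \<in> A" "\<pi> a \<notin> \<mm>" and no_inv: "\<And>b. b \<in> A \<Longrightarrow> \<pi> (a * b) \<noteq> \<one>"
  shows "\<exists>A' \<pi>' \<psi>'. partial_lift R \<mm> E g A' \<pi>' \<psi>' \<and> extends_lift R \<mm> A \<pi> \<psi> A' \<pi>' \<psi>' \<and> A' \<noteq> A"
proof -
  define \<alpha> where "\<alpha> = inv (\<pi> a)"
  have u: "\<pi> a \<in> Units R" using a by (simp add: Units_iff \<pi>_closed)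
  have \<alpha>: "\<alpha> \<in> carrier R" "\<pi> a \<otimes> \<alpha> = \<one>" "\<alpha> \<otimes> \<pi> a = \<one>" using u by (simp_all add: \<alpha>_def)
  let ?X = "(\<lambda>v. v \<alpha>) :: ('a \<Rightarrow> int) \<Rightarrow> int"
  have new: "\<not> (?X \<in> A \<and> \<pi> ?X = \<alpha>)"
    using no_inv[of ?X] a \<alpha> \<pi>_mult[of a ?X] by auto
  define \<Phi> where "\<Phi> = [:- 1, a:]"
  have \<Phi>: "\<Phi> \<in> polys" by (simp add: \<Phi>_def polys_pCons polys_zero one_A minus_A a)
  have ev_\<Phi>: "ev \<alpha> \<Phi> = \<zero>"
    using a \<alpha> by (simp add: \<Phi>_def ev_pCons \<pi>_minus \<pi>_one one_A \<pi>_closed l_neg)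
  have gen: "\<exists>b\<in>polys. \<exists>e\<in>Q_polys. p = \<Phi> * b + e"
    if "degree p \<le> n" "p \<in> polys" "ev \<alpha> p \<in> \<mm>" for p n
    using that
  proof (induction n arbitrary: p)
    case 0
    then obtain c where p: "p = [:c:]" by (metis degree_eq_zeroE le_zero_eq)
    then have "c \<in> A" "\<pi> c \<in> \<mm>" using 0 \<alpha> by (simp_all add: polys_pCons ev_pCons \<pi>_closed)
    then have "p \<in> Q_polys" using p by (simp add: Q_polys_pCons Q_polys_zero Q_def)
    then show ?case using polys_zero by (intro bexI[of _ 0] bexI[of _ p]) auto
  next
    case (Suc n)
    obtain c q where p: "p = pCons c q" by (cases p)
    have c: "c \<in> A" "q \<in> polys" using Suc.prems(2) by (simp_all add: p polys_pCons)
    \<comment> \<open>c + X q = - c (a X - 1) + X (q + c a) trades the constant term for a multiple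
      of \<Phi>. Since \<alpha> is a unit, q + c a again evaluates into \<mm>, and the degree bound
      has dropped.\<close>
    define q' where "q' = q + [:c * a:]"
    have ca: "[:c * a:] \<in> polys" using a c by (simp add: polys_pCons polys_zero mult_A)
    have q': "q' \<in> polys" using c ca by (simp add: q'_def polys_add)
    have "degree q \<le> n" using Suc.prems(1) by (cases "q = 0") (auto simp: p)
    then have "degree q' \<le> n" unfolding q'_def by (intro degree_add_le) auto
    have evq: "ev \<alpha> q' = ev \<alpha> q \<oplus> \<pi> c \<otimes> \<pi> a"
      using a c ca \<alpha> by (simp add: q'_def ev_add ev_pCons \<pi>_mult \<pi>_closed)
    have "\<alpha> \<otimes> ev \<alpha> q' = \<alpha> \<otimes> ev \<alpha> q \<oplus> \<pi> c \<otimes> (\<alpha> \<otimes> \<pi> a)"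
      using a(1) c \<alpha>(1) ev_closed[OF \<alpha>(1) c(2)]
      by (simp add: evq r_distr \<pi>_closed m_lcomm)
    also have "\<dots> = ev \<alpha> p"
      using \<alpha> c ev_closed[OF \<alpha>(1) c(2)] by (simp add: p ev_pCons \<pi>_closed a_comm)
    finally have "\<pi> a \<otimes> (\<alpha> \<otimes> ev \<alpha> q') \<in> \<mm>" using Suc.prems(3) a by (simp add: I_l_closed \<pi>_closed)
    moreover have "\<pi> a \<otimes> (\<alpha> \<otimes> ev \<alpha> q') = ev \<alpha> q'"
      using \<alpha> a ev_closed[OF \<alpha>(1) q'] m_assoc[of "\<pi> a" \<alpha> "ev \<alpha> q'"] by (simp add: \<pi>_closed)
    ultimately have "ev \<alpha> q' \<in> \<mm>" by simp
    then obtain b e where be: "b \<in> polys" "e \<in> Q_polys" "q' = \<Phi> * b + e"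
      using Suc.IH \<open>degree q' \<le> n\<close> q' by blast
    have "p = \<Phi> * [:- c:] + pCons 0 q'"
      by (simp add: p q'_def \<Phi>_def mult.commute)
    also have "\<dots> = \<Phi> * pCons (- c) b + pCons 0 e"
      by (simp add: be(3) algebra_simps)
    finally show ?case
      using be c by (intro bexI[of _ "pCons (- c) b"] bexI[of _ "pCons 0 e"])
        (auto simp: polys_pCons Q_polys_pCons minus_A zero_Q)
  qed
  have regular: "b \<in> Q_polys" if b: "b \<in> polys" "\<Phi> * b \<in> Q_polys" for b
  proof -
    \<comment> \<open>Because of the constant term -1, the coefficients of b are recovered one after
      the other from those of the product.\<close>
    have "coeff b i \<in> Q" for i
    proof (induction i)
      case 0
      have "coeff (\<Phi> * b) 0 = - coeff b 0" by (simp add: \<Phi>_def)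
      then show ?case using Q_polysD[OF b(2), of 0] minus_Q[of "- coeff b 0"] by simp
    next
      case (Suc i)
      have "coeff (\<Phi> * b) (Suc i) = a * coeff b i - coeff b (Suc i)" by (simp add: \<Phi>_def)
      then have "coeff b (Suc i) = a * coeff b i - coeff (\<Phi> * b) (Suc i)" by (simp only: diff_diff_eq2 add_diff_cancel_left')
      then show ?case using diff_Q[OF mult_Q[OF a(1) Suc] Q_polysD[OF b(2), of "Suc i"]] by (simp only:)
    qed
    then show ?thesis by (simp add: Q_polys_def)
  qed
  obtain A' \<pi>' \<psi>' where A': "partial_lift R \<mm> E g A' \<pi>' \<psi>'" "extends_lift R \<mm> A \<pi> \<psi> A' \<pi>' \<psi>'"
    "?X \<in> A'" "\<pi>' ?X = \<alpha>"
    using adjoin_element[OF \<alpha>(1) new \<Phi> E.zero_closed _ gen[OF order_refl]] ev_\<Phi> regular by auto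
  have "A' \<noteq> A"
  proof
    assume "A' = A"
    then have "?X \<in> A" "\<pi> ?X = \<alpha>" using A' by (auto simp: extends_lift_def)
    then show False using new by blast
  qed
  then show ?thesis using A' by blast
qed

text \<open>Now \<open>A\<close> modulo \<open>Q\<close> is a field, so the polynomials evaluating
  into \<mm> reduce to a principal ideal over it: zero if the residue class of \<alpha> is
  transcendental, otherwise generated by its minimal polynomial, which \<Phi> lifts up to a constant
  factor. If the class of \<alpha> is represented in \<open>A\<close> already, \<Phi> is linear; so
  the step enlarges the image of \<pi> inside a residue class as well.\<close>

lemma adjoin_residue:
  assumes inverses: "\<And>a. a \<in> A \<Longrightarrow> \<pi> a \<notin> \<mm> \<Longrightarrow> \<exists>b\<in>A. \<pi> (a * b) = \<one>"
    and \<alpha>: "\<alpha> \<in> carrier R" and new: "\<And>a. a \<in> A \<Longrightarrow> \<pi> a \<noteq> \<alpha>"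
  shows "\<exists>A' \<pi>' \<psi>'. partial_lift R \<mm> E g A' \<pi>' \<psi>' \<and> extends_lift R \<mm> A \<pi> \<psi> A' \<pi>' \<psi>' \<and> A' \<noteq> A"
proof -
  let ?X = "(\<lambda>v. v \<alpha>) :: ('a \<Rightarrow> int) \<Rightarrow> int"
  have new': "\<not> (?X \<in> A \<and> \<pi> ?X = \<alpha>)" using new by blast
  \<comment> \<open>The polynomials with nonzero reduction modulo \<open>Q\<close> that vanish at
    the residue class of \<alpha>; \<Phi> will be one of least degree.\<close>
  define Z where "Z = {p \<in> polys. ev \<alpha> p \<in> \<mm> \<and> p \<notin> Q_polys}"
  have ev_Q: "ev \<alpha> p \<in> \<mm>" if "p \<in> Q_polys" for p
    using that g_\<psi>_ev[OF \<alpha> that] \<psi>_ev_closed[OF \<alpha> that] g_maximal by metis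
  have "\<exists>\<Phi> \<theta>. \<Phi> \<in> polys \<and> \<theta> \<in> carrier E \<and> g \<theta> = ev \<alpha> \<Phi> \<and>
    (\<forall>p\<in>polys. ev \<alpha> p \<in> \<mm> \<longrightarrow> (\<exists>b\<in>polys. \<exists>e\<in>Q_polys. p = \<Phi> * b + e)) \<and>
    (\<Phi> = 0 \<and> \<theta> = \<zero>\<^bsub>E\<^esub> \<or> (\<forall>b\<in>polys. \<Phi> * b \<in> Q_polys \<longrightarrow> b \<in> Q_polys))"
  proof (cases "Z = {}")
    case True
    then show ?thesis
      using polys_zero by (intro exI[of _ 0] exI[of _ "\<zero>\<^bsub>E\<^esub>"]) (auto simp: Z_def)
  next
    case False
    then obtain \<Phi> where \<Phi>: "\<Phi> \<in> Z" and least: "\<And>p. p \<in> Z \<Longrightarrow> degree \<Phi> \<le> degree p"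
      using ex_has_least_nat[of "\<lambda>p. p \<in> Z" _ degree] by blast
    then have \<Phi>P: "\<Phi> \<in> polys" "ev \<alpha> \<Phi> \<in> \<mm>" "\<Phi> \<notin> Q_polys" by (auto simp: Z_def)
    define d where "d = degree \<Phi>"
    define l where "l = lead_coeff \<Phi>"
    have lA: "l \<in> A" using \<Phi>P(1) by (simp add: l_def polysD)
    have small: "p \<in> Q_polys" if "p \<in> polys" "ev \<alpha> p \<in> \<mm>" "degree p < d" for p
      using least[of p] that by (force simp: Z_def d_def)
    have diff_m: "ev \<alpha> (p - q) \<in> \<mm>" if "p \<in> polys" "q \<in> polys" "ev \<alpha> p \<in> \<mm>" "ev \<alpha> q \<in> \<mm>" for p q
    proof -
      have "ev \<alpha> p = ev \<alpha> (p - q) \<oplus> ev \<alpha> q"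
        using ev_add[OF \<alpha> polys_diff[OF that(1,2)] that(2)] by simp
      then have "ev \<alpha> (p - q) = ev \<alpha> p \<ominus> ev \<alpha> q"
        using ev_closed[OF \<alpha> polys_diff[OF that(1,2)]] ev_closed[OF \<alpha> that(2)]
        by (simp add: minus_eq a_assoc r_neg)
      then show ?thesis using that by (simp add: minus_eq)
    qed
    have drop: "degree (p - q) < n" if "degree p \<le> n" "degree q \<le> n" "coeff p n = coeff q n" "0 < n"
      for p q :: "(('a \<Rightarrow> int) \<Rightarrow> int) poly" and n
    proof -
      have "degree (p - q) \<le> n" using that by (intro degree_diff_le) auto
      moreover have "coeff (p - q) n = 0" using that by simp
      ultimately show ?thesis using that(4) by (metis degree_0 leading_coeff_0_iff le_neq_implies_less)
    qed
    \<comment> \<open>If the leading coefficient were in \<open>Q\<close>, the rest of \<Phi> would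
      have smaller degree and, by minimality, coefficients in \<open>Q\<close>; then so would
      \<Phi>. A constant \<Phi> is its own leading coefficient.\<close>
    have lQ: "l \<notin> Q"
    proof
      assume lQ: "l \<in> Q"
      let ?t = "Polynomial.monom l d"
      have tQ: "?t \<in> Q_polys" using lQ by (rule Q_polys_monom)
      show False
      proof (cases "d = 0")
        case True
        then obtain c where "\<Phi> = [:c:]" unfolding d_def by (rule degree_eq_zeroE)
        then have "\<Phi> = [:l:]" by (simp add: l_def)
        then show False using lQ \<Phi>P(3) by (simp add: Q_polys_pCons Q_polys_zero)
      next
        case False
        have "degree (\<Phi> - ?t) < d"
          using False by (intro drop) (auto simp: d_def l_def degree_monom_le)
        then have "\<Phi> - ?t \<in> Q_polys"
          using small polys_diff[OF \<Phi>P(1) Q_polys_polys[OF tQ]]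
            diff_m[OF \<Phi>P(1) Q_polys_polys[OF tQ] \<Phi>P(2) ev_Q[OF tQ]] by blast
        then have "\<Phi> - ?t + ?t \<in> Q_polys" using tQ by (rule Q_polys_add)
        then show False using \<Phi>P(3) by simp
      qed
    qed
    then obtain l' where l': "l' \<in> A" "\<pi> (l * l') = \<one>"
      using inverses lA by (auto simp: Q_def)
    have gen: "\<exists>b\<in>polys. \<exists>e\<in>Q_polys. p = \<Phi> * b + e"
      if "degree p < n" "p \<in> polys" "ev \<alpha> p \<in> \<mm>" for p n
      using that
    proof (induction n arbitrary: p)
      case (Suc n)
      show ?case
      proof (cases "degree p < d")
        case True
        then show ?thesis
          using small Suc.prems polys_zero by (intro bexI[of _ 0] bexI[of _ p]) auto
      next
        case False
        define N where "N = degree p"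
        define c where "c = coeff p N"
        have c: "c \<in> A" using Suc.prems(2) by (simp add: c_def polysD)
        define b where "b = Polynomial.monom (l' * c) (N - d)"
        have b: "b \<in> polys" unfolding b_def using l' c by (intro polys_monom mult_A)
        \<comment> \<open>\<open>l'\<close> inverts \<open>l\<close> only after applying \<pi>. So
          \<Phi> b matches the leading term of p up to a coefficient in \<open>Q\<close>, and the
          monomial \<open>e\<close> absorbs that error.\<close>
        have r: "c - l * (l' * c) \<in> Q"
        proof -
          have A: "c - l * (l' * c) = c + - (l * l' * c)" by (simp add: algebra_simps)
          have "l * l' \<in> A" using lA l' by (simp add: mult_A)
          then show ?thesis unfolding A Q_def using c l'
            by (simp add: add_A minus_A mult_A \<pi>_add \<pi>_minus \<pi>_mult \<pi>_closed r_neg del: add_uminus_conv_diff)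
        qed
        define e where "e = Polynomial.monom (c - l * (l' * c)) N"
        have e: "e \<in> Q_polys" unfolding e_def using r by (rule Q_polys_monom)
        have q: "\<Phi> * b + e \<in> polys" by (rule polys_add[OF polys_mult[OF \<Phi>P(1) b] Q_polys_polys[OF e]])
        have evq: "ev \<alpha> (\<Phi> * b + e) \<in> \<mm>"
          using \<Phi>P(1,2) b e ev_Q[OF e] ev_closed[OF \<alpha> b]
          by (simp add: ev_add[OF \<alpha>] ev_mult[OF \<alpha>] polys_mult Q_polys_polys I_r_closed)
        define p' where "p' = p - (\<Phi> * b + e)"
        have p': "p' \<in> polys" "ev \<alpha> p' \<in> \<mm>"
          unfolding p'_def using Suc.prems q evq by (auto intro: polys_diff diff_m)
        have Nd: "d \<le> N" using False by (simp add: N_def)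
        have "degree b \<le> N - d" by (simp add: b_def degree_monom_le)
        then have "degree (\<Phi> * b) \<le> N" using degree_mult_le[of \<Phi> b] Nd by (simp add: d_def)
        then have dq: "degree (\<Phi> * b + e) \<le> N" by (intro degree_add_le) (auto simp: e_def degree_monom_le)
        have "coeff (\<Phi> * b) N = (l' * c) * coeff \<Phi> (N - (N - d))"
          using Nd unfolding b_def by (subst mult.commute) (simp only: coeff_monom_mult, simp)
        also have "\<dots> = l * (l' * c)" using Nd by (simp add: l_def d_def mult.commute)
        finally have "coeff (\<Phi> * b) N = l * (l' * c)" .
        then have cq: "coeff p N = coeff (\<Phi> * b + e) N" by (simp add: e_def c_def)
        have "\<exists>b'\<in>polys. \<exists>e'\<in>Q_polys. p' = \<Phi> * b' + e'"
        \<comment> \<open>In degree zero the degree cannot drop, but there equal leading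
          coefficients already make p' zero.\<close>
        proof (cases "N = 0")
          case True
          then have "p' = 0" using cq dq unfolding p'_def N_def
            by (metis degree_eq_zeroE coeff_pCons_0 diff_self le_zero_eq)
          then show ?thesis using polys_zero Q_polys_zero by (intro bexI[of _ 0]) auto
        next
          case False
          then have "degree p' < N" unfolding p'_def using dq cq by (intro drop) (auto simp: N_def)
          then show ?thesis using Suc.IH[of p'] Suc.prems(1) p' by (simp add: N_def)
        qed
        then obtain b' e' where be': "b' \<in> polys" "e' \<in> Q_polys" "p' = \<Phi> * b' + e'" by blast
        have "p = p' + (\<Phi> * b + e)" by (simp add: p'_def)
        also have "\<dots> = \<Phi> * (b' + b) + (e' + e)" unfolding be'(3) by (simp only: distrib_left add_ac)
        finally show ?thesis using polys_add[OF be'(1) b] Q_polys_add[OF be'(2) e] by blast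
      qed
    qed simp
    have regular: "b \<in> Q_polys" if "degree b < n" "b \<in> polys" "\<Phi> * b \<in> Q_polys" for b n
      using that
    proof (induction n arbitrary: b)
      case (Suc n)
      let ?c = "lead_coeff b" and ?t = "Polynomial.monom (lead_coeff b) (degree b)"
      have "coeff (\<Phi> * b) (degree \<Phi> + degree b) = l * ?c"
        by (simp add: coeff_mult_degree_sum l_def)
      \<comment> \<open>The top coefficient of the product is the product of the leading
        coefficients. \<open>Q\<close> is prime and omits \<open>l\<close>, so the leading term of b
        can be split off with its coefficient in \<open>Q\<close>.\<close>
      then have "l * ?c \<in> Q" using Q_polysD[OF Suc.prems(3)] by metis
      then have cQ: "?c \<in> Q" using prime_Q lA lQ Suc.prems(2) polysD by blast
      then have tQ: "?t \<in> Q_polys" by (rule Q_polys_monom)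
      have "b - ?t \<in> Q_polys"
      proof (cases "degree b = 0")
        case True
        then have "b = ?t" by (metis degree_eq_zeroE monom_0 coeff_pCons_0)
        then show ?thesis using Q_polys_zero by simp
      next
        case False
        then have "degree (b - ?t) < degree b" by (intro drop) (auto simp: degree_monom_le)
        moreover have "\<Phi> * (b - ?t) = \<Phi> * b - \<Phi> * ?t" by (rule right_diff_distrib)
        then have "\<Phi> * (b - ?t) \<in> Q_polys"
          using Q_polys_diff[OF Suc.prems(3) Q_polys_mult[OF \<Phi>P(1) tQ]] by simp
        ultimately show ?thesis
          using Suc.IH[of "b - ?t"] Suc.prems(1,2) polys_diff[OF Suc.prems(2) Q_polys_polys[OF tQ]] by simp
      qed
      then have "b - ?t + ?t \<in> Q_polys" using tQ by (rule Q_polys_add)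
      then show ?case by simp
    qed simp
    obtain \<theta> where "\<theta> \<in> carrier E" "g \<theta> = ev \<alpha> \<Phi>" using \<Phi>P(2) g_surj by (metis imageE)
    then show ?thesis using \<Phi>P(1) gen[OF lessI] regular[OF lessI] by blast
  qed
  then obtain \<Phi> \<theta> where *: "\<Phi> \<in> polys" "\<theta> \<in> carrier E" "g \<theta> = ev \<alpha> \<Phi>"
    "\<And>p. p \<in> polys \<Longrightarrow> ev \<alpha> p \<in> \<mm> \<Longrightarrow> \<exists>b\<in>polys. \<exists>e\<in>Q_polys. p = \<Phi> * b + e"
    "\<Phi> = 0 \<and> \<theta> = \<zero>\<^bsub>E\<^esub> \<or> (\<forall>b\<in>polys. \<Phi> * b \<in> Q_polys \<longrightarrow> b \<in> Q_polys)"
    by blast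
  obtain A' \<pi>' \<psi>' where A': "partial_lift R \<mm> E g A' \<pi>' \<psi>'" "extends_lift R \<mm> A \<pi> \<psi> A' \<pi>' \<psi>'"
    "?X \<in> A'" "\<pi>' ?X = \<alpha>"
    using adjoin_element[OF \<alpha> new' *] by blast
  then have "A' \<noteq> A" using new by (auto simp: extends_lift_def)
  then show ?thesis using A' by blast
qed

end

section \<open>The integers as a starting point, and maximal lifts\<close>

lemma integer_ideal_principal:
  fixes P :: "int \<Rightarrow> bool"
  assumes "P 0" "\<And>m n. P m \<Longrightarrow> P n \<Longrightarrow> P (m - n)" and mult: "\<And>m n. P n \<Longrightarrow> P (m * n)"
  shows "\<exists>c. \<forall>n. P n \<longleftrightarrow> c dvd n"
proof (cases "\<exists>n>0. P n")
  case False
  have "n = 0" if "P n" for n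
    using False that mult[OF that, of "- 1"] by (metis less_linear mult_minus1 neg_0_less_iff_less)
  then show ?thesis using assms(1) by (intro exI[of _ 0]) auto
next
  case True
  define k where "k = (LEAST k. 0 < k \<and> P (int k))"
  have "\<exists>k::nat. 0 < k \<and> P (int k)" using True by (metis zero_less_imp_eq_int)
  then have k: "0 < k" "P (int k)" and least: "\<And>j. 0 < j \<Longrightarrow> P (int j) \<Longrightarrow> k \<le> j"
    unfolding k_def by (auto intro: LeastI_ex[THEN conjunct1] LeastI_ex[THEN conjunct2] Least_le)
  have "int k dvd n" if "P n" for n
  proof -
    have "P (n - (n div int k) * int k)" using assms(2) mult k(2) that by blast
    then have "P (n mod int k)" by (simp add: minus_div_mult_eq_mod)
    moreover have "0 \<le> n mod int k" "n mod int k < int k" using k(1) by simp_all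
    ultimately have "n mod int k = 0"
      using least[of "nat (n mod int k)"] by (cases "n mod int k = 0") auto
    then show ?thesis by auto
  qed
  moreover have "P n" if "int k dvd n" for n using that mult[OF k(2)] by (metis dvd_def mult.commute)
  ultimately show ?thesis by blast
qed

context symmetric_surjection
begin

text \<open>The constants form a copy of the integers. Those mapping into \<mm> are the multiples of
  c, up to sign the characteristic of the residue field, so one \<theta> above the image of c
  determines \<psi>. If c is zero, division by it returns zero, which is right since only the
  integer 0 then maps into \<mm>.\<close>

lemma exists_partial_lift: "\<exists>A \<pi> \<psi>. partial_lift R \<mm> E g A \<pi> \<psi>"
proof -
  define i where "i n = add_pow R n \<one>" for n :: int
  have i_c [simp]: "i n \<in> carrier R" for n by (simp add: i_def)
  have i_add: "i (m + n) = i m \<oplus> i n" for m n by (simp add: i_def add.int_pow_mult)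
  have i_mult: "i (m * n) = i m \<otimes> i n" for m n
    by (simp add: i_def add_pow_ldistr_int add.int_pow_pow mult.commute)
  have i_0: "i 0 = \<zero>" using i_add[of 0 0] by (metis add.r_cancel_one add_0 i_c)
  have i_1: "i 1 = \<one>" by (simp add: i_def)
  have i_diff: "i (m - n) = i m \<ominus> i n" for m n
    using i_add[of "m - n" n] by (simp add: minus_eq a_assoc r_neg)
  have "\<exists>c. \<forall>n. i n \<in> \<mm> \<longleftrightarrow> c dvd n"
    by (rule integer_ideal_principal) (auto simp: i_0 i_diff i_mult minus_eq I_l_closed)
  then obtain c where c: "\<And>n. i n \<in> \<mm> \<longleftrightarrow> c dvd n" by blast
  then obtain \<theta> where \<theta>: "\<theta> \<in> carrier E" "g \<theta> = i c" using g_surj by (metis dvd_refl imageE)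
  let ?\<pi> = "\<lambda>u :: ('a \<Rightarrow> int) \<Rightarrow> int. i (u (\<lambda>_. 0))"
  let ?\<psi> = "\<lambda>u :: ('a \<Rightarrow> int) \<Rightarrow> int. i (u (\<lambda>_. 0) div c) \<odot>\<^bsub>E\<^esub> \<theta>"
  have "partial_lift R \<mm> E g (range (\<lambda>n _. n)) ?\<pi> ?\<psi>"
  proof unfold_locales
    fix a :: "('a \<Rightarrow> int) \<Rightarrow> int" assume "a \<in> range (\<lambda>n _. n)"
    then obtain m where a: "a = (\<lambda>_. m)" by auto
    show "- a \<in> range (\<lambda>n _. n)" by (auto simp: a fun_Compl_def)
    show "?\<pi> a \<in> carrier R" by simp
    show "?\<psi> a \<in> carrier E" using \<theta> by simp
    show "g (?\<psi> a) = ?\<pi> a" if "?\<pi> a \<in> \<mm>"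
      using that \<theta> c by (simp add: a g_smult flip: i_mult)
    show "a v = a w" for v w by (simp add: a)
    fix b :: "('a \<Rightarrow> int) \<Rightarrow> int" assume "b \<in> range (\<lambda>n _. n)"
    then obtain n where b: "b = (\<lambda>_. n)" by auto
    show "a + b \<in> range (\<lambda>n _. n)" "a * b \<in> range (\<lambda>n _. n)" by (auto simp: a b plus_fun_def times_fun_def)
    show "?\<pi> (a + b) = ?\<pi> a \<oplus> ?\<pi> b" "?\<pi> (a * b) = ?\<pi> a \<otimes> ?\<pi> b"
      by (simp_all add: i_add i_mult)
    assume bm: "?\<pi> b \<in> \<mm>"
    then show "?\<psi> (a * b) = ?\<pi> a \<odot>\<^bsub>E\<^esub> ?\<psi> b"
      using \<theta> c by (simp add: a b i_mult E.smult_assoc1 flip: div_mult_swap)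
    assume "?\<pi> a \<in> \<mm>"
    then show "?\<psi> (a + b) = ?\<psi> a \<oplus>\<^bsub>E\<^esub> ?\<psi> b"
      using bm \<theta> c by (simp add: a b div_add i_add E.smult_l_distr)
  next
    show "1 \<in> range (\<lambda>n (_::'a \<Rightarrow> int). n)" by (auto simp: one_fun_def)
  qed (simp add: i_1)
  then show ?thesis by blast
qed

text \<open>Extension of lifts becomes inclusion of sets, as Zorn's lemma for subsets requires. The
  arbitrary values of \<psi> off the preimage of \<mm> are normalised to zero, since otherwise a
  lift and its extension could have incomparable graphs.\<close>

definition lift_graph where
  "lift_graph A \<pi> \<psi> = (\<lambda>a. (a, \<pi> a, if \<pi> a \<in> \<mm> then \<psi> a else \<zero>\<^bsub>E\<^esub>)) ` A"

lemma exists_maximal_lift: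
  "\<exists>A \<pi> \<psi>. partial_lift R \<mm> E g A \<pi> \<psi> \<and>
    (\<forall>A' \<pi>' \<psi>'. partial_lift R \<mm> E g A' \<pi>' \<psi>' \<longrightarrow> extends_lift R \<mm> A \<pi> \<psi> A' \<pi>' \<psi>' \<longrightarrow> A' = A)"
proof -
  define Z where "Z = {lift_graph A \<pi> \<psi> | A \<pi> \<psi>. partial_lift R \<mm> E g A \<pi> \<psi>}"
  have "\<exists>M\<in>Z. \<forall>X\<in>Z. M \<subseteq> X \<longrightarrow> X = M"
  proof (rule subset_Zorn_nonempty)
    show "Z \<noteq> {}" using exists_partial_lift unfolding Z_def by blast
    fix C assume C: "C \<noteq> {}" "subset.chain Z C"
    define H where "H = \<Union>C"
    have member: "\<exists>A \<pi> \<psi>. partial_lift R \<mm> E g A \<pi> \<psi> \<and> h = lift_graph A \<pi> \<psi>" if "h \<in> C" for h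
      using that C(2) unfolding subset_chain_def Z_def by blast
    have two: "\<exists>h\<in>C. p \<in> h \<and> q \<in> h" if "p \<in> H" "q \<in> H" for p q
      using that C(2) unfolding H_def subset_chain_def by blast
    have functional: "r = r'" "x = x'" if mem: "(a, r, x) \<in> H" "(a, r', x') \<in> H" for a r x r' x'
    proof -
      obtain h where "h \<in> C" "(a, r, x) \<in> h" "(a, r', x') \<in> h" using two[OF mem] by blast
      with member show "r = r'" "x = x'" by (fastforce simp: lift_graph_def)+
    qed
    define A where "A = fst ` H"
    define \<pi> where "\<pi> a = (THE r. \<exists>x. (a, r, x) \<in> H)" for a
    define \<psi> where "\<psi> a = (THE x. \<exists>r. (a, r, x) \<in> H)" for a
    have H: "\<pi> a = r" "\<psi> a = x" if "(a, r, x) \<in> H" for a r x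
      unfolding \<pi>_def \<psi>_def using that functional by blast+
    \<comment> \<open>Each axiom of a lift speaks of at most two elements of the subring, and two
      elements of the union lie in one member of the chain; so the axioms are inherited from
      there.\<close>
    have common: "\<exists>A\<^sub>0 \<pi>\<^sub>0 \<psi>\<^sub>0. partial_lift R \<mm> E g A\<^sub>0 \<pi>\<^sub>0 \<psi>\<^sub>0 \<and> extends_lift R \<mm> A\<^sub>0 \<pi>\<^sub>0 \<psi>\<^sub>0 A \<pi> \<psi> \<and> a \<in> A\<^sub>0 \<and> b \<in> A\<^sub>0 \<and>
        lift_graph A\<^sub>0 \<pi>\<^sub>0 \<psi>\<^sub>0 \<in> C"
      if ab: "a \<in> A" "b \<in> A" for a b
    proof -
      obtain p q where pq: "p \<in> H" "fst p = a" "q \<in> H" "fst q = b" using ab unfolding A_def by auto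
      then obtain h where h: "h \<in> C" "p \<in> h" "q \<in> h" using two by blast
      then obtain A\<^sub>0 \<pi>\<^sub>0 \<psi>\<^sub>0 where h0: "partial_lift R \<mm> E g A\<^sub>0 \<pi>\<^sub>0 \<psi>\<^sub>0" "h = lift_graph A\<^sub>0 \<pi>\<^sub>0 \<psi>\<^sub>0"
        using member by blast
      have "a \<in> A\<^sub>0" "b \<in> A\<^sub>0" using h(2,3) pq unfolding h0(2) lift_graph_def by auto
      moreover have "extends_lift R \<mm> A\<^sub>0 \<pi>\<^sub>0 \<psi>\<^sub>0 A \<pi> \<psi>"
      proof -
        have cH: "(c, \<pi>\<^sub>0 c, if \<pi>\<^sub>0 c \<in> \<mm> then \<psi>\<^sub>0 c else \<zero>\<^bsub>E\<^esub>) \<in> H" if "c \<in> A\<^sub>0" for c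
          unfolding H_def using h(1) that unfolding h0(2) lift_graph_def by blast
        show ?thesis
          unfolding extends_lift_def
        proof (intro conjI ballI impI subsetI)
          fix c assume c: "c \<in> A\<^sub>0"
          show "c \<in> A" unfolding A_def using cH[OF c] by force
          show "\<pi> c = \<pi>\<^sub>0 c" using H(1)[OF cH[OF c]] .
          show "\<psi> c = \<psi>\<^sub>0 c" if "\<pi>\<^sub>0 c \<in> \<mm>" using H(2)[OF cH[OF c]] that by simp
        qed
      qed
      ultimately show ?thesis using h0 h(1) by blast
    qed
    have "partial_lift R \<mm> E g A \<pi> \<psi>"
    proof unfold_locales
      obtain h where "h \<in> C" using C(1) by blast
      then obtain A\<^sub>0 \<pi>\<^sub>0 \<psi>\<^sub>0 where h0: "partial_lift R \<mm> E g A\<^sub>0 \<pi>\<^sub>0 \<psi>\<^sub>0" "h = lift_graph A\<^sub>0 \<pi>\<^sub>0 \<psi>\<^sub>0"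
        using member by blast
      interpret L: partial_lift R \<mm> E g A\<^sub>0 \<pi>\<^sub>0 \<psi>\<^sub>0 by fact
      have "(1, \<pi>\<^sub>0 1, if \<pi>\<^sub>0 1 \<in> \<mm> then \<psi>\<^sub>0 1 else \<zero>\<^bsub>E\<^esub>) \<in> H"
        unfolding H_def using \<open>h \<in> C\<close> L.one_A unfolding h0(2) lift_graph_def by blast
      then show "1 \<in> A" "\<pi> 1 = \<one>" using H(1) L.\<pi>_one unfolding A_def by force+
    next
      fix a b :: "('a \<Rightarrow> int) \<Rightarrow> int" assume "a \<in> A" "b \<in> A"
      then obtain A\<^sub>0 \<pi>\<^sub>0 \<psi>\<^sub>0 where L: "partial_lift R \<mm> E g A\<^sub>0 \<pi>\<^sub>0 \<psi>\<^sub>0" and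
        ext: "extends_lift R \<mm> A\<^sub>0 \<pi>\<^sub>0 \<psi>\<^sub>0 A \<pi> \<psi>" and ab: "a \<in> A\<^sub>0" "b \<in> A\<^sub>0"
        using common by metis
      interpret L: partial_lift R \<mm> E g A\<^sub>0 \<pi>\<^sub>0 \<psi>\<^sub>0 by (rule L)
      have sub: "c \<in> A\<^sub>0 \<Longrightarrow> c \<in> A" and \<pi>0: "c \<in> A\<^sub>0 \<Longrightarrow> \<pi> c = \<pi>\<^sub>0 c"
        and \<psi>0: "c \<in> A\<^sub>0 \<Longrightarrow> \<pi>\<^sub>0 c \<in> \<mm> \<Longrightarrow> \<psi> c = \<psi>\<^sub>0 c" for c
        using ext unfolding extends_lift_def by auto
      note cl = L.add_A[OF ab] L.mult_A[OF ab] L.minus_A[OF ab(1)]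
      show "a + b \<in> A" "a * b \<in> A" "- a \<in> A" using sub cl by blast+
      show "\<pi> a \<in> carrier R" "\<pi> (a + b) = \<pi> a \<oplus> \<pi> b" "\<pi> (a * b) = \<pi> a \<otimes> \<pi> b"
        using ab cl by (simp_all add: \<pi>0 L.\<pi>_closed L.\<pi>_add L.\<pi>_mult)
      show "\<psi> a \<in> carrier E" "g (\<psi> a) = \<pi> a" if "\<pi> a \<in> \<mm>"
        using that ab by (simp_all add: \<pi>0 \<psi>0 L.\<psi>_closed L.g_\<psi>)
      show "\<psi> (a + b) = \<psi> a \<oplus>\<^bsub>E\<^esub> \<psi> b" if "\<pi> a \<in> \<mm>" "\<pi> b \<in> \<mm>"
        using that ab cl by (simp add: \<pi>0 \<psi>0 L.\<psi>_add L.\<pi>_add)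
      show "\<psi> (a * b) = \<pi> a \<odot>\<^bsub>E\<^esub> \<psi> b" if "\<pi> b \<in> \<mm>"
        using that ab cl by (simp add: \<pi>0 \<psi>0 L.\<psi>_mult L.\<pi>_mult I_l_closed L.\<pi>_closed)
      fix v w :: "'a \<Rightarrow> int" assume agree: "\<And>s. (\<lambda>v. v s) \<in> A \<Longrightarrow> \<pi> (\<lambda>v. v s) = s \<Longrightarrow> v s = w s"
      show "a v = a w" by (rule L.support[OF ab(1)]) (use agree sub \<pi>0 in auto)
    qed
    moreover have "H = lift_graph A \<pi> \<psi>"
    proof
      show "H \<subseteq> lift_graph A \<pi> \<psi>"
      proof
        fix p assume p: "p \<in> H"
        obtain a r x where prx: "p = (a, r, x)" by (cases p)
        obtain h where h: "h \<in> C" "p \<in> h" using p unfolding H_def by blast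
        then obtain A\<^sub>0 \<pi>\<^sub>0 \<psi>\<^sub>0 where "h = lift_graph A\<^sub>0 \<pi>\<^sub>0 \<psi>\<^sub>0" using member by blast
        then have "x = (if r \<in> \<mm> then x else \<zero>\<^bsub>E\<^esub>)" using h(2) prx by (auto simp: lift_graph_def)
        then have "p = (a, \<pi> a, if \<pi> a \<in> \<mm> then \<psi> a else \<zero>\<^bsub>E\<^esub>)"
          using p H[of a r x] unfolding prx by (auto split: if_splits)
        moreover have "a \<in> A" using p unfolding A_def prx by force
        ultimately show "p \<in> lift_graph A \<pi> \<psi>" unfolding lift_graph_def by blast
      qed
      show "lift_graph A \<pi> \<psi> \<subseteq> H"
      proof
        fix p assume "p \<in> lift_graph A \<pi> \<psi>"
        then obtain a where a: "a \<in> A" "p = (a, \<pi> a, if \<pi> a \<in> \<mm> then \<psi> a else \<zero>\<^bsub>E\<^esub>)"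
          by (auto simp: lift_graph_def)
        then obtain A\<^sub>0 \<pi>\<^sub>0 \<psi>\<^sub>0 where
          ext: "extends_lift R \<mm> A\<^sub>0 \<pi>\<^sub>0 \<psi>\<^sub>0 A \<pi> \<psi>" and "a \<in> A\<^sub>0" "lift_graph A\<^sub>0 \<pi>\<^sub>0 \<psi>\<^sub>0 \<in> C"
          using common by metis
        moreover from this have "p \<in> lift_graph A\<^sub>0 \<pi>\<^sub>0 \<psi>\<^sub>0"
          using a unfolding extends_lift_def lift_graph_def by (auto intro!: image_eqI[of _ _ a])
        ultimately show "p \<in> H" unfolding H_def by blast
      qed
    qed
    ultimately show "\<Union>C \<in> Z" unfolding Z_def H_def by blast
  qed
  then obtain M where M: "M \<in> Z" "\<And>X. X \<in> Z \<Longrightarrow> M \<subseteq> X \<Longrightarrow> X = M" by blast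
  then obtain A \<pi> \<psi> where L: "partial_lift R \<mm> E g A \<pi> \<psi>" and "M = lift_graph A \<pi> \<psi>"
    unfolding Z_def by blast
  with M have max: "\<And>X. X \<in> Z \<Longrightarrow> lift_graph A \<pi> \<psi> \<subseteq> X \<Longrightarrow> X = lift_graph A \<pi> \<psi>" by blast
  have fst_graph: "fst ` lift_graph B \<rho> \<chi> = B" for B :: "(('a \<Rightarrow> int) \<Rightarrow> int) set" and \<rho> \<chi>
    by (auto simp: lift_graph_def image_image)
  have "A' = A" if "partial_lift R \<mm> E g A' \<pi>' \<psi>'" "extends_lift R \<mm> A \<pi> \<psi> A' \<pi>' \<psi>'" for A' \<pi>' \<psi>'
  proof -
    have "lift_graph A \<pi> \<psi> \<subseteq> lift_graph A' \<pi>' \<psi>'"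
      using that(2) unfolding extends_lift_def lift_graph_def by (auto intro!: image_eqI)
    then have "lift_graph A' \<pi>' \<psi>' = lift_graph A \<pi> \<psi>" using that(1) by (intro max) (auto simp: Z_def)
    then show ?thesis using fst_graph by metis
  qed
  then show ?thesis using L by blast
qed

lemma exists_surjective_lift: "\<exists>A \<pi> \<psi>. partial_lift R \<mm> E g A \<pi> \<psi> \<and> \<pi> ` A = carrier R"
proof -
  obtain A \<pi> \<psi> where L: "partial_lift R \<mm> E g A \<pi> \<psi>"
    and max: "\<And>A' \<pi>' \<psi>'. partial_lift R \<mm> E g A' \<pi>' \<psi>' \<Longrightarrow> extends_lift R \<mm> A \<pi> \<psi> A' \<pi>' \<psi>' \<Longrightarrow> A' = A"
    using exists_maximal_lift by blast
  interpret L: partial_lift R \<mm> E g A \<pi> \<psi> by fact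
  have inverses: "\<exists>b\<in>A. \<pi> (a * b) = \<one>" if "a \<in> A" "\<pi> a \<notin> \<mm>" for a
    using L.adjoin_inverse[OF that] max by blast
  have "\<exists>a\<in>A. \<pi> a = \<alpha>" if "\<alpha> \<in> carrier R" for \<alpha>
    using L.adjoin_residue[OF inverses that] max by blast
  then have "\<pi> ` A = carrier R" using L.\<pi>_closed by blast
  then show ?thesis using L by blast
qed

end

section \<open>The Gorenstein ring\<close>

text \<open>A ring surjecting onto \<open>R\<close> in which the \<open>R\<close>-module \<open>E\<close> sits, via \<open>\<iota>\<close>, as the preimage of
  \<open>\<mm>\<close>.\<close>

locale ring_lift = symmetric_surjection R \<mm> E g + S: cring S
  for R (structure) and \<mm> and E (structure) and g and S (structure) +
  fixes p and \<iota>
  assumes p_hom: "p \<in> ring_hom S R" and p_surj: "p ` carrier S = carrier R"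
    and \<iota>_closed: "x \<in> carrier E \<Longrightarrow> \<iota> x \<in> carrier S"
    and p_\<iota>: "x \<in> carrier E \<Longrightarrow> p (\<iota> x) = g x"
    and \<iota>_add: "x \<in> carrier E \<Longrightarrow> y \<in> carrier E \<Longrightarrow> \<iota> (x \<oplus>\<^bsub>E\<^esub> y) = \<iota> x \<oplus>\<^bsub>S\<^esub> \<iota> y"
    and \<iota>_inj: "inj_on \<iota> (carrier E)"
    and \<iota>_mult: "s \<in> carrier S \<Longrightarrow> x \<in> carrier E \<Longrightarrow> s \<otimes>\<^bsub>S\<^esub> \<iota> x = \<iota> (p s \<odot>\<^bsub>E\<^esub> x)"
    and ker_p: "s \<in> carrier S \<Longrightarrow> p s = \<zero> \<Longrightarrow> s \<in> \<iota> ` carrier E"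

text \<open>\<open>code\<close> embeds ker g into the type of \<open>R\<close>, which lets the
  quotient of \<open>A\<close> be carried by pairs. \<open>full\<close> makes \<psi> surjective, a
  property that the construction of the lift does not provide by itself.\<close>

lemma (in symmetric_surjection) exists_ring_lift:
  fixes code :: "_ \<Rightarrow> 'a"
  assumes code: "inj_on code {x \<in> carrier E. g x = \<zero>}"
    and full: "\<And>W. submodule W R E \<Longrightarrow> g ` W = \<mm> \<Longrightarrow> W = carrier E"
  shows "\<exists>(S :: ('a \<times> 'a) ring) p \<iota>. ring_lift R \<mm> E g S p \<iota>"
proof -
  obtain A \<pi> \<psi> where L: "partial_lift R \<mm> E g A \<pi> \<psi>" and \<pi>_surj: "\<pi> ` A = carrier R"
    using exists_surjective_lift by blast
  interpret L: partial_lift R \<mm> E g A \<pi> \<psi> by fact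
  define B :: "(('a \<Rightarrow> int) \<Rightarrow> int) ring"
    where "B = \<lparr>carrier = A, monoid.mult = (*), one = 1, ring.zero = 0, add = (+)\<rparr>"
  have B_simps [simp]: "carrier B = A" "\<one>\<^bsub>B\<^esub> = 1" "\<zero>\<^bsub>B\<^esub> = 0"
    "a \<otimes>\<^bsub>B\<^esub> b = a * b" "a \<oplus>\<^bsub>B\<^esub> b = a + b" for a b
    by (simp_all add: B_def)
  interpret B: cring B
  proof (rule cringI)
    show "abelian_group B"
      by (rule abelian_groupI)
        (auto simp: add_ac intro: L.add_A L.zero_A bexI[of _ "- _"] L.minus_A)
    show "Group.comm_monoid B"
      by (rule comm_monoidI) (auto simp: mult_ac intro: L.mult_A L.one_A)
  qed (auto simp: distrib_right)
  have B_minus: "a \<ominus>\<^bsub>B\<^esub> b = a + - b" if "a \<in> A" "b \<in> A" for a b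
  proof -
    have "\<ominus>\<^bsub>B\<^esub> b = - b" using that L.minus_A by (intro B.minus_equality) auto
    then show ?thesis by (simp add: B.minus_eq del: add_uminus_conv_diff)
  qed
  define K where "K = {a \<in> A. \<pi> a = \<zero> \<and> \<psi> a = \<zero>\<^bsub>E\<^esub>}"
  have zm: "\<zero> \<in> \<mm>" by simp
  have \<psi>0: "\<psi> 0 = \<zero>\<^bsub>E\<^esub>" by (rule L.\<psi>_zero[of \<zero>]) simp
  have K: "ideal K B"
    by (rule B.ideal_of_closed)
      (auto simp: K_def L.zero_A L.\<pi>_zero \<psi>0 L.add_A L.mult_A L.\<pi>_add L.\<pi>_mult L.\<psi>_add L.\<psi>_mult L.\<pi>_closed)
  define \<sigma> where "\<sigma> r = (SOME a. a \<in> A \<and> \<pi> a = r)" for r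
  have \<sigma>: "\<sigma> (\<pi> a) \<in> A" "\<pi> (\<sigma> (\<pi> a)) = \<pi> a" if "a \<in> A" for a
    using someI[of "\<lambda>b. b \<in> A \<and> \<pi> b = \<pi> a" a] that by (auto simp: \<sigma>_def)
  \<comment> \<open>\<sigma> fixes a base point in each fibre of \<pi>. The difference to the base
    point lies in ker \<pi>, where \<psi> separates elements modulo \<open>K\<close> and has values
    in ker g. So \<open>F\<close> is a complete invariant modulo \<open>K\<close>, and its values
    can serve as elements of the quotient ring.\<close>
  define F where "F a = (\<pi> a, code (\<psi> (a + - \<sigma> (\<pi> a))))" for a
  have \<pi>_diff: "\<pi> (a + - b) = \<zero> \<longleftrightarrow> \<pi> a = \<pi> b" if "a \<in> A" "b \<in> A" for a b
    using that minus_eq_zero_iff[of "\<pi> a" "\<pi> b"]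
    by (simp add: L.\<pi>_add L.minus_A L.\<pi>_minus L.\<pi>_closed minus_eq del: add_uminus_conv_diff)
  have sub_A: "a + - b \<in> A" "\<pi> (a + - b) = \<zero>" if "a \<in> A" "b \<in> A" "\<pi> a = \<pi> b" for a b
    using L.add_A[OF that(1) L.minus_A[OF that(2)]] \<pi>_diff[OF that(1,2)] that(3) by blast+
  have \<psi>_diff: "\<psi> (a + - b) = \<zero>\<^bsub>E\<^esub> \<longleftrightarrow> \<psi> (a + - \<sigma> (\<pi> a)) = \<psi> (b + - \<sigma> (\<pi> b))"
    if ab: "a \<in> A" "b \<in> A" "\<pi> a = \<pi> b" for a b
  proof -
    have s: "\<sigma> (\<pi> b) \<in> A" "\<pi> (\<sigma> (\<pi> b)) = \<pi> b" using \<sigma> ab by auto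
    note 1 = sub_A[OF ab] and 2 = sub_A[OF ab(2) s(1) s(2)[symmetric]]
    have "a + - \<sigma> (\<pi> b) = (a + - b) + (b + - \<sigma> (\<pi> b))" by simp
    then have "\<psi> (a + - \<sigma> (\<pi> b)) = \<psi> (a + - b) \<oplus>\<^bsub>E\<^esub> \<psi> (b + - \<sigma> (\<pi> b))"
      using L.\<psi>_add[OF 1(1) 2(1)] 1(2) 2(2) zm by (simp only:)
    moreover have "\<psi> (a + - b) \<in> carrier E" "\<psi> (b + - \<sigma> (\<pi> b)) \<in> carrier E"
      using L.\<psi>_closed 1 2 zm by (simp_all del: add_uminus_conv_diff)
    ultimately show ?thesis using ab(3) by (simp del: add_uminus_conv_diff)
  qed
  have ker_\<psi>: "\<psi> (a + - \<sigma> (\<pi> a)) \<in> {x \<in> carrier E. g x = \<zero>}" if a: "a \<in> A" for a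
  proof -
    have "a + - \<sigma> (\<pi> a) \<in> A" "\<pi> (a + - \<sigma> (\<pi> a)) = \<zero>"
      using sub_A[OF a \<sigma>(1)[OF a] \<sigma>(2)[OF a, symmetric]] .
    then show ?thesis using L.\<psi>_closed L.g_\<psi> zm by (simp del: add_uminus_conv_diff)
  qed
  have F_eq: "F a = F b \<longleftrightarrow> a \<ominus>\<^bsub>B\<^esub> b \<in> K" if ab: "a \<in> A" "b \<in> A" for a b
  proof -
    have "F a = F b \<longleftrightarrow> \<pi> a = \<pi> b \<and> \<psi> (a + - \<sigma> (\<pi> a)) = \<psi> (b + - \<sigma> (\<pi> b))"
      unfolding F_def using inj_on_eq_iff[OF code ker_\<psi>[OF ab(1)] ker_\<psi>[OF ab(2)]] by blast
    also have "\<dots> \<longleftrightarrow> \<pi> (a + - b) = \<zero> \<and> \<psi> (a + - b) = \<zero>\<^bsub>E\<^esub>"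
      using \<psi>_diff[OF ab] \<pi>_diff[OF ab] by blast
    also have "\<dots> \<longleftrightarrow> a \<ominus>\<^bsub>B\<^esub> b \<in> K"
      using L.add_A[OF ab(1) L.minus_A[OF ab(2)]] by (simp only: K_def B_minus[OF ab] mem_Collect_eq) simp
    finally show ?thesis .
  qed
  have F_mor: "weak_ring_morphism F K B"
    by (rule weak_ring_morphismI[OF K]) (simp add: F_eq)
  define S where "S = image_ring F B"
  have F_hom: "F \<in> ring_hom B S"
    unfolding S_def by (rule B.weak_ring_morphism_is_hom[OF F_mor])
  note F = ring_hom_memE[OF F_hom, simplified]
  have S_carrier: "carrier S = F ` A" by (simp add: S_def image_ring_carrier)
  interpret S: ring S unfolding S_def by (rule B.image_ring_is_ring[OF F_mor])
  interpret S: cring S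
    by (intro cring.intro comm_monoid.intro comm_monoid_axioms.intro S.ring_axioms S.monoid_axioms)
      (auto simp: S_carrier mult.commute simp flip: F(2))
  have W: "submodule (\<psi> ` L.Q) R E"
  proof (rule E.submodule_of_closed)
    show "\<psi> ` L.Q \<subseteq> carrier E" using L.\<psi>_closed by (auto simp: L.Q_def)
    show "\<zero>\<^bsub>E\<^esub> \<in> \<psi> ` L.Q" using \<psi>0 L.zero_Q by (metis imageI)
  next
    fix x y assume "x \<in> \<psi> ` L.Q" "y \<in> \<psi> ` L.Q"
    then obtain a b where "a \<in> L.Q" "x = \<psi> a" "b \<in> L.Q" "y = \<psi> b" by blast
    then show "x \<oplus>\<^bsub>E\<^esub> y \<in> \<psi> ` L.Q"
      using L.\<psi>_add[of a b] L.add_Q[of a b] L.Q_A L.Q_m by (metis imageI)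
  next
    fix r x assume "r \<in> carrier R" "x \<in> \<psi> ` L.Q"
    then obtain a b where "a \<in> A" "r = \<pi> a" "b \<in> L.Q" "x = \<psi> b" using \<pi>_surj by blast
    then show "r \<odot>\<^bsub>E\<^esub> x \<in> \<psi> ` L.Q"
      using L.\<psi>_mult[of a b] L.mult_Q[of a b] L.Q_A L.Q_m by (metis imageI)
  qed
  have "g ` \<psi> ` L.Q = \<mm>"
  proof
    show "g ` \<psi> ` L.Q \<subseteq> \<mm>" using L.g_\<psi> L.Q_A L.Q_m by auto
    show "\<mm> \<subseteq> g ` \<psi> ` L.Q"
    proof
      fix r assume r: "r \<in> \<mm>"
      then obtain a where a: "a \<in> A" "\<pi> a = r" using \<pi>_surj Icarr by (metis imageE)
      then have "a \<in> L.Q" "g (\<psi> a) = r" using L.g_\<psi> r by (auto simp: L.Q_def)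
      then show "r \<in> g ` \<psi> ` L.Q" by blast
    qed
  qed
  then have \<psi>_surj: "\<psi> ` L.Q = carrier E" using full W by blast
  define \<tau> where "\<tau> x = (SOME a. a \<in> L.Q \<and> \<psi> a = x)" for x
  have \<tau>: "\<tau> x \<in> A" "\<pi> (\<tau> x) \<in> \<mm>" "\<psi> (\<tau> x) = x" if "x \<in> carrier E" for x
  proof -
    from that have "x \<in> \<psi> ` L.Q" by (simp only: \<psi>_surj)
    then obtain a where "a \<in> L.Q \<and> \<psi> a = x" by blast
    then have "\<tau> x \<in> L.Q \<and> \<psi> (\<tau> x) = x" unfolding \<tau>_def by (rule someI[where P = "\<lambda>a. a \<in> L.Q \<and> \<psi> a = x"])
    then show "\<tau> x \<in> A" "\<pi> (\<tau> x) \<in> \<mm>" "\<psi> (\<tau> x) = x" by (auto simp: L.Q_def)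
  qed
  \<comment> \<open>On the preimage of \<mm> the value of \<pi> is \<open>g\<close> of the value of
    \<psi>, so \<psi> alone determines the class modulo \<open>K\<close>. This identifies the
    preimage of \<mm> in S with \<open>E\<close>.\<close>
  have F_\<tau>: "F a = F (\<tau> (\<psi> a))" if a: "a \<in> A" "\<pi> a \<in> \<mm>" for a
  proof -
    define b where "b = \<tau> (\<psi> a)"
    have b: "b \<in> A" "\<pi> b \<in> \<mm>" "\<psi> b = \<psi> a" using \<tau> L.\<psi>_closed a by (auto simp: b_def)
    have \<pi>: "\<pi> a = \<pi> b" using L.g_\<psi>[OF a] L.g_\<psi>[OF b(1,2)] b(3) by simp
    note ab = sub_A[OF a(1) b(1) \<pi>]
    have "a = (a + - b) + b" by simp
    then have "\<psi> a = \<psi> (a + - b) \<oplus>\<^bsub>E\<^esub> \<psi> b"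
      using L.\<psi>_add[OF ab(1) b(1) _ b(2)] ab(2) zm by (simp only:)
    then have "\<psi> (a + - b) = \<zero>\<^bsub>E\<^esub>"
      using b(3) L.\<psi>_closed[OF b(1,2)] L.\<psi>_closed[OF ab(1)] ab(2) zm
      by (simp add: E.M.add.r_cancel_one' del: add_uminus_conv_diff)
    then show ?thesis
      unfolding b_def[symmetric] F_eq[OF a(1) b(1)] B_minus[OF a(1) b(1)] K_def mem_Collect_eq
      using ab by (intro conjI)
  qed
  have fst_F: "fst (F a) = \<pi> a" for a by (simp add: F_def)
  have "ring_lift R \<mm> E g S fst (\<lambda>x. F (\<tau> x))"
  proof unfold_locales
    show "fst \<in> ring_hom S R"
      by (rule ring_hom_memI)
        (auto simp: S_carrier fst_F L.\<pi>_closed L.\<pi>_mult L.\<pi>_add L.mult_A L.add_A L.\<pi>_one F(4)[symmetric]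
          simp flip: F(2,3))
    show "fst ` carrier S = carrier R" using \<pi>_surj by (simp add: S_carrier image_image fst_F)
  next
    fix x assume x: "x \<in> carrier E"
    show "F (\<tau> x) \<in> carrier S" using \<tau>[OF x] by (simp add: S_carrier)
    show "fst (F (\<tau> x)) = g x" using \<tau>[OF x] L.g_\<psi>[of "\<tau> x"] by (simp add: fst_F)
    show "s \<otimes>\<^bsub>S\<^esub> F (\<tau> x) = F (\<tau> (fst s \<odot>\<^bsub>E\<^esub> x))" if sS: "s \<in> carrier S" for s
    proof -
      obtain a where a: "a \<in> A" "s = F a" using sS unfolding S_carrier by blast
      have "F (a * \<tau> x) = F (\<tau> (\<psi> (a * \<tau> x)))"
        using a \<tau>[OF x] by (intro F_\<tau>) (simp_all add: L.mult_A L.\<pi>_mult I_l_closed L.\<pi>_closed)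
      then show ?thesis using a \<tau>[OF x] by (simp add: fst_F L.\<psi>_mult flip: F(2))
    qed
    fix y assume y: "y \<in> carrier E"
    have "F (\<tau> x + \<tau> y) = F (\<tau> (\<psi> (\<tau> x + \<tau> y)))"
      using \<tau>[OF x] \<tau>[OF y] by (intro F_\<tau>) (simp_all add: L.add_A L.\<pi>_add)
    then show "F (\<tau> (x \<oplus>\<^bsub>E\<^esub> y)) = F (\<tau> x) \<oplus>\<^bsub>S\<^esub> F (\<tau> y)"
      using \<tau>[OF x] \<tau>[OF y] by (simp add: L.\<psi>_add flip: F(3))
  next
    show "inj_on (\<lambda>x. F (\<tau> x)) (carrier E)"
    proof (rule inj_onI)
      fix x y assume x: "x \<in> carrier E" and y: "y \<in> carrier E" and "F (\<tau> x) = F (\<tau> y)"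
      then have "\<tau> x + - \<tau> y \<in> K" using F_eq \<tau>(1)[OF x] \<tau>(1)[OF y] B_minus by metis
      then have d: "\<tau> x + - \<tau> y \<in> A" "\<pi> (\<tau> x + - \<tau> y) = \<zero>" "\<psi> (\<tau> x + - \<tau> y) = \<zero>\<^bsub>E\<^esub>"
        by (auto simp: K_def)
      have "\<tau> x = (\<tau> x + - \<tau> y) + \<tau> y" by simp
      then have "\<psi> (\<tau> x) = \<psi> (\<tau> x + - \<tau> y) \<oplus>\<^bsub>E\<^esub> \<psi> (\<tau> y)"
        using L.\<psi>_add[OF d(1) \<tau>(1)[OF y] _ \<tau>(2)[OF y]] d(2) zm by (simp only:)
      then show "x = y" using d(3) \<tau>(3)[OF x] \<tau>(3)[OF y] y by (simp del: add_uminus_conv_diff)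
    qed
    fix s assume "s \<in> carrier S" and s0: "fst s = \<zero>"
    then obtain a where a: "a \<in> A" "s = F a" unfolding S_carrier by blast
    then have "\<pi> a \<in> \<mm>" using s0 zm by (simp add: fst_F)
    then show "s \<in> (\<lambda>x. F (\<tau> x)) ` carrier E" using F_\<tau> a L.\<psi>_closed by blast
  qed
  then show ?thesis by blast
qed

section \<open>Local structure of the lifted ring\<close>

context ring_lift
begin

lemmas p_memE = ring_hom_memE[OF p_hom]

lemma p_surjE: assumes "r \<in> carrier R" obtains s where "s \<in> carrier S" "p s = r"
  using assms p_surj by (metis imageE)

lemma \<iota>_zero: "\<iota> \<zero>\<^bsub>E\<^esub> = \<zero>\<^bsub>S\<^esub>"
  using \<iota>_add[of "\<zero>\<^bsub>E\<^esub>" "\<zero>\<^bsub>E\<^esub>"] \<iota>_closed[of "\<zero>\<^bsub>E\<^esub>"] by (simp add: S.add.r_cancel_one')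

lemma \<iota>_eq_zero: "x \<in> carrier E \<Longrightarrow> \<iota> x = \<zero>\<^bsub>S\<^esub> \<longleftrightarrow> x = \<zero>\<^bsub>E\<^esub>"
  using inj_onD[OF \<iota>_inj, of x "\<zero>\<^bsub>E\<^esub>"] \<iota>_zero by auto

lemma p_zero: "p \<zero>\<^bsub>S\<^esub> = \<zero>"
  using p_\<iota>[of "\<zero>\<^bsub>E\<^esub>"] \<iota>_zero by simp

lemma p_diff: assumes "s \<in> carrier S" "t \<in> carrier S" shows "p (s \<ominus>\<^bsub>S\<^esub> t) = p s \<ominus> p t"
proof -
  have "p s = p (s \<ominus>\<^bsub>S\<^esub> t) \<oplus> p t"
    using assms p_memE(3)[of "s \<ominus>\<^bsub>S\<^esub> t" t] by (simp add: S.minus_eq S.a_assoc S.l_neg)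
  then show ?thesis using assms p_memE(1) by (simp add: minus_eq a_assoc r_neg)
qed

lemma p_maximal_iff:
  assumes s: "s \<in> carrier S"
  shows "p s \<in> \<mm> \<longleftrightarrow> s \<in> \<iota> ` carrier E"
proof
  assume "p s \<in> \<mm>"
  then obtain x where x: "x \<in> carrier E" "g x = p s" using g_surj by (metis imageE)
  have "p (s \<ominus>\<^bsub>S\<^esub> \<iota> x) = \<zero>" using x s \<iota>_closed p_\<iota> p_memE(1) by (simp add: p_diff minus_eq r_neg)
  then have "s \<ominus>\<^bsub>S\<^esub> \<iota> x \<in> \<iota> ` carrier E" using s x(1) \<iota>_closed by (intro ker_p) auto
  then obtain z where z: "z \<in> carrier E" "s \<ominus>\<^bsub>S\<^esub> \<iota> x = \<iota> z" by blast
  have "s = (s \<ominus>\<^bsub>S\<^esub> \<iota> x) \<oplus>\<^bsub>S\<^esub> \<iota> x" using s x \<iota>_closed by (simp add: S.minus_eq S.a_assoc S.l_neg)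
  then have "s = \<iota> (z \<oplus>\<^bsub>E\<^esub> x)" using z x by (simp add: \<iota>_add)
  then show "s \<in> \<iota> ` carrier E" using x z by blast
qed (auto simp: p_\<iota> g_maximal)

lemma \<iota>_ideal: "ideal (\<iota> ` carrier E) S"
proof (rule S.ideal_of_closed)
  show "\<zero>\<^bsub>S\<^esub> \<in> \<iota> ` carrier E" using \<iota>_zero by (metis E.M.zero_closed imageI)
qed (auto simp: \<iota>_closed \<iota>_mult p_memE(1) simp flip: \<iota>_add)

text \<open>The image of s in \<open>R\<close> is a unit, so s t = 1 - y for some t in S and y in
  ker p. Elements of ker p have square zero, and 1 + y inverts 1 - y.\<close>

lemma S_Units:
  assumes s: "s \<in> carrier S" "s \<notin> \<iota> ` carrier E"
  shows "s \<in> Units S"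
proof -
  have "p s \<in> Units R" using p_maximal_iff s p_memE(1) by (simp add: Units_iff)
  then obtain t where t: "t \<in> carrier S" "p t = inv (p s)" by (metis Units_inv_closed p_surjE)
  have st: "s \<otimes>\<^bsub>S\<^esub> t \<in> carrier S" using s t by simp
  have "p (s \<otimes>\<^bsub>S\<^esub> t) = \<one>" using s t \<open>p s \<in> Units R\<close> by (simp add: p_memE(2))
  then have "p (\<one>\<^bsub>S\<^esub> \<ominus>\<^bsub>S\<^esub> s \<otimes>\<^bsub>S\<^esub> t) = \<zero>" using st by (simp add: p_diff p_memE(4) minus_eq r_neg)
  then have "\<one>\<^bsub>S\<^esub> \<ominus>\<^bsub>S\<^esub> s \<otimes>\<^bsub>S\<^esub> t \<in> \<iota> ` carrier E" using st by (intro ker_p) auto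
  then obtain x where x: "x \<in> carrier E" "\<one>\<^bsub>S\<^esub> \<ominus>\<^bsub>S\<^esub> s \<otimes>\<^bsub>S\<^esub> t = \<iota> x" by blast
  have gx: "g x = \<zero>" using \<open>p (\<one>\<^bsub>S\<^esub> \<ominus>\<^bsub>S\<^esub> s \<otimes>\<^bsub>S\<^esub> t) = \<zero>\<close> x p_\<iota> by simp
  have ic: "\<iota> x \<in> carrier S" using x by (simp add: \<iota>_closed)
  have sq: "\<iota> x \<otimes>\<^bsub>S\<^esub> \<iota> x = \<zero>\<^bsub>S\<^esub>" using x ic gx by (simp add: \<iota>_mult p_\<iota> \<iota>_zero)
  have st_eq: "s \<otimes>\<^bsub>S\<^esub> t = \<one>\<^bsub>S\<^esub> \<ominus>\<^bsub>S\<^esub> \<iota> x"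
    unfolding x(2)[symmetric] using st by (simp add: S.minus_eq S.minus_add S.r_neg2)
  have "s \<otimes>\<^bsub>S\<^esub> (t \<otimes>\<^bsub>S\<^esub> (\<one>\<^bsub>S\<^esub> \<oplus>\<^bsub>S\<^esub> \<iota> x)) = (\<one>\<^bsub>S\<^esub> \<ominus>\<^bsub>S\<^esub> \<iota> x) \<otimes>\<^bsub>S\<^esub> (\<one>\<^bsub>S\<^esub> \<oplus>\<^bsub>S\<^esub> \<iota> x)"
    using s t ic by (simp add: st_eq flip: S.m_assoc)
  also have "\<dots> = \<one>\<^bsub>S\<^esub>"
    using ic sq by (simp add: S.minus_eq S.l_distr S.r_distr S.l_minus S.a_assoc S.r_neg S.l_neg)
  finally show ?thesis
    using s t ic unfolding Units_def by (auto simp: S.m_comm intro!: bexI[of _ "t \<otimes>\<^bsub>S\<^esub> (\<one>\<^bsub>S\<^esub> \<oplus>\<^bsub>S\<^esub> \<iota> x)"])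
qed

lemma image_ideal:
  assumes "ideal I S" shows "ideal (p ` I) R"
proof (rule ideal_of_closed)
  interpret I: ideal I S by fact
  show "p ` I \<subseteq> carrier R" using p_memE(1) I.Icarr by blast
  show "\<zero> \<in> p ` I" using p_zero by (metis I.zero_closed imageI)
  fix x y assume "x \<in> p ` I" "y \<in> p ` I"
  then obtain s t where "s \<in> I" "x = p s" "t \<in> I" "y = p t" by blast
  moreover from this have "x \<oplus> y = p (s \<oplus>\<^bsub>S\<^esub> t)" using p_memE(3) I.Icarr by simp
  ultimately show "x \<oplus> y \<in> p ` I" using I.a_closed by blast
next
  interpret I: ideal I S by fact
  fix r x assume "r \<in> carrier R" "x \<in> p ` I"
  then obtain s t where "s \<in> carrier S" "p s = r" "t \<in> I" "x = p t" by (metis p_surjE imageE)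
  moreover from this have "r \<otimes> x = p (s \<otimes>\<^bsub>S\<^esub> t)" using p_memE(2) I.Icarr by simp
  ultimately show "r \<otimes> x \<in> p ` I" using I.I_l_closed by blast
qed

lemma one_notin_\<iota>: "\<one>\<^bsub>S\<^esub> \<notin> \<iota> ` carrier E"
  using p_maximal_iff[of "\<one>\<^bsub>S\<^esub>"] p_memE(4) one_notin by simp

lemma proper_ideal_subset:
  assumes I: "ideal I S" "I \<noteq> carrier S"
  shows "I \<subseteq> \<iota> ` carrier E"
proof
  interpret I: ideal I S by fact
  fix s assume s: "s \<in> I"
  show "s \<in> \<iota> ` carrier E"
  proof (rule ccontr)
    assume "s \<notin> \<iota> ` carrier E"
    then have u: "s \<in> Units S" using S_Units s I.Icarr by blast
    have "inv\<^bsub>S\<^esub> s \<otimes>\<^bsub>S\<^esub> s \<in> I" using s S.Units_inv_closed[OF u] by (rule I.I_l_closed)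
    then show False using I.one_imp_carrier I(2) u by simp
  qed
qed

lemma maximalideal_\<iota>: "maximalideal (\<iota> ` carrier E) S"
proof (rule maximalidealI[OF \<iota>_ideal])
  show "carrier S \<noteq> \<iota> ` carrier E" using one_notin_\<iota> by auto
  fix J assume "ideal J S" "\<iota> ` carrier E \<subseteq> J" "J \<subseteq> carrier S"
  then show "J = \<iota> ` carrier E \<or> J = carrier S" using proper_ideal_subset by blast
qed

end

section \<open>Gorenstein property of the lifted ring\<close>

locale hull_ring_lift = ring_lift + artinian_local_ring_hull
begin

abbreviation \<nn> where "\<nn> \<equiv> \<iota> ` carrier E"

text \<open>For x in ker g, symmetry gives g(y) x = g(x) y = 0; as \<open>g\<close> is onto \<mm>, x
  lies in the socle of \<open>E\<close>. So ker p is generated by \<open>\<iota> e\<close>, and it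
  is simple, as every nonzero element of it has \<open>\<iota> e\<close> as a multiple.\<close>

lemma ker_p_multiple:
  assumes s: "s \<in> carrier S" "p s = \<zero>"
  shows "\<exists>t\<in>carrier S. s = t \<otimes>\<^bsub>S\<^esub> \<iota> e"
    and "s \<noteq> \<zero>\<^bsub>S\<^esub> \<Longrightarrow> \<exists>t\<in>carrier S. \<iota> e = t \<otimes>\<^bsub>S\<^esub> s"
proof -
  obtain x where x: "x \<in> carrier E" "s = \<iota> x" using ker_p s by blast
  have "a \<odot>\<^bsub>E\<^esub> x = \<zero>\<^bsub>E\<^esub>" if a: "a \<in> \<mm>" for a
  proof -
    obtain y where "y \<in> carrier E" "g y = a" using a g_surj by blast
    then show ?thesis using g_sym[of y x] x p_\<iota>[of x] s by simp
  qed
  then obtain r where r: "r \<in> carrier R" "x = r \<odot>\<^bsub>E\<^esub> e" using socle_cyclic x by blast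
  obtain t where "t \<in> carrier S" "p t = r" using r(1) by (rule p_surjE)
  then show "\<exists>t\<in>carrier S. s = t \<otimes>\<^bsub>S\<^esub> \<iota> e" using r x by (auto simp: \<iota>_mult)
  assume "s \<noteq> \<zero>\<^bsub>S\<^esub>"
  then have "x \<noteq> \<zero>\<^bsub>E\<^esub>" using x \<iota>_zero by auto
  then obtain c where c: "c \<in> carrier R" "c \<odot>\<^bsub>E\<^esub> x = e" using smult_eq_e x by blast
  obtain t where "t \<in> carrier S" "p t = c" using c(1) by (rule p_surjE)
  then show "\<exists>t\<in>carrier S. \<iota> e = t \<otimes>\<^bsub>S\<^esub> s" using c x by (auto simp: \<iota>_mult)
qed

text \<open>ker p is simple, so an ideal I meets it in zero or contains it. Lifts of generators of
  p(I), joined by \<open>\<iota> e\<close> if it belongs to I, therefore generate I.\<close>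

lemma noetherian_S: "noetherian_ring S"
proof (rule S.noetherian_ringI)
  fix I assume I: "ideal I S"
  interpret I: ideal I S by fact
  obtain A where A: "A \<subseteq> carrier R" "finite A" "p ` I = Idl A"
    using finetely_gen[OF image_ideal[OF I]] by blast
  then have "A \<subseteq> p ` I" using genideal_self by blast
  then obtain B where B: "B \<subseteq> I" "finite B" "A = p ` B" using A(2) finite_subset_image by metis
  define B' where "B' = (if \<iota> e \<in> I then insert (\<iota> e) B else B)"
  have B': "B' \<subseteq> I" "finite B'" "B \<subseteq> B'" using B by (auto simp: B'_def)
  have B'c: "B' \<subseteq> carrier S" using B'(1) I.a_subset by blast
  interpret J: ideal "Idl\<^bsub>S\<^esub> B'" S by (rule S.genideal_ideal[OF B'c])
  have BJ: "B' \<subseteq> Idl\<^bsub>S\<^esub> B'" by (rule S.genideal_self[OF B'c])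
  have "ideal (p ` (Idl\<^bsub>S\<^esub> B')) R" by (rule image_ideal[OF J.is_ideal])
  then have pI: "p ` I \<subseteq> p ` (Idl\<^bsub>S\<^esub> B')"
    unfolding A(3) using BJ B'(3) B(3) by (intro genideal_minimal) auto
  have "I \<subseteq> Idl\<^bsub>S\<^esub> B'"
  proof
    fix s assume s: "s \<in> I"
    then obtain y where y: "y \<in> Idl\<^bsub>S\<^esub> B'" "p s = p y" using pI by blast
    have "Idl\<^bsub>S\<^esub> B' \<subseteq> I" using B'(1) by (intro S.genideal_minimal I)
    then have yI: "y \<in> I" using y by blast
    define d where "d = s \<ominus>\<^bsub>S\<^esub> y"
    have d: "d \<in> I" "d \<in> carrier S" "p d = \<zero>"
      using s yI y(2) I.Icarr p_memE(1) p_diff[of s y]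
      by (auto simp: d_def I.a_inv_closed S.minus_eq minus_eq r_neg)
    have "d \<in> Idl\<^bsub>S\<^esub> B'"
    proof (cases "d = \<zero>\<^bsub>S\<^esub>")
      case False
      then have "\<iota> e \<in> I" using ker_p_multiple(2)[OF d(2,3)] d(1) I.I_l_closed by auto
      then have "\<iota> e \<in> Idl\<^bsub>S\<^esub> B'" using BJ by (auto simp: B'_def)
      then show ?thesis using ker_p_multiple(1)[OF d(2,3)] J.I_l_closed by auto
    qed simp
    moreover have "s = d \<oplus>\<^bsub>S\<^esub> y"
      using s yI I.Icarr by (simp add: d_def S.minus_eq S.a_assoc S.l_neg)
    ultimately show "s \<in> Idl\<^bsub>S\<^esub> B'" using y by simp
  qed
  moreover have "Idl\<^bsub>S\<^esub> B' \<subseteq> I" using B'(1) by (intro S.genideal_minimal I)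
  ultimately show "\<exists>A\<subseteq>carrier S. finite A \<and> I = Idl\<^bsub>S\<^esub> A" using B'c B'(2) by blast
qed

lemma local_ring_S: "local_ring S \<nn>"
proof (intro local_ring.intro local_ring_axioms.intro S.is_cring noetherian_S maximalideal_\<iota>)
  fix I assume "maximalideal I S"
  then interpret I: maximalideal I S .
  have "I \<subseteq> \<nn>" using I.is_ideal I.I_notcarr by (intro proper_ideal_subset) auto
  then show "I = \<nn>" using I.I_maximal[OF \<iota>_ideal] one_notin_\<iota> \<iota>_closed by blast
qed

text \<open>Elements of \<nn> become nilpotent in \<open>R\<close>, and elements of ker p have
  square zero. So \<nn> consists of nilpotent elements and lies in every prime ideal.\<close>

lemma primeideal_S:
  assumes "primeideal P S" shows "P = \<nn>"
proof
  interpret P: primeideal P S by fact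
  show "P \<subseteq> \<nn>" using P.is_ideal P.I_notcarr by (intro proper_ideal_subset) auto
  have power: "s \<in> P" if "s [^]\<^bsub>S\<^esub> n \<in> P" "s \<in> carrier S" for s and n :: nat
    using that
  proof (induction n)
    case 0
    then show ?case using P.one_imp_carrier P.I_notcarr by simp
  next
    case (Suc n)
    then show ?case using P.I_prime[of "s [^]\<^bsub>S\<^esub> n" s] by auto
  qed
  show "\<nn> \<subseteq> P"
  proof
    fix s assume "s \<in> \<nn>"
    then have s: "s \<in> carrier S" "p s \<in> \<mm>" using \<iota>_closed p_maximal_iff by auto
    then obtain n :: nat where n: "p s [^] n = \<zero>" using nilpotent_maximal by blast
    have pp: "p (s [^]\<^bsub>S\<^esub> n) = p s [^] n" for n :: nat
      by (induction n) (simp_all add: p_memE s)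
    then obtain x where x: "x \<in> carrier E" "s [^]\<^bsub>S\<^esub> n = \<iota> x" using ker_p[of "s [^]\<^bsub>S\<^esub> n"] s n by auto
    have "g x = \<zero>" using x p_\<iota>[of x] pp[of n] n by metis
    then have "\<iota> x \<otimes>\<^bsub>S\<^esub> \<iota> x = \<zero>\<^bsub>S\<^esub>" using x by (simp add: \<iota>_mult \<iota>_closed p_\<iota> \<iota>_zero)
    then have "\<iota> x \<in> P" using P.I_prime[of "\<iota> x" "\<iota> x"] x \<iota>_closed by auto
    then show "s \<in> P" using power x s by metis
  qed
qed

lemma krull_dim_S: "krull_dim S = 0"
proof -
  have "n = 0" if "\<forall>i\<le>n. primeideal (P i) S" "\<forall>i<n. P i \<subset> P (Suc i)" for n and P :: "nat \<Rightarrow> _ set"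
  proof (rule ccontr)
    assume "n \<noteq> 0"
    then have "P 0 \<subset> P (Suc 0)" "P 0 = \<nn>" "P (Suc 0) = \<nn>" using that primeideal_S by auto
    then show False by simp
  qed
  then have "krull_dim S \<le> enat 0" unfolding krull_dim_def
    by (intro SUP_least) fastforce
  then show ?thesis by (simp add: zero_enat_def[symmetric])
qed

text \<open>An element s acts on \<nn>, a copy of \<open>E\<close>, through \<open>p s\<close>, and
  \<open>E\<close> is faithful over \<open>R\<close>.\<close>

lemma socle_S: "socle S \<nn> = a_kernel S R p"
proof
  show "socle S \<nn> \<subseteq> a_kernel S R p"
  proof
    fix s assume "s \<in> socle S \<nn>"
    then have s: "s \<in> carrier S" "\<And>y. y \<in> carrier E \<Longrightarrow> s \<otimes>\<^bsub>S\<^esub> \<iota> y = \<zero>\<^bsub>S\<^esub>" by (auto simp: socle_def)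
    then have "p s \<odot>\<^bsub>E\<^esub> y = \<zero>\<^bsub>E\<^esub>" if "y \<in> carrier E" for y
      using that \<iota>_mult[of s y] \<iota>_eq_zero[of "p s \<odot>\<^bsub>E\<^esub> y"] p_memE(1) by simp
    then have "p s = \<zero>" using faithful p_memE(1) s by blast
    then show "s \<in> a_kernel S R p" using s by (simp add: a_kernel_def')
  qed
  show "a_kernel S R p \<subseteq> socle S \<nn>"
    by (auto simp: a_kernel_def' socle_def \<iota>_mult \<iota>_zero)
qed

text \<open>Inside \<nn> the multiples reaching \<open>\<iota> e\<close> come from \<open>E\<close>.
  For self-injectivity, a linear map from a proper ideal turns out to have values in \<nn>, so it is
  an R-linear map from a submodule of \<open>E\<close> to \<open>E\<close>. It extends to an
  endomorphism of \<open>E\<close>, a multiplication by some r, and any preimage of r under p is the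
  multiplier demanded by Baer's criterion.\<close>

lemma generator_S: "injective_hull_generator S \<nn> (ring_module S) (\<iota> e)"
  unfolding injective_hull_generator_def
proof (intro conjI ballI impI)
  show ec: "\<iota> e \<in> carrier (ring_module S)" by (simp add: \<iota>_closed)
  show "\<iota> e \<noteq> \<zero>\<^bsub>ring_module S\<^esub>" using \<iota>_eq_zero e_nonzero by simp
  have n_e: "a \<otimes>\<^bsub>S\<^esub> \<iota> e = \<zero>\<^bsub>S\<^esub>" if "a \<in> \<nn>" for a
    using that by (auto simp: \<iota>_mult \<iota>_closed p_\<iota> g_maximal maximal_smult_e \<iota>_zero)
  then show "a \<odot>\<^bsub>ring_module S\<^esub> \<iota> e = \<zero>\<^bsub>ring_module S\<^esub>" if "a \<in> \<nn>" for a using that by simp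
  show "\<exists>t\<in>carrier S. t \<odot>\<^bsub>ring_module S\<^esub> s = \<iota> e"
    if s: "s \<in> carrier (ring_module S)" "s \<noteq> \<zero>\<^bsub>ring_module S\<^esub>" for s
  proof (cases "s \<in> \<nn>")
    case True
    then obtain x where x: "x \<in> carrier E" "s = \<iota> x" by blast
    then have "x \<noteq> \<zero>\<^bsub>E\<^esub>" using s(2) \<iota>_zero by auto
    then obtain r where r: "r \<in> carrier R" "r \<odot>\<^bsub>E\<^esub> x = e" using smult_eq_e x by blast
    obtain t where "t \<in> carrier S" "p t = r" using r(1) by (rule p_surjE)
    then show ?thesis using r x by (auto simp: \<iota>_mult)
  next
    case False
    then have u: "s \<in> Units S" using s(1) S_Units by simp
    have "(\<iota> e \<otimes>\<^bsub>S\<^esub> inv\<^bsub>S\<^esub> s) \<otimes>\<^bsub>S\<^esub> s = \<iota> e"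
      using u ec S.m_assoc[of "\<iota> e" "inv\<^bsub>S\<^esub> s" s] by (simp add: S.Units_closed)
    then show ?thesis using u ec by (intro bexI[of _ "\<iota> e \<otimes>\<^bsub>S\<^esub> inv\<^bsub>S\<^esub> s"]) auto
  qed
  show "injective_module S (ring_module S)"
  proof (rule baer_criterion[OF module_ring_module[OF S.is_cring]])
    fix I h assume I: "ideal I S" and h: "h \<in> mod_hom S (ideal_module S I) (ring_module S)"
    interpret I: ideal I S by fact
    note h' = mod_homD[OF h, simplified]
    show "\<exists>y\<in>carrier (ring_module S). \<forall>r\<in>I. h r = r \<odot>\<^bsub>ring_module S\<^esub> y"
    proof (cases "I = carrier S")
      case True
      then have one: "\<one>\<^bsub>S\<^esub> \<in> I" by simp
      have "h r = r \<otimes>\<^bsub>S\<^esub> h \<one>\<^bsub>S\<^esub>" if "r \<in> carrier S" for r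
        using h'(3)[OF that one] unfolding S.r_one[OF that] .
      then have "\<forall>r\<in>I. h r = r \<odot>\<^bsub>ring_module S\<^esub> h \<one>\<^bsub>S\<^esub>" unfolding ring_module_simps using I.Icarr by blast
      moreover have "h \<one>\<^bsub>S\<^esub> \<in> carrier (ring_module S)" using h'(1)[OF one] by simp
      ultimately show ?thesis by blast
    next
      case False
      then have In: "I \<subseteq> \<nn>" using I proper_ideal_subset by blast
      \<comment> \<open>\<open>\<iota> e\<close> kills I and hence all values of \<open>h\<close>,
        but it kills no unit.\<close>
      have hn: "h s \<in> \<nn>" if s: "s \<in> I" for s
      proof (rule ccontr)
        assume "h s \<notin> \<nn>"
        then have u: "h s \<in> Units S" using h'(1)[OF s] S_Units by blast
        have "\<iota> e \<otimes>\<^bsub>S\<^esub> s = \<zero>\<^bsub>S\<^esub>" using n_e[of s] In s ec I.Icarr[OF s] by (auto simp: S.m_comm)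
        moreover have "h \<zero>\<^bsub>S\<^esub> = \<zero>\<^bsub>S\<^esub>"
          using mod_hom_zero[OF module_ideal_module[OF S.is_cring I] module_ring_module[OF S.is_cring] h] by simp
        ultimately have "\<iota> e \<otimes>\<^bsub>S\<^esub> h s = \<zero>\<^bsub>S\<^esub>" using h'(3)[of "\<iota> e" s] s ec by simp
        then have "(\<iota> e \<otimes>\<^bsub>S\<^esub> h s) \<otimes>\<^bsub>S\<^esub> inv\<^bsub>S\<^esub> (h s) = \<zero>\<^bsub>S\<^esub>" using u by simp
        then have "\<iota> e = \<zero>\<^bsub>S\<^esub>" using u ec h'(1)[OF s] by (simp add: S.m_assoc)
        then show False using \<iota>_eq_zero e_nonzero by simp
      qed
      define W where "W = {x \<in> carrier E. \<iota> x \<in> I}"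
      have W: "module R (E\<lparr>carrier := W\<rparr>)"
      proof (rule E.module_of_closed)
        fix r x assume r: "r \<in> carrier R" and x: "x \<in> W"
        obtain s where "s \<in> carrier S" "p s = r" using r by (rule p_surjE)
        then show "r \<odot>\<^bsub>E\<^esub> x \<in> W" using r x I.I_l_closed[of "\<iota> x" s] by (auto simp: W_def \<iota>_mult)
      qed (auto simp: W_def \<iota>_zero \<iota>_add)
      define \<phi> where "\<phi> x = inv_into (carrier E) \<iota> (h (\<iota> x))" for x
      have \<phi>: "\<phi> x \<in> carrier E" "\<iota> (\<phi> x) = h (\<iota> x)" if "x \<in> W" for x
        using hn[of "\<iota> x"] that unfolding \<phi>_def W_def
        by (auto simp: inv_into_into f_inv_into_f)
      have \<phi>I: "\<phi> x = y" if "x \<in> W" "y \<in> carrier E" "h (\<iota> x) = \<iota> y" for x y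
        using inj_onD[OF \<iota>_inj, of "\<phi> x" y] \<phi> that by simp
      have "\<phi> \<in> mod_hom R (E\<lparr>carrier := W\<rparr>) E"
      proof (rule mod_homI)
        fix x y assume "x \<in> carrier (E\<lparr>carrier := W\<rparr>)" "y \<in> carrier (E\<lparr>carrier := W\<rparr>)"
        then have xy: "x \<in> W" "y \<in> W" by auto
        have "h (\<iota> (x \<oplus>\<^bsub>E\<^esub> y)) = \<iota> (\<phi> x \<oplus>\<^bsub>E\<^esub> \<phi> y)"
          using xy \<phi>[OF xy(1)] \<phi>[OF xy(2)] h'(2) by (simp add: W_def \<iota>_add)
        moreover have "x \<oplus>\<^bsub>E\<^esub> y \<in> W" using xy by (simp add: W_def \<iota>_add)
        ultimately show "\<phi> (x \<oplus>\<^bsub>E\<lparr>carrier := W\<rparr>\<^esub> y) = \<phi> x \<oplus>\<^bsub>E\<^esub> \<phi> y"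
          using xy \<phi> by (simp add: \<phi>I)
      next
        fix r x assume r: "r \<in> carrier R" and "x \<in> carrier (E\<lparr>carrier := W\<rparr>)"
        then have x: "x \<in> W" by auto
        obtain s where s: "s \<in> carrier S" "p s = r" using r by (rule p_surjE)
        have sx: "\<iota> (r \<odot>\<^bsub>E\<^esub> x) = s \<otimes>\<^bsub>S\<^esub> \<iota> x" using s x \<iota>_mult by (simp add: W_def)
        have "h (\<iota> (r \<odot>\<^bsub>E\<^esub> x)) = \<iota> (r \<odot>\<^bsub>E\<^esub> \<phi> x)"
          unfolding sx using s x \<phi>[OF x] h'(3)[of s "\<iota> x"] \<iota>_mult[of s "\<phi> x"] by (simp add: W_def)
        moreover have "r \<odot>\<^bsub>E\<^esub> x \<in> W" using r x s sx I.I_l_closed by (simp add: W_def)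
        ultimately show "\<phi> (r \<odot>\<^bsub>E\<lparr>carrier := W\<rparr>\<^esub> x) = r \<odot>\<^bsub>E\<^esub> \<phi> x"
          using r x \<phi> by (simp add: \<phi>I)
      qed (use \<phi> in auto)
      moreover from mod_hom_zero[OF W E.module_axioms this] have "\<phi> \<zero>\<^bsub>E\<^esub> = \<zero>\<^bsub>E\<^esub>" by simp
      moreover have "(\<lambda>x. x) \<in> mod_hom R (E\<lparr>carrier := W\<rparr>) E"
        by (rule mod_homI) (auto simp: W_def)
      ultimately have "\<exists>h'\<in>mod_hom R E E. \<forall>x\<in>carrier (E\<lparr>carrier := W\<rparr>). h' x = \<phi> x"
        by (intro injective_module_factor[OF injective W E.module_axioms]) auto
      then obtain h'' where h'': "h'' \<in> mod_hom R E E" "\<And>x. x \<in> W \<Longrightarrow> h'' x = \<phi> x" by auto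
      obtain r where r: "r \<in> carrier R" "\<And>x. x \<in> carrier E \<Longrightarrow> h'' x = r \<odot>\<^bsub>E\<^esub> x"
        using homothety[OF h''(1)] by blast
      obtain y where y: "y \<in> carrier S" "p y = r" using r(1) by (rule p_surjE)
      have "h t = t \<otimes>\<^bsub>S\<^esub> y" if t: "t \<in> I" for t
      proof -
        obtain x where x: "x \<in> carrier E" "t = \<iota> x" using In t by blast
        then have "x \<in> W" using t by (simp add: W_def)
        then have "h t = \<iota> (r \<odot>\<^bsub>E\<^esub> x)" using \<phi>(2) h''(2) r(2)[OF x(1)] x(2) by metis
        also have "\<dots> = y \<otimes>\<^bsub>S\<^esub> t" using x y \<iota>_mult by simp
        finally show ?thesis using y I.Icarr[OF t] by (simp add: S.m_comm)
      qed
      then show ?thesis using y by auto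
    qed
  qed
qed

lemma gorenstein_S: "zero_dim_gorenstein_local_ring S \<nn>"
  unfolding zero_dim_gorenstein_local_ring_def
  using local_ring_S krull_dim_S local_ring.generator_imp_canonical_module[OF local_ring_S generator_S] by blast

lemma quotient_iso: "R \<simeq> S Quot socle S \<nn>"
proof -
  interpret p: ring_hom_ring S R p
    by (rule ring_hom_ringI2[OF S.ring_axioms ring_axioms p_hom])
  show ?thesis
    unfolding socle_S
    by (rule ring_iso_sym[OF ideal.quotient_is_ring[OF p.kernel_is_ideal] p.FactRing_iso[OF p_surj]])
qed

end

(* The two implications of the equivalence. HOL cannot quantify over rings of all types: in the
   forward direction the ring S is carried by an arbitrary type 'b, while the converse claims a
   ring carried by 'a \<times> 'a, which is large enough for every S with R \<simeq> S Quot socle S \<nn>,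
   as S then has cardinality |R| * |k|. For 'b = 'a \<times> 'a this is literally the equivalence. *)
theorem theorem2p5:
  fixes R :: "('a, 'm) ring_scheme" (structure)
    and \<mm> :: "'a set"
    and \<omega> :: "('a, 'e, 'p) module_scheme"
  assumes "artinian_local_ring R \<mm>"
    and "canonical_module R \<mm> \<omega>"
    and "\<one> \<oplus> \<one> \<in> Units R"
    and "socle R \<mm> \<subseteq> \<mm> \<cdot> \<mm>"
  shows "((\<exists>(S :: 'b ring) \<nn>. zero_dim_gorenstein_local_ring S \<nn> \<and> R \<simeq> S Quot socle S \<nn>)
            \<longrightarrow> (\<exists>f\<in>mod_hom R \<omega> (ideal_module R \<mm>). f ` carrier \<omega> = \<mm>))
       \<and> ((\<exists>f\<in>mod_hom R \<omega> (ideal_module R \<mm>). f ` carrier \<omega> = \<mm>)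
            \<longrightarrow> (\<exists>(S :: ('a \<times> 'a) ring) \<nn>. zero_dim_gorenstein_local_ring S \<nn> \<and> R \<simeq> S Quot socle S \<nn>))"
proof -
  interpret R: artinian_local_ring R \<mm> by fact
  obtain e where e: "injective_hull_generator R \<mm> \<omega> e"
    using R.canonical_module_imp_generator assms(2) by blast
  then have \<omega>: "module R \<omega>" by (simp add: injective_hull_generator_def injective_module_def)
  interpret H: artinian_local_ring_hull R \<mm> \<omega> e
    by (intro artinian_local_ring_hull.intro local_ring_hull.intro local_ring_hull_axioms.intro
        R.local_ring_axioms assms(1) \<omega> e)
  show ?thesis
  proof (intro conjI impI)
    assume "\<exists>(S :: 'b ring) \<nn>. zero_dim_gorenstein_local_ring S \<nn> \<and> R \<simeq> S Quot socle S \<nn>"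
    then obtain S :: "'b ring" and \<nn> where S: "local_ring S \<nn>" "canonical_module S \<nn> (ring_module S)"
      and iso: "R \<simeq> S Quot socle S \<nn>"
      by (auto simp: zero_dim_gorenstein_local_ring_def)
    interpret S: local_ring S \<nn> by fact
    interpret I: ideal "socle S \<nn>" S by (rule S.socle_ideal)
    obtain s0 where s0: "injective_hull_generator S \<nn> (ring_module S) s0"
      using S.canonical_module_imp_generator S(2) by blast
    obtain \<phi> where "\<phi> \<in> ring_iso (S Quot socle S \<nn>) R"
      using ring_iso_sym[OF R.ring_axioms iso] by (auto simp: is_ring_iso_def)
    then have \<phi>: "\<phi> \<in> ring_hom (S Quot socle S \<nn>) R"
      "bij_betw \<phi> (carrier (S Quot socle S \<nn>)) (carrier R)"
      by (auto simp: ring_iso_def)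
    define \<rho> where "\<rho> = \<phi> \<circ> (+>\<^bsub>S\<^esub>) (socle S \<nn>)"
    have \<rho>: "\<rho> \<in> ring_hom S R"
      unfolding \<rho>_def by (rule ring_hom_trans[OF I.rcos_ring_hom \<phi>(1)])
    have cosets: "carrier (S Quot socle S \<nn>) = (+>\<^bsub>S\<^esub>) (socle S \<nn>) ` carrier S"
      by (auto simp: FactRing_def A_RCOSETS_def')
    have surj: "\<rho> ` carrier S = carrier R"
      using \<phi>(2) by (simp add: \<rho>_def bij_betw_def cosets image_comp)
    interpret \<rho>: ring_hom_ring S R \<rho>
      by (rule ring_hom_ringI2[OF S.ring_axioms R.ring_axioms \<rho>])
    have "\<rho> s = \<zero> \<longleftrightarrow> s \<in> socle S \<nn>" if s: "s \<in> carrier S" for s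
    proof -
      have "\<rho> s = \<zero> \<longleftrightarrow> \<rho> s = \<rho> \<zero>\<^bsub>S\<^esub>" by simp
      also have "\<dots> \<longleftrightarrow> socle S \<nn> +>\<^bsub>S\<^esub> s = socle S \<nn> +>\<^bsub>S\<^esub> \<zero>\<^bsub>S\<^esub>"
        using \<phi>(2) s by (auto simp: \<rho>_def bij_betw_def cosets dest: inj_onD)
      also have "\<dots> \<longleftrightarrow> s \<ominus>\<^bsub>S\<^esub> \<zero>\<^bsub>S\<^esub> \<in> socle S \<nn>"
        by (rule S.quotient_eq_iff_same_a_r_cos[symmetric]) (use s I.is_ideal in auto)
      finally show ?thesis using s by (simp add: S.minus_eq)
    qed
    then show "\<exists>f\<in>mod_hom R \<omega> (ideal_module R \<mm>). f ` carrier \<omega> = \<mm>"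
      by (rule H.surjection_of_socle_quotient[OF S(1) s0 \<rho> surj])
  next
    assume "\<exists>f\<in>mod_hom R \<omega> (ideal_module R \<mm>). f ` carrier \<omega> = \<mm>"
    then obtain g where g: "g \<in> mod_hom R \<omega> (ideal_module R \<mm>)" "g ` carrier \<omega> = \<mm>"
      "\<And>x y. x \<in> carrier \<omega> \<Longrightarrow> y \<in> carrier \<omega> \<Longrightarrow> g x \<odot>\<^bsub>\<omega>\<^esub> y = g y \<odot>\<^bsub>\<omega>\<^esub> x"
      using H.exists_symmetric_surjection assms(3,4) by metis
    interpret G: symmetric_surjection R \<mm> \<omega> g
      by (intro symmetric_surjection.intro symmetric_surjection_axioms.intro R.local_ring_axioms \<omega> g)
    \<comment> \<open>Over a field the socle is the whole ring, against the socle hypothesis. A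
      nonzero element of \<mm> is what forces a submodule mapping onto \<mm> to contain
      \<open>e\<close>.\<close>
    have "\<mm> \<noteq> {\<zero>}"
    proof
      assume m0: "\<mm> = {\<zero>}"
      then have "\<one> \<in> socle R \<mm>" by (simp add: socle_def)
      then have "\<one> \<in> \<mm>"
        using assms(4) R.ideal_prod_inter[OF R.is_ideal R.is_ideal] by blast
      then show False using R.one_notin by simp
    qed
    then obtain a where a: "a \<in> \<mm>" "a \<noteq> \<zero>" using R.zero_closed by blast
    have ker: "\<exists>r\<in>carrier R. x = r \<odot>\<^bsub>\<omega>\<^esub> e" if x: "x \<in> carrier \<omega>" "g x = \<zero>" for x
    proof (rule H.socle_cyclic[OF x(1)])
      fix b assume "b \<in> \<mm>"
      then obtain y where "y \<in> carrier \<omega>" "b = g y" using g(2) by blast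
      then show "b \<odot>\<^bsub>\<omega>\<^esub> x = \<zero>\<^bsub>\<omega>\<^esub>" using g(3)[of y x] x by simp
    qed
    \<comment> \<open>ker g is the line R e, so each of its elements is identified by a coefficient
      of \<open>e\<close>.\<close>
    define code where "code x = (SOME r. x = r \<odot>\<^bsub>\<omega>\<^esub> e)" for x
    have code: "x = code x \<odot>\<^bsub>\<omega>\<^esub> e" if "x \<in> carrier \<omega>" "g x = \<zero>" for x
      unfolding code_def using ker[OF that] by (metis (mono_tags, lifting) someI)
    have "W = carrier \<omega>" if W: "submodule W R \<omega>" and gW: "g ` W = \<mm>" for W
    proof
      interpret W: submodule W R \<omega> by fact
      have Wc: "W \<subseteq> carrier \<omega>" using W.subset by simp
      have Wa: "x \<oplus>\<^bsub>\<omega>\<^esub> y \<in> W" if "x \<in> W" "y \<in> W" for x y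
        using H.E.submoduleE(5)[OF W] that by blast
      \<comment> \<open>A nonzero element of W has \<open>e\<close> among its multiples, so W
        contains R e, which is ker g. As W also maps onto \<mm>, it is all of \<omega>.\<close>
      obtain w where w: "w \<in> W" "g w = a" using a gW by blast
      then have "w \<noteq> \<zero>\<^bsub>\<omega>\<^esub>" using a(2) by auto
      then obtain r where "r \<in> carrier R" "r \<odot>\<^bsub>\<omega>\<^esub> w = e" using H.smult_eq_e w Wc by blast
      then have eW: "e \<in> W" using W.smult_closed w by blast
      show "carrier \<omega> \<subseteq> W"
      proof
        fix x assume x: "x \<in> carrier \<omega>"
        then have "g x \<in> g ` W" using G.g_maximal gW by blast
        then obtain y where y: "y \<in> W" "g x = g y" by (elim imageE) blast
        then have yc: "y \<in> carrier \<omega>" using Wc by blast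
        have "g (x \<ominus>\<^bsub>\<omega>\<^esub> y) = \<zero>"
          using x yc y(2) by (simp add: H.E.M.minus_eq G.g_add G.g_minus R.r_neg)
        then obtain c where c: "c \<in> carrier R" "x \<ominus>\<^bsub>\<omega>\<^esub> y = c \<odot>\<^bsub>\<omega>\<^esub> e"
          using ker[of "x \<ominus>\<^bsub>\<omega>\<^esub> y"] x yc by auto
        have "x = (x \<ominus>\<^bsub>\<omega>\<^esub> y) \<oplus>\<^bsub>\<omega>\<^esub> y"
          using x yc by (simp add: H.E.M.minus_eq H.E.M.a_assoc H.E.M.l_neg)
        then show "x \<in> W" using Wa[OF W.smult_closed[OF c(1) eW] y(1)] c(2) by simp
      qed
    qed (use submodule.axioms(1)[OF W] subgroup.subset in force)
    moreover have "inj_on code {x \<in> carrier \<omega>. g x = \<zero>}"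
    proof (rule inj_onI)
      fix x y assume x: "x \<in> {x \<in> carrier \<omega>. g x = \<zero>}" and y: "y \<in> {x \<in> carrier \<omega>. g x = \<zero>}"
        and eq: "code x = code y"
      have "x = code x \<odot>\<^bsub>\<omega>\<^esub> e" using x by (intro code) auto
      also have "\<dots> = y" unfolding eq using y by (intro code[symmetric]) auto
      finally show "x = y" .
    qed
    ultimately obtain S :: "('a \<times> 'a) ring" and p \<iota> where "ring_lift R \<mm> \<omega> g S p \<iota>"
      using G.exists_ring_lift by blast
    then interpret L: hull_ring_lift R \<mm> \<omega> g S p \<iota> e
      by (intro hull_ring_lift.intro H.artinian_local_ring_hull_axioms)
    show "\<exists>(S :: ('a \<times> 'a) ring) \<nn>. zero_dim_gorenstein_local_ring S \<nn> \<and> R \<simeq> S Quot socle S \<nn>"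
      using L.gorenstein_S L.quotient_iso by blast
  qed
qed

end
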